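(* Let $\Psi$ be a $\delta'$-like potential and let $\alpha\in\mathbb{R}$. Then the family of Hamiltonians $H_\varepsilon(\alpha,\Psi)$ converges in the norm resolvent sense, as $\varepsilon\to 0$ (with $\varepsilon>0$), to $H(\alpha,\Psi)$.
   Context: A (real-valued) function $\Psi\in C_0^\infty(\mathbb{R})$ with $\operatorname{supp}\Psi=[-1,1]$ is called a $\delta'$-like potential if $\int_{\mathbb{R}}\Psi(\xi)\,d\xi=0$ and $\int_{\mathbb{R}}\xi\Psi(\xi)\,d\xi=-1$. For $\varepsilon>0$, $H_\varepsilon(\alpha,\Psi)=-\frac{d^2}{dx^2}+\frac{\alpha}{\varepsilon^2}\Psi(\varepsilon^{-1}x)$ is the self-adjoint operator in $L_2(\mathbb{R})$ with domain the Sobolev space $W_2^2(\mathbb{R})$. The resonant set $\Sigma_\Psi$ is the set of all $\alpha\in\mathbb R$ for which the problem $$-w''+\alpha\Psi(\xi)w=0,\quad \xi\in(-1,1),\qquad w'(-1)=w'(1)=0$$ has a non-trivial solution $w_\alpha$ (in particular $0\in\Sigma_\Psi$). The coupling function $\theta_\Psi:\Sigma_\Psi\to\mathbb{R}$ is $\theta_\Psi(\alpha)=w_\alpha(1)/w_\alpha(-1)$, which is well defined, real, non-zero and independent of the choice of $w_\alpha$ (so $\theta_\Psi(0)=1$). $W_2^2(\mathbb{R}\setminus\{0\})$ is the Sobolev space of functions on $\mathbb{R}\setminus\{0\}$ in $L_2$ together with their (distributional on $\mathbb{R}\setminus\{0\}$) derivatives up to order $2$. For real $\theta\ne0$, $S(\theta)$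 is the self-adjoint operator $S(\theta)y=-y''$ in $L_2(\mathbb{R})$ with domain $\{y\in W_2^2(\mathbb{R}\setminus\{0\}): y(0+)=\theta y(0-),\ \theta y'(0+)=y'(0-)\}$. $S_-\oplus S_+$ is the direct sum of the operators $S_\pm=-d^2/dx^2$ in $L_2(\mathbb{R}_\pm)$ subject to the Dirichlet condition at $x=0$, with domains $\{y\in W_2^2(\mathbb{R}_\pm):y(0\pm)=0\}$. The operator $H(\alpha,\Psi)$ is defined by $H(\alpha,\Psi)=S_-\oplus S_+$ if $\alpha\notin\Sigma_\Psi$, and $H(\alpha,\Psi)=S(\theta_\Psi(\alpha))$ if $\alpha\in\Sigma_\Psi$. Norm resolvent convergence $H_\varepsilon\to H$ means $\|(H_\varepsilon-z)^{-1}-(H-z)^{-1}\|\to0$ in operator norm on $L_2(\mathbb{R})$ for $z\in\mathbb{C}\setminus\mathbb{R}$. *)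

theory Defs
  imports "HOL-Analysis.Analysis"
begin

section \<open>The Hilbert space of square-integrable functions on the real line\<close>

definition square_integrable :: "(real \<Rightarrow> complex) \<Rightarrow> bool" where
  "square_integrable f \<longleftrightarrow>
     f \<in> borel_measurable lborel \<and> integrable lborel (\<lambda>x. (norm (f x))\<^sup>2)"

definition l2_eq :: "(real \<Rightarrow> complex) \<Rightarrow> (real \<Rightarrow> complex) \<Rightarrow> bool" where
  "l2_eq f g \<longleftrightarrow> square_integrable f \<and> square_integrable g \<and> (AE x in lborel. f x = g x)"

lemma square_integrable_measurable [measurable_dest]:
  "square_integrable f \<Longrightarrow> f \<in> borel_measurable lborel"
  by (simp add: square_integrable_def)

lemma square_integrable_zero: "square_integrable (\<lambda>x. 0)"
  by (simp add: square_integrable_def)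

lemma square_integrable_add:
  assumes f: "square_integrable f" and g: "square_integrable g"
  shows "square_integrable (\<lambda>x. f x + g x)"
proof -
  have [measurable]: "f \<in> borel_measurable lborel" "g \<in> borel_measurable lborel"
    using f g by (auto simp: square_integrable_def)
  have "integrable lborel (\<lambda>x. 2 * (norm (f x))\<^sup>2 + 2 * (norm (g x))\<^sup>2)"
    using f g by (auto simp: square_integrable_def)
  moreover have "norm ((norm (f x + g x))\<^sup>2) \<le> norm (2 * (norm (f x))\<^sup>2 + 2 * (norm (g x))\<^sup>2)" for x
  proof -
    have "(norm (f x + g x))\<^sup>2 \<le> (norm (f x) + norm (g x))\<^sup>2"
      by (intro power_mono norm_triangle_ineq) simp
    also have "\<dots> \<le> 2 * (norm (f x))\<^sup>2 + 2 * (norm (g x))\<^sup>2"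
      using sum_squares_bound[of "norm (f x)" "norm (g x)"] by (simp add: power2_sum)
    finally show ?thesis by simp
  qed
  ultimately show ?thesis
    unfolding square_integrable_def
    by (auto intro!: Bochner_Integration.integrable_bound[where g = "\<lambda>x. (norm (f x + g x))\<^sup>2"])
qed

lemma square_integrable_mult:
  assumes "square_integrable f"
  shows "square_integrable (\<lambda>x. c * f x)"
  using assms by (auto simp: square_integrable_def norm_mult power_mult_distrib)

lemma square_integrable_minus: "square_integrable f \<Longrightarrow> square_integrable (\<lambda>x. - f x)"
  using square_integrable_mult[of f "-1"] by simp

lemma square_integrable_inner:
  assumes f: "square_integrable f" and g: "square_integrable g"
  shows "integrable lborel (\<lambda>x. f x \<bullet> g x)"
proof -
  have [measurable]: "f \<in> borel_measurable lborel" "g \<in> borel_measurable lborel"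
    using f g by (auto simp: square_integrable_def)
  have "integrable lborel (\<lambda>x. (norm (f x))\<^sup>2 + (norm (g x))\<^sup>2)"
    using f g by (auto simp: square_integrable_def)
  moreover have "norm (f x \<bullet> g x) \<le> norm ((norm (f x))\<^sup>2 + (norm (g x))\<^sup>2)" for x
  proof -
    have "\<bar>f x \<bullet> g x\<bar> \<le> norm (f x) * norm (g x)"
      by (rule Cauchy_Schwarz_ineq2)
    also have "\<dots> \<le> (norm (f x))\<^sup>2 + (norm (g x))\<^sup>2"
    proof -
      have "0 \<le> norm (f x) * norm (g x)" by simp
      then show ?thesis
        using sum_squares_bound[of "norm (f x)" "norm (g x)"] by linarith
    qed
    finally show ?thesis by simp
  qed
  ultimately show ?thesis
    by (auto intro: Bochner_Integration.integrable_bound)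
qed

lemma part_equivp_l2_eq: "part_equivp l2_eq"
proof (rule part_equivpI)
  show "\<exists>x. l2_eq x x"
    by (rule exI[of _ "\<lambda>x. 0"]) (simp add: l2_eq_def square_integrable_zero)
  show "symp l2_eq"
    by (auto simp: l2_eq_def symp_def eq_commute)
  show "transp l2_eq"
    by (auto simp: l2_eq_def transp_def)
qed

text \<open>Elements of \<open>L\<^sub>2(\<real>)\<close> are classes of Borel functions modulo almost everywhere equality; every
  Lebesgue measurable function is almost everywhere equal to a Borel one.\<close>

quotient_type l2 = "real \<Rightarrow> complex" / partial: l2_eq
  morphisms l2_rep l2_class
  by (rule part_equivp_l2_eq)

text \<open>The real inner product below is the real part of the Hermitian one, so the norm is the usual
  norm of \<open>L\<^sub>2(\<real>)\<close>.\<close>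

instantiation l2 :: real_inner
begin

lift_definition zero_l2 :: l2 is "\<lambda>x. 0"
  by (simp add: l2_eq_def square_integrable_zero)

lift_definition plus_l2 :: "l2 \<Rightarrow> l2 \<Rightarrow> l2" is "\<lambda>f g x. f x + g x"
  by (auto simp: l2_eq_def square_integrable_add)

lift_definition uminus_l2 :: "l2 \<Rightarrow> l2" is "\<lambda>f x. - f x"
  by (auto simp: l2_eq_def square_integrable_minus)

definition minus_l2 :: "l2 \<Rightarrow> l2 \<Rightarrow> l2" where
  "minus_l2 u v = u + - v"

lift_definition scaleR_l2 :: "real \<Rightarrow> l2 \<Rightarrow> l2" is "\<lambda>r f x. complex_of_real r * f x"
  by (auto simp: l2_eq_def square_integrable_mult)

lift_definition inner_l2 :: "l2 \<Rightarrow> l2 \<Rightarrow> real" is "\<lambda>f g. LBINT x. f x \<bullet> g x"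
proof -
  fix f f' g g' :: "real \<Rightarrow> complex"
  assume *: "l2_eq f f'" "l2_eq g g'"
  then have [measurable]: "f \<in> borel_measurable lborel" "f' \<in> borel_measurable lborel"
      "g \<in> borel_measurable lborel" "g' \<in> borel_measurable lborel"
    by (auto simp: l2_eq_def square_integrable_def)
  from * have "AE x in lborel. f x = f' x" "AE x in lborel. g x = g' x"
    by (auto simp: l2_eq_def)
  then show "(LBINT x. f x \<bullet> g x) = (LBINT x. f' x \<bullet> g' x)"
    by (intro integral_cong_AE) auto
qed

definition norm_l2 :: "l2 \<Rightarrow> real" where
  "norm_l2 u = sqrt (u \<bullet> u)"

definition dist_l2 :: "l2 \<Rightarrow> l2 \<Rightarrow> real" where
  "dist_l2 u v = norm (u - v)"

definition sgn_l2 :: "l2 \<Rightarrow> l2" where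
  "sgn_l2 u = inverse (norm u) *\<^sub>R u"

definition uniformity_l2 :: "(l2 \<times> l2) filter" where
  "uniformity_l2 = (INF e\<in>{0<..}. principal {(u, v). dist u v < e})"

definition open_l2 :: "l2 set \<Rightarrow> bool" where
  "open_l2 U \<longleftrightarrow> (\<forall>x\<in>U. \<forall>\<^sub>F (x', y) in uniformity. x' = x \<longrightarrow> y \<in> U)"

instance
proof
  fix a b c u v w :: l2 and r s :: real
  show "a + b + c = a + (b + c)"
    by transfer (auto simp: l2_eq_def square_integrable_add add.assoc)
  show "a + b = b + a"
    by transfer (auto simp: l2_eq_def square_integrable_add add.commute)
  show "0 + a = a"
    by transfer (auto simp: l2_eq_def)
  show "- a + a = 0"
    by transfer (auto simp: l2_eq_def square_integrable_zero)
  show "a - b = a + - b"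
    by (rule minus_l2_def)
  show "r *\<^sub>R (a + b) = r *\<^sub>R a + r *\<^sub>R b"
    by transfer (auto simp: l2_eq_def distrib_left intro!: square_integrable_add square_integrable_mult)
  show "(r + s) *\<^sub>R a = r *\<^sub>R a + s *\<^sub>R a"
    by transfer (auto simp: l2_eq_def distrib_right square_integrable_add square_integrable_mult)
  show "r *\<^sub>R s *\<^sub>R a = (r * s) *\<^sub>R a"
    by transfer (auto simp: l2_eq_def mult.assoc square_integrable_mult)
  show "1 *\<^sub>R a = a"
    by transfer (auto simp: l2_eq_def)
  show "dist a b = norm (a - b)"
    by (rule dist_l2_def)
  show "sgn a = inverse (norm a) *\<^sub>R a"
    by (rule sgn_l2_def)
  show "uniformity = (INF e\<in>{0<..}. principal {(x, y::l2). dist x y < e})"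
    by (rule uniformity_l2_def)
  show "open U \<longleftrightarrow> (\<forall>x\<in>U. \<forall>\<^sub>F (x', y) in uniformity. x' = x \<longrightarrow> y \<in> U)" for U :: "l2 set"
    by (rule open_l2_def)
  show "a \<bullet> b = b \<bullet> a"
    by transfer (simp add: inner_commute)
  show "(a + b) \<bullet> c = a \<bullet> c + b \<bullet> c"
    by transfer (auto simp: l2_eq_def inner_add_left square_integrable_inner)
  show "(r *\<^sub>R a) \<bullet> b = r * (a \<bullet> b)"
    by transfer (simp flip: scaleR_conv_of_real)
  show "0 \<le> a \<bullet> a"
    by transfer simp
  show "(a \<bullet> a = 0) = (a = 0)"
  proof transfer
    fix f :: "real \<Rightarrow> complex"
    assume "l2_eq f f"
    then have f: "square_integrable f"
      by (simp add: l2_eq_def)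
    have "(LBINT x. f x \<bullet> f x) = 0 \<longleftrightarrow> (AE x in lborel. f x \<bullet> f x = 0)"
      by (intro integral_nonneg_eq_0_iff_AE square_integrable_inner f) simp
    then show "((LBINT x. f x \<bullet> f x) = 0) = l2_eq f (\<lambda>x. 0)"
      by (simp add: l2_eq_def f square_integrable_zero)
  qed
  show "norm a = sqrt (a \<bullet> a)"
    by (rule norm_l2_def)
qed

end

lift_definition scaleC_l2 :: "complex \<Rightarrow> l2 \<Rightarrow> l2"  (infixr \<open>*\<^sub>C\<close> 75) is "\<lambda>c f x. c * f x"
  by (auto simp: l2_eq_def square_integrable_mult)

lemma square_integrable_l2_rep: "square_integrable (l2_rep u)"
  using Quotient3_rep_reflp[OF Quotient3_l2, of u] by (simp add: l2_eq_def)

lemma norm_l2_eq: "norm u = sqrt (LBINT x. (norm (l2_rep u x))\<^sup>2)"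
  by (simp add: norm_l2_def inner_l2.rep_eq power2_norm_eq_inner)

section \<open>Unbounded operators and resolvents\<close>

text \<open>An operator in \<open>L\<^sub>2(\<real>)\<close> is identified with its graph, the set of all pairs \<open>(u, T u)\<close> with \<open>u\<close>
  in the domain of \<open>T\<close>. Thus \<open>(T - z) u = f\<close> means \<open>(u, f + z *\<^sub>C u) \<in> T\<close>.\<close>

type_synonym l2_operator = "(l2 \<times> l2) set"

definition resolvent :: "l2_operator \<Rightarrow> complex \<Rightarrow> l2 \<Rightarrow> l2" where
  "resolvent T z f = (THE u. (u, f + z *\<^sub>C u) \<in> T)"

text \<open>For a complex linear graph the resolvent is automatically complex linear, and its operator
  norm does not depend on whether \<open>L\<^sub>2(\<real>)\<close> is regarded as a real or as a complex space.\<close>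

definition resolvent_set :: "l2_operator \<Rightarrow> complex set" where
  "resolvent_set T =
     {z. (\<forall>f. \<exists>!u. (u, f + z *\<^sub>C u) \<in> T) \<and> bounded_linear (resolvent T z)}"

definition norm_resolvent_convergent :: "(real \<Rightarrow> l2_operator) \<Rightarrow> l2_operator \<Rightarrow> bool" where
  "norm_resolvent_convergent T A \<longleftrightarrow>
     (\<forall>z. z \<notin> \<real> \<longrightarrow>
        z \<in> resolvent_set A \<and>
        (\<forall>\<epsilon>>0. z \<in> resolvent_set (T \<epsilon>)) \<and>
        ((\<lambda>\<epsilon>. onorm (\<lambda>f. resolvent (T \<epsilon>) z f - resolvent A z f)) \<longlongrightarrow> 0) (at_right 0))"

text \<open>The direct sum of operators acting in two complementary orthogonal subspaces of \<open>L\<^sub>2(\<real>)\<close>.\<close>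

definition direct_sum :: "l2_operator \<Rightarrow> l2_operator \<Rightarrow> l2_operator"  (infixl \<open>\<oplus>\<^sub>o\<^sub>p\<close> 65) where
  "A \<oplus>\<^sub>o\<^sub>p B = {(u + v, f + g) | u v f g. (u, f) \<in> A \<and> (v, g) \<in> B}"

section \<open>Sobolev spaces\<close>

definition C0_infty :: "real set \<Rightarrow> (real \<Rightarrow> real) set" where
  "C0_infty U = {\<phi>. (\<forall>n x. (deriv ^^ n) \<phi> differentiable (at x)) \<and>
                    compact (closure (support_on UNIV \<phi>)) \<and> closure (support_on UNIV \<phi>) \<subseteq> U}"

text \<open>Real-valued test functions suffice for the distributional derivative, by linearity.\<close>

definition weak_derivative :: "real set \<Rightarrow> l2 \<Rightarrow> l2 \<Rightarrow> bool" where
  "weak_derivative U u v \<longleftrightarrow>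
     (\<forall>\<phi>\<in>C0_infty U. (LBINT x. deriv \<phi> x *\<^sub>R l2_rep u x) = - (LBINT x. \<phi> x *\<^sub>R l2_rep v x))"

text \<open>\<open>L\<^sub>2(U)\<close> as the subspace of \<open>L\<^sub>2(\<real>)\<close> of functions vanishing almost everywhere outside \<open>U\<close>.\<close>

definition l2_on :: "real set \<Rightarrow> l2 set" where
  "l2_on U = {u. AE x in lborel. x \<notin> U \<longrightarrow> l2_rep u x = 0}"

text \<open>\<open>sobolev_2_2 U\<close> consists of the triples \<open>(y, y', y'')\<close> with \<open>y\<close> in the Sobolev space
  \<open>W\<^sub>2\<^sup>2(U)\<close>.\<close>

definition sobolev_2_2 :: "real set \<Rightarrow> (l2 \<times> l2 \<times> l2) set" where
  "sobolev_2_2 U = {(y, y1, y2). y \<in> l2_on U \<and> y1 \<in> l2_on U \<and> y2 \<in> l2_on U \<and>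
                      weak_derivative U y y1 \<and> weak_derivative U y1 y2}"

text \<open>The value \<open>u(0-)\<close> or \<open>u(0+)\<close>, for \<open>F = at_left 0\<close> or \<open>F = at_right 0\<close>, is a limit of the
  representative that is continuous away from the origin.\<close>

definition has_limit_value :: "l2 \<Rightarrow> real filter \<Rightarrow> complex \<Rightarrow> bool" where
  "has_limit_value u F a \<longleftrightarrow>
     (\<exists>f. continuous_on (- {0}) f \<and> (AE x in lborel. l2_rep u x = f x) \<and> (f \<longlongrightarrow> a) F)"

section \<open>The Hamiltonians\<close>

definition delta'_like :: "(real \<Rightarrow> real) \<Rightarrow> bool" where
  "delta'_like \<Psi> \<longleftrightarrow> \<Psi> \<in> C0_infty UNIV \<and> closure (support_on UNIV \<Psi>) = {-1..1} \<and>
     (LBINT \<xi>. \<Psi> \<xi>) = 0 \<and> (LBINT \<xi>. \<xi> * \<Psi> \<xi>) = -1"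

definition H_eps :: "real \<Rightarrow> real \<Rightarrow> (real \<Rightarrow> real) \<Rightarrow> l2_operator" where
  "H_eps \<epsilon> \<alpha> \<Psi> = {(y, g). \<exists>y1 y2. (y, y1, y2) \<in> sobolev_2_2 UNIV \<and>
     (AE x in lborel. l2_rep g x = - l2_rep y2 x + (\<alpha> / \<epsilon>\<^sup>2 * \<Psi> (x / \<epsilon>)) *\<^sub>R l2_rep y x)}"

definition S_op :: "real \<Rightarrow> l2_operator" where
  "S_op \<theta> = {(y, - y2) | y y1 y2. (y, y1, y2) \<in> sobolev_2_2 (- {0}) \<and>
     (\<exists>a b. has_limit_value y (at_left 0) a \<and> has_limit_value y (at_right 0) b \<and>
            b = complex_of_real \<theta> * a) \<and>
     (\<exists>a b. has_limit_value y1 (at_left 0) a \<and> has_limit_value y1 (at_right 0) b \<and>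
            complex_of_real \<theta> * b = a)}"

definition S_minus :: l2_operator where
  "S_minus = {(y, - y2) | y y1 y2. (y, y1, y2) \<in> sobolev_2_2 {..<0} \<and>
                                  has_limit_value y (at_left 0) 0}"

definition S_plus :: l2_operator where
  "S_plus = {(y, - y2) | y y1 y2. (y, y1, y2) \<in> sobolev_2_2 {0<..} \<and>
                                 has_limit_value y (at_right 0) 0}"

text \<open>Non-trivial solutions of the Neumann problem on \<open>(-1, 1)\<close>. As all data are real, it makes no
  difference whether real or complex solutions are considered.\<close>

definition neumann_solution :: "real \<Rightarrow> (real \<Rightarrow> real) \<Rightarrow> (real \<Rightarrow> real) \<Rightarrow> bool" where
  "neumann_solution \<alpha> \<Psi> w \<longleftrightarrow>
     (\<exists>w1 w2. (\<forall>\<xi>\<in>{-1..1}. (w has_real_derivative w1 \<xi>) (at \<xi> within {-1..1})) \<and>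
              continuous_on {-1..1} w1 \<and>
              (\<forall>\<xi>\<in>{-1<..<1}. (w1 has_real_derivative w2 \<xi>) (at \<xi>) \<and>
                               - w2 \<xi> + \<alpha> * \<Psi> \<xi> * w \<xi> = 0) \<and>
              w1 (-1) = 0 \<and> w1 1 = 0) \<and>
     (\<exists>\<xi>\<in>{-1..1}. w \<xi> \<noteq> 0)"

definition resonant_set :: "(real \<Rightarrow> real) \<Rightarrow> real set" where
  "resonant_set \<Psi> = {\<alpha>. \<exists>w. neumann_solution \<alpha> \<Psi> w}"

text \<open>Solutions with \<open>\<alpha> \<in> resonant_set \<Psi>\<close> are unique up to a factor and do not vanish at \<open>-1\<close>
  and \<open>1\<close>, so the quotient is well defined and non-zero.\<close>

definition coupling :: "(real \<Rightarrow> real) \<Rightarrow> real \<Rightarrow> real" where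
  "coupling \<Psi> \<alpha> = (THE \<theta>. \<exists>w. neumann_solution \<alpha> \<Psi> w \<and> \<theta> = w 1 / w (-1))"

definition H_lim :: "real \<Rightarrow> (real \<Rightarrow> real) \<Rightarrow> l2_operator" where
  "H_lim \<alpha> \<Psi> = (if \<alpha> \<in> resonant_set \<Psi> then S_op (coupling \<Psi> \<alpha>) else S_minus \<oplus>\<^sub>o\<^sub>p S_plus)"

end

theory Submission
  imports Defs
begin

text \<open>
Fix a non-real \<open>z = k\<^sup>2\<close> with \<open>Im k > 0\<close>, and let \<open>G f\<close> be the free resolvent of \<open>f\<close>. A solution of
\<open>(H_\<epsilon> - z) y = f\<close> differs from \<open>G f\<close> by an outgoing wave on each side of \<open>[- \<epsilon>, \<epsilon>]\<close>, and in the
variable \<open>x / \<epsilon>\<close> it solves on \<open>[-1, 1]\<close> an equation that is an \<open>O (\<epsilon>\<^sup>2)\<close> perturbation of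
\<open>- w'' + \<alpha> \<Psi> w = 0\<close>. Green's identity against two homogeneous solutions normalised at the right end
point (\<open>Green_identity\<close>) therefore relates the Cauchy data at \<open>- \<epsilon>\<close> and \<open>\<epsilon>\<close> by a transfer matrix
\<open>t11, \<epsilon> t12, t21 / \<epsilon>, t22\<close> of determinant one, up to an error of order \<open>sqrt \<epsilon>\<close> times the norm of \<open>f\<close>.
Matching becomes one linear equation for the left amplitude, whose coefficient \<open>\<Delta>\<close> cannot vanish
because of the sign of the flux \<open>Im (cnj u * u')\<close> (\<open>\<Delta>_nonzero\<close>). The boundary data of \<open>G f\<close> enter
the amplitudes with coefficients that converge as \<open>\<epsilon>\<close> tends to zero: they are built from the entries of
the transfer matrix, \<open>\<epsilon> / \<Delta>\<close> and \<open>t21 / \<Delta>\<close>.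

The alternative in the theorem is the alternative for \<open>t21\<close> at \<open>\<epsilon> = 0\<close>, which is zero exactly for
resonant \<open>\<alpha>\<close> (\<open>resonant_iff\<close>). If it is not zero, then \<open>\<epsilon> / \<Delta> \<rightarrow> 0\<close> and \<open>t21 / \<Delta> \<rightarrow> 1\<close>, and both
amplitudes tend to \<open>- G f 0\<close>: the Dirichlet condition. If it is zero, then \<open>t21 = O (\<epsilon>\<^sup>2)\<close>, the
quotient \<open>\<epsilon> / \<Delta>\<close> has a finite limit, and \<open>t11 = \<theta>\<close>, \<open>t22 = 1 / \<theta>\<close> with the coupling \<open>\<theta>\<close>; the limits of
the amplitudes are then those that the interface condition of \<open>S_op \<theta>\<close> prescribes
(\<open>limit_coefficients\<close>). The amplitudes converge as functionals in norm, and the inner part is bounded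
by a constant times the norm of \<open>f\<close> on an interval of length \<open>2 \<epsilon>\<close>, so the resolvents converge in
norm (\<open>resolvent_convergence\<close>).

That these functions are the resolvents requires uniqueness. Elements of the Sobolev spaces have
absolutely continuous representatives by the lemma of du Bois-Reymond, for which \<open>\<Psi>\<close> itself supplies
the mollifier (\<open>delta'_like_mollifier\<close>). For a solution of the homogeneous equation in \<open>L\<^sub>2\<close> the
flux is monotone and integrable on each half-line; at the origin this bounds it by zero from above on one
side and from below on the other, and each of the three interface conditions makes it vanish (\<open>flux_right\<close>, \<open>flux_left\<close>).
\<close>

section \<open>Absolutely continuous functions\<close>

text \<open>The derivative of a Sobolev function is known almost everywhere only, so absolute continuity is
  expressed by the integral formula. On an interval \<open>I\<close> this says that \<open>F\<close> is locally absolutely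
  continuous with derivative \<open>f\<close>; in this form primitives can be cut and glued at points.\<close>

definition primitive_on :: "real set \<Rightarrow> (real \<Rightarrow> complex) \<Rightarrow> (real \<Rightarrow> complex) \<Rightarrow> bool" where
  "primitive_on I F f \<longleftrightarrow>
     (\<forall>a\<in>I. \<forall>b\<in>I. a \<le> b \<longrightarrow>
        set_integrable lborel {a..b} f \<and> F b - F a = (LBINT x:{a..b}. f x))"

lemma primitive_onI:
  assumes "\<And>a b. a \<in> I \<Longrightarrow> b \<in> I \<Longrightarrow> a \<le> b \<Longrightarrow> set_integrable lborel {a..b} f"
    and "\<And>a b. a \<in> I \<Longrightarrow> b \<in> I \<Longrightarrow> a \<le> b \<Longrightarrow> F b - F a = (LBINT x:{a..b}. f x)"
  shows "primitive_on I F f"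
  using assms by (auto simp: primitive_on_def)

lemma primitive_onD:
  assumes "primitive_on I F f" "a \<in> I" "b \<in> I" "a \<le> b"
  shows "set_integrable lborel {a..b} f" "F b - F a = (LBINT x:{a..b}. f x)"
  using assms by (auto simp: primitive_on_def)

lemma primitive_on_subset: "primitive_on I F f \<Longrightarrow> J \<subseteq> I \<Longrightarrow> primitive_on J F f"
  by (auto simp: primitive_on_def)

lemma primitive_on_cong:
  assumes "primitive_on I F f" "is_interval I"
    and "\<And>x. x \<in> I \<Longrightarrow> F x = F' x" "\<And>x. x \<in> I \<Longrightarrow> f x = f' x"
  shows "primitive_on I F' f'"
proof (rule primitive_onI)
  fix a b assume ab: "a \<in> I" "b \<in> I" "a \<le> b"
  then have sub: "{a..b} \<subseteq> I"
    using assms(2) by (meson atLeastAtMost_iff is_interval_1 subsetI)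
  have eq: "f x = f' x" if "x \<in> {a..b}" for x using sub that assms(4) by blast
  show "set_integrable lborel {a..b} f'"
    using primitive_onD(1)[OF assms(1) ab] eq by (subst set_integrable_cong[of _ lborel _ "{a..b}" f' f]) auto
  have "(LBINT x:{a..b}. f x) = (LBINT x:{a..b}. f' x)"
    by (rule set_lebesgue_integral_cong) (use eq in auto)
  then show "F' b - F' a = (LBINT x:{a..b}. f' x)"
    using primitive_onD(2)[OF assms(1) ab] assms(3)[OF ab(1)] assms(3)[OF ab(2)] by simp
qed

lemma primitive_on_cong_AE:
  assumes "primitive_on I F f" "is_interval I" "f \<in> borel_measurable lborel" "f' \<in> borel_measurable lborel"
    and "AE x in lborel. x \<in> I \<longrightarrow> f x = f' x"
  shows "primitive_on I F f'"
proof (rule primitive_onI)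
  fix a b assume ab: "a \<in> I" "b \<in> I" "a \<le> b"
  then have sub: "{a..b} \<subseteq> I"
    using assms(2) by (meson atLeastAtMost_iff is_interval_1 subsetI)
  have eq: "AE x \<in> {a..b} in lborel. f x = f' x"
    using assms(5) by eventually_elim (use sub in auto)
  show "set_integrable lborel {a..b} f'"
    using primitive_onD(1)[OF assms(1) ab] set_integrable_cong_AE[OF assms(3,4) eq] by auto
  show "F b - F a = (LBINT x:{a..b}. f' x)"
    using primitive_onD(2)[OF assms(1) ab] set_lebesgue_integral_cong_AE[OF _ assms(3,4) eq] by auto
qed

lemma primitive_on_derivative:
  assumes "is_interval I" "continuous_on I f"
    and "\<And>x. x \<in> I \<Longrightarrow> (F has_vector_derivative f x) (at x within I)"
  shows "primitive_on I F f"
proof (rule primitive_onI)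
  fix a b assume ab: "a \<in> I" "b \<in> I" "a \<le> b"
  then have sub: "{a..b} \<subseteq> I"
    using assms(1) by (meson atLeastAtMost_iff is_interval_1 subsetI)
  have cont: "continuous_on {a..b} f" using continuous_on_subset[OF assms(2) sub] .
  then show "set_integrable lborel {a..b} f"
    by (rule borel_integrable_atLeastAtMost')
  show "F b - F a = (LBINT x:{a..b}. f x)"
    unfolding set_lebesgue_integral_def
  proof (rule integral_FTC_atLeastAtMost[symmetric, OF ab(3) _ cont])
    fix x assume "a \<le> x" "x \<le> b"
    then have "x \<in> I" using sub by auto
    from has_vector_derivative_within_subset[OF assms(3)[OF this] sub]
    show "(F has_vector_derivative f x) (at x within {a..b})" .
  qed
qed

lemma primitive_on_add:
  assumes F: "primitive_on I F f" and G: "primitive_on I G g"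
  shows "primitive_on I (\<lambda>x. F x + G x) (\<lambda>x. f x + g x)"
proof (rule primitive_onI)
  fix a b assume ab: "a \<in> I" "b \<in> I" "a \<le> b"
  note 1 = primitive_onD[OF F ab] and 2 = primitive_onD[OF G ab]
  show "set_integrable lborel {a..b} (\<lambda>x. f x + g x)"
    by (rule set_integral_add(1)[OF 1(1) 2(1)])
  show "F b + G b - (F a + G a) = (LBINT x:{a..b}. f x + g x)"
    unfolding set_integral_add(2)[OF 1(1) 2(1)] 1(2)[symmetric] 2(2)[symmetric] by simp
qed

lemma primitive_on_cmult:
  assumes F: "primitive_on I F f"
  shows "primitive_on I (\<lambda>x. c * F x) (\<lambda>x. c * f x)"
proof (rule primitive_onI)
  fix a b assume ab: "a \<in> I" "b \<in> I" "a \<le> b"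
  note 1 = primitive_onD[OF F ab]
  show "set_integrable lborel {a..b} (\<lambda>x. c * f x)"
    using 1(1) by (rule set_integrable_mult_right)
  show "c * F b - c * F a = (LBINT x:{a..b}. c * f x)"
    unfolding set_integral_mult_right 1(2)[symmetric] by (simp add: right_diff_distrib)
qed

lemma primitive_on_diff:
  assumes "primitive_on I F f" "primitive_on I G g"
  shows "primitive_on I (\<lambda>x. F x - G x) (\<lambda>x. f x - g x)"
  using primitive_on_add[OF assms(1) primitive_on_cmult[OF assms(2), of "-1"]] by simp

lemma primitive_on_cnj:
  assumes "primitive_on I F f"
  shows "primitive_on I (\<lambda>x. cnj (F x)) (\<lambda>x. cnj (f x))"
proof (rule primitive_onI)
  fix a b assume ab: "a \<in> I" "b \<in> I" "a \<le> b"
  note 1 = primitive_onD[OF assms ab]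
  show "set_integrable lborel {a..b} (\<lambda>x. cnj (f x))"
    using integrable_cnj[of lborel "\<lambda>x. indicator {a..b} x *\<^sub>R f x"] 1(1)
    by (simp add: set_integrable_def complex_cnj_scaleR)
  have "cnj (LBINT x:{a..b}. f x) = (LBINT x:{a..b}. cnj (f x))"
    unfolding set_lebesgue_integral_def
    by (rule trans[OF Bochner_Integration.integral_cnj[symmetric]]) (simp only: complex_cnj_scaleR)
  then show "cnj (F b) - cnj (F a) = (LBINT x:{a..b}. cnj (f x))"
    using 1(2) by (metis complex_cnj_diff)
qed

lemma primitive_on_glue:
  assumes 1: "primitive_on (I \<inter> {..c}) F f" and 2: "primitive_on (I \<inter> {c..}) F f" and "c \<in> I"
  shows "primitive_on I F f"
proof -
  have "set_integrable lborel {a..b} f \<and> F b - F a = (LBINT x:{a..b}. f x)"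
    if ab: "a \<in> I" "b \<in> I" "a \<le> b" for a b
  proof -
    consider "b \<le> c" | "c \<le> a" | "a < c" "c < b" by linarith
    then show ?thesis
    proof cases
      case 1 then show ?thesis using primitive_onD[OF assms(1), of a b] ab by auto
    next
      case 2 then show ?thesis using primitive_onD[OF assms(2), of a b] ab by auto
    next
      case 3
      note l = primitive_onD[OF assms(1), of a c]
      note r = primitive_onD[OF assms(2), of c b]
      have un: "{a..b} = {a..c} \<union> {c..b}" using 3 by auto
      have s: "set_integrable lborel {a..b} f"
        unfolding un by (rule set_integrable_Un) (use l r ab \<open>c \<in> I\<close> 3 in auto)
      have "(LBINT x:{a..b}. f x) = (LBINT x:{a..c}. f x) + (LBINT x:{c..b}. f x)"
        unfolding un
      proof (rule set_integral_Un_AE)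
        show "AE x in lborel. \<not> (x \<in> {a..c} \<and> x \<in> {c..b})"
          using AE_lborel_singleton[of c] by eventually_elim auto
      qed (use l r ab \<open>c \<in> I\<close> 3 in auto)
      then show ?thesis using s l r ab \<open>c \<in> I\<close> 3 by (simp add: algebra_simps)
    qed
  qed
  then show ?thesis by (auto simp: primitive_on_def)
qed

lemma continuous_on_primitive_Icc:
  assumes "primitive_on {a..b} F f"
  shows "continuous_on {a..b} F"
proof (cases "a \<le> b")
  case True
  have int: "f integrable_on {a..b}"
    using primitive_onD(1)[OF assms] True by (intro set_borel_integral_eq_integral) auto
  have eq: "F x = F a + integral {a..x} f" if "x \<in> {a..b}" for x
    using primitive_onD[OF assms, of a x] that
    by (auto simp: set_borel_integral_eq_integral(2) algebra_simps)
  have cont: "continuous_on {a..b} (\<lambda>x. F a + integral {a..x} f)"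
    by (intro continuous_intros indefinite_integral_continuous_1 int)
  show ?thesis
    by (rule continuous_on_eq[OF cont]) (rule eq[symmetric])
qed auto

lemma continuous_on_primitive_UNIV:
  assumes "primitive_on UNIV F f"
  shows "continuous_on UNIV F"
proof -
  have "isCont F x" for x
  proof -
    have "continuous_on {x - 1..x + 1} F"
      by (rule continuous_on_primitive_Icc[OF primitive_on_subset[OF assms]]) auto
    then show ?thesis
      by (rule continuous_on_interior) auto
  qed
  then show ?thesis by (simp add: continuous_at_imp_continuous_on)
qed

text \<open>For integrable \<open>f\<close> and \<open>g\<close> the square over which \<open>f s * g t\<close> is integrated splits into the
  triangles \<open>t \<le> s\<close> and \<open>s < t\<close>; Fubini's theorem turns the two parts into the two summands of the
  product rule.\<close>

lemma primitive_on_mult_Icc: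
  assumes F: "primitive_on {a..b} F f" and G: "primitive_on {a..b} G g" and "a \<le> b"
  shows "set_integrable lborel {a..b} (\<lambda>x. f x * G x + F x * g x) \<and>
    F b * G b - F a * G a = (LBINT x:{a..b}. f x * G x + F x * g x)"
proof -
  define f' where "f' x = indicator {a..b} x *\<^sub>R f x" for x
  define g' where "g' x = indicator {a..b} x *\<^sub>R g x" for x
  have f'[simp]: "integrable lborel f'" and g'[simp]: "integrable lborel g'"
    using primitive_onD(1)[OF F] primitive_onD(1)[OF G] \<open>a \<le> b\<close>
    by (auto simp: set_integrable_def f'_def[abs_def] g'_def[abs_def])
  have [measurable]: "f' \<in> borel_measurable lborel" "g' \<in> borel_measurable lborel"
    using f' g' by (auto simp del: f' g')
  have inth: "integrable (lborel \<Otimes>\<^sub>M lborel) (\<lambda>(s,t). f' s * g' t)"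
  proof (rule lborel_pair.Fubini_integrable)
    show "(\<lambda>(s,t). f' s * g' t) \<in> borel_measurable (lborel \<Otimes>\<^sub>M lborel)" by measurable
    show "integrable lborel (\<lambda>x. LBINT y. cmod (case (x, y) of (s, t) \<Rightarrow> f' s * g' t))"
      by (simp add: norm_mult)
    show "AE x in lborel. integrable lborel (\<lambda>y. case (x, y) of (s, t) \<Rightarrow> f' s * g' t)"
      by simp
  qed
  define A where "A = {p :: real \<times> real. snd p \<le> fst p}"
  have A[measurable]: "A \<in> sets (lborel \<Otimes>\<^sub>M lborel)"
  proof -
    have "A = {p \<in> space (lborel \<Otimes>\<^sub>M lborel). snd p \<le> fst p}" by (auto simp: A_def space_pair_measure)
    also have "\<dots> \<in> sets (lborel \<Otimes>\<^sub>M lborel)" by measurable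
    finally show ?thesis .
  qed
  have int1: "integrable (lborel \<Otimes>\<^sub>M lborel) (\<lambda>(s,t). indicator A (s,t) *\<^sub>R (f' s * g' t))"
    using integrable_mult_indicator[OF A inth] by (simp add: case_prod_beta')
  have int2: "integrable (lborel \<Otimes>\<^sub>M lborel) (\<lambda>(s,t). indicator (-A) (s,t) *\<^sub>R (f' s * g' t))"
    by (rule Bochner_Integration.integrable_cong[THEN iffD1, OF refl _
        Bochner_Integration.integrable_diff[OF inth int1]]) (auto split: split_indicator)
  have Gs: "(LBINT t. indicator A (s,t) *\<^sub>R (f' s * g' t)) = f' s * (G s - G a)" for s
  proof (cases "s \<in> {a..b}")
    case True
    have "(LBINT t. indicator A (s,t) *\<^sub>R (f' s * g' t)) = (LBINT t. f' s * (indicator {a..s} t *\<^sub>R g t))"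
      by (rule Bochner_Integration.integral_cong) (use True in \<open>auto simp: A_def g'_def split: split_indicator\<close>)
    also have "\<dots> = f' s * (LBINT t:{a..s}. g t)"
      by (simp add: set_lebesgue_integral_def del: mult_scaleR_right)
    finally show ?thesis using primitive_onD(2)[OF G, of a s] True by auto
  qed (auto simp: f'_def)
  have Fs: "(LBINT s. indicator (-A) (s,t) *\<^sub>R (f' s * g' t)) = (F t - F a) * g' t" for t
  proof (cases "t \<in> {a..b}")
    case True
    have [measurable]: "set_borel_measurable borel {a..t} f"
      using primitive_onD(1)[OF F, of a t] True by (auto simp: set_integrable_def set_borel_measurable_def)
    have "(LBINT s. indicator (-A) (s,t) *\<^sub>R (f' s * g' t)) = (LBINT s. (indicator {..<t} s *\<^sub>R f' s) * g' t)"
      by (rule Bochner_Integration.integral_cong) (use True in \<open>auto simp: A_def f'_def split: split_indicator\<close>)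
    also have "\<dots> = (LBINT s. indicator {..<t} s *\<^sub>R f' s) * g' t"
      by (simp del: mult_scaleR_left)
    also have "(LBINT s. indicator {..<t} s *\<^sub>R f' s) = (LBINT s:{a..t}. f s)"
      unfolding set_lebesgue_integral_def
    proof (rule integral_cong_AE)
      show "(\<lambda>x. indicat_real {a..t} x *\<^sub>R f x) \<in> borel_measurable lborel"
        using primitive_onD(1)[OF F, of a t] True by (auto simp: set_integrable_def)
      show "AE s in lborel. indicat_real {..<t} s *\<^sub>R f' s = indicat_real {a..t} s *\<^sub>R f s"
        using AE_lborel_singleton[of t]
        by eventually_elim (use True in \<open>auto simp: f'_def split: split_indicator\<close>)
    qed measurable
    finally show ?thesis using primitive_onD(2)[OF F, of a t] True by auto
  qed (auto simp: g'_def)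
  have i1: "integrable lborel (\<lambda>s. f' s * (G s - G a))"
    using lborel_pair.integrable_fst[OF int1] by (simp add: Gs)
  have i2: "integrable lborel (\<lambda>t. (F t - F a) * g' t)"
    using lborel_pair.integrable_snd[OF int2] by (simp add: Fs)
  have F1: "(LBINT s. f' s) = F b - F a" "(LBINT s. g' s) = G b - G a"
    using primitive_onD(2)[OF F, of a b] primitive_onD(2)[OF G, of a b] \<open>a \<le> b\<close>
    by (simp_all add: f'_def[abs_def] g'_def[abs_def] set_lebesgue_integral_def)
  have "(LBINT s. f' s * (G s - G a)) + (LBINT t. (F t - F a) * g' t)
      = (LINT p|(lborel \<Otimes>\<^sub>M lborel). (case p of (s,t) \<Rightarrow> indicator A (s,t) *\<^sub>R (f' s * g' t)))
      + (LINT p|(lborel \<Otimes>\<^sub>M lborel). (case p of (s,t) \<Rightarrow> indicator (-A) (s,t) *\<^sub>R (f' s * g' t)))"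
    using lborel_pair.integral_fst[OF int1] lborel_pair.integral_snd[OF int2]
    by (simp add: Gs Fs)
  also have "\<dots> = (LINT p|(lborel \<Otimes>\<^sub>M lborel). (case p of (s,t) \<Rightarrow> f' s * g' t))"
    by (subst Bochner_Integration.integral_add[OF int1 int2, symmetric])
       (rule Bochner_Integration.integral_cong, auto split: split_indicator)
  also have "\<dots> = (LBINT s. (LBINT t. f' s * g' t))"
    using lborel_pair.integral_fst[OF inth] by simp
  also have "\<dots> = (F b - F a) * (G b - G a)"
    by (simp add: F1)
  finally have eq: "(LBINT s. f' s * (G s - G a)) + (LBINT t. (F t - F a) * g' t) = (F b - F a) * (G b - G a)" .
  have dec: "indicator {a..b} x *\<^sub>R (f x * G x + F x * g x) =
      (f' x * (G x - G a) + (F x - F a) * g' x) + (G a * f' x + F a * g' x)" for x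
    by (auto simp: f'_def g'_def algebra_simps split: split_indicator)
  have I: "integrable lborel (\<lambda>x. indicator {a..b} x *\<^sub>R (f x * G x + F x * g x))"
    unfolding dec by (intro Bochner_Integration.integrable_add i1 i2 integrable_mult_right f' g')
  have "(LBINT x:{a..b}. f x * G x + F x * g x) =
      ((F b - F a) * (G b - G a)) + (G a * (F b - F a) + F a * (G b - G a))"
    unfolding set_lebesgue_integral_def dec
    using i1 i2 eq by (subst Bochner_Integration.integral_add; simp add: F1)+
  then show ?thesis using I by (simp add: set_integrable_def algebra_simps)
qed

lemma primitive_on_mult:
  assumes "primitive_on I F f" "primitive_on I G g" "is_interval I"
  shows "primitive_on I (\<lambda>x. F x * G x) (\<lambda>x. f x * G x + F x * g x)"
proof -
  have "set_integrable lborel {a..b} (\<lambda>x. f x * G x + F x * g x) \<and>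
    F b * G b - F a * G a = (LBINT x:{a..b}. f x * G x + F x * g x)"
    if ab: "a \<in> I" "b \<in> I" "a \<le> b" for a b
  proof -
    have sub: "{a..b} \<subseteq> I"
      using assms(3) ab by (meson atLeastAtMost_iff is_interval_1 subsetI)
    show ?thesis
      using primitive_on_mult_Icc[OF primitive_on_subset[OF assms(1) sub] primitive_on_subset[OF assms(2) sub] ab(3)] .
  qed
  then show ?thesis by (auto simp: primitive_on_def)
qed

lemma exists_primitive:
  assumes f: "\<And>a b. set_integrable lborel {a..b} f"
  shows "\<exists>F. primitive_on UNIV F f"
proof -
  define F where "F x = (if 0 \<le> x then (LBINT t:{0..x}. f t) else - (LBINT t:{x..0}. f t))" for x
  have split: "(LBINT t:{a..b}. f t) = (LBINT t:{a..c}. f t) + (LBINT t:{c..b}. f t)"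
    if "a \<le> c" "c \<le> b" for a b c
  proof -
    have un: "{a..b} = {a..c} \<union> {c..b}" using that by auto
    show ?thesis unfolding un
    proof (rule set_integral_Un_AE)
      show "AE x in lborel. \<not> (x \<in> {a..c} \<and> x \<in> {c..b})"
        using AE_lborel_singleton[of c] by eventually_elim auto
    qed (use f in auto)
  qed
  have s0: "(LBINT t:{0..0}. f t) = 0"
    using split[of 0 0 0] by simp
  have "primitive_on UNIV F f"
  proof (rule primitive_on_glue[of _ 0])
    show "primitive_on (UNIV \<inter> {..0}) F f"
    proof (rule primitive_onI)
      fix a b :: real assume ab: "a \<in> UNIV \<inter> {..0}" "b \<in> UNIV \<inter> {..0}" "a \<le> b"
      have "F x = - (LBINT t:{x..0}. f t)" if "x \<le> 0" for x
        using that s0 by (cases "x = 0") (auto simp: F_def)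
      then show "F b - F a = (LBINT t:{a..b}. f t)"
        using split[of a b 0] ab by simp
    qed (rule f)
    show "primitive_on (UNIV \<inter> {0..}) F f"
    proof (rule primitive_onI)
      fix a b :: real assume ab: "a \<in> UNIV \<inter> {0..}" "b \<in> UNIV \<inter> {0..}" "a \<le> b"
      then show "F b - F a = (LBINT t:{a..b}. f t)"
        using split[of 0 a b] by (simp add: F_def)
    qed (rule f)
  qed simp
  then show ?thesis by blast
qed

section \<open>Test functions\<close>

text \<open>The first clause in the definition of \<open>C0_infty\<close>.\<close>

definition smooth :: "(real \<Rightarrow> real) \<Rightarrow> bool" where
  "smooth \<phi> \<longleftrightarrow> (\<forall>n x. (deriv ^^ n) \<phi> differentiable (at x))"

lemma smooth_DERIV: "smooth \<phi> \<Longrightarrow> (\<phi> has_real_derivative deriv \<phi> x) (at x)"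
  unfolding smooth_def DERIV_deriv_iff_real_differentiable
  by (drule spec[of _ 0]) simp

lemma smooth_deriv: "smooth \<phi> \<Longrightarrow> smooth (deriv \<phi>)"
  unfolding smooth_def
  by (intro allI, drule_tac x="Suc n" in spec) (simp add: funpow_swap1)

lemma smooth_continuous: "smooth \<phi> \<Longrightarrow> continuous_on A \<phi>"
  by (intro continuous_at_imp_continuous_on ballI DERIV_isCont[OF smooth_DERIV])

lemma smooth_primitive:
  assumes "smooth \<psi>" "\<And>x. (\<phi> has_real_derivative \<psi> x) (at x)"
  shows "smooth \<phi>"
  unfolding smooth_def
proof (intro allI)
  fix n x
  have d: "deriv \<phi> = \<psi>" using assms(2) by (auto intro: DERIV_imp_deriv)
  show "(deriv ^^ n) \<phi> differentiable at x"
  proof (cases n)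
    case 0 then show ?thesis using assms(2) real_differentiable_def by auto
  next
    case (Suc m)
    then have "(deriv ^^ n) \<phi> = (deriv ^^ m) \<psi>"
      using d by (simp add: funpow_swap1)
    then show ?thesis using assms(1) by (simp add: smooth_def)
  qed
qed

lemma smooth_linear_combination:
  assumes "smooth \<phi>" "smooth \<psi>"
  shows "smooth (\<lambda>x. a * \<phi> x + b * \<psi> x)"
proof -
  have *: "((\<lambda>x. a * (deriv ^^ n) \<phi> x + b * (deriv ^^ n) \<psi> x) has_real_derivative
      a * (deriv ^^ Suc n) \<phi> x + b * (deriv ^^ Suc n) \<psi> x) (at x)" for n x
  proof -
    have "((deriv ^^ n) \<phi> has_real_derivative (deriv ^^ Suc n) \<phi> x) (at x)"
      "((deriv ^^ n) \<psi> has_real_derivative (deriv ^^ Suc n) \<psi> x) (at x)"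
      using assms by (simp_all add: smooth_def DERIV_deriv_iff_real_differentiable)
    then show ?thesis by (auto intro!: derivative_eq_intros)
  qed
  have "(deriv ^^ n) (\<lambda>x. a * \<phi> x + b * \<psi> x) = (\<lambda>x. a * (deriv ^^ n) \<phi> x + b * (deriv ^^ n) \<psi> x)" for n
  proof (induction n)
    case (Suc n)
    have "deriv (\<lambda>x. a * (deriv ^^ n) \<phi> x + b * (deriv ^^ n) \<psi> x) x =
       a * (deriv ^^ Suc n) \<phi> x + b * (deriv ^^ Suc n) \<psi> x" for x
      by (rule DERIV_imp_deriv[OF *])
    then show ?case using Suc.IH by auto
  qed simp
  then show ?thesis
    unfolding smooth_def using * real_differentiable_def by metis
qed

lemma smooth_affine:
  assumes "smooth \<phi>"
  shows "smooth (\<lambda>x. \<phi> (c * x + d))"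
proof -
  have *: "((\<lambda>x. c ^ n * (deriv ^^ n) \<phi> (c * x + d)) has_real_derivative
      c ^ Suc n * (deriv ^^ Suc n) \<phi> (c * x + d)) (at x)" for n x
  proof -
    have "((deriv ^^ n) \<phi> has_real_derivative (deriv ^^ Suc n) \<phi> (c * x + d)) (at (c * x + d))"
      using assms by (simp add: smooth_def DERIV_deriv_iff_real_differentiable)
    moreover have "((\<lambda>x. c * x + d) has_real_derivative c) (at x)"
      by (auto intro!: derivative_eq_intros)
    ultimately have "((\<lambda>x. (deriv ^^ n) \<phi> (c * x + d)) has_real_derivative (deriv ^^ Suc n) \<phi> (c * x + d) * c) (at x)"
      by (rule DERIV_chain2)
    from DERIV_cmult[OF this, of "c ^ n"] show ?thesis by (simp add: mult_ac)
  qed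
  have "(deriv ^^ n) (\<lambda>x. \<phi> (c * x + d)) = (\<lambda>x. c ^ n * (deriv ^^ n) \<phi> (c * x + d))" for n
  proof (induction n)
    case (Suc n)
    have "deriv (\<lambda>x. c ^ n * (deriv ^^ n) \<phi> (c * x + d)) x = c ^ Suc n * (deriv ^^ Suc n) \<phi> (c * x + d)" for x
      by (rule DERIV_imp_deriv[OF *])
    then show ?case using Suc.IH by auto
  qed simp
  then show ?thesis
    unfolding smooth_def using * real_differentiable_def by metis
qed

lemma C0_inftyI:
  assumes "smooth \<phi>" "compact K" "K \<subseteq> U" "\<And>x. x \<notin> K \<Longrightarrow> \<phi> x = 0"
  shows "\<phi> \<in> C0_infty U"
proof -
  have "closure (support_on UNIV \<phi>) \<subseteq> K"
    using assms(2,4) by (intro closure_minimal) (auto simp: support_on_def compact_imp_closed)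
  then show ?thesis
    using assms unfolding C0_infty_def smooth_def
    by (auto intro: compact_closure[THEN iffD2] bounded_subset compact_imp_bounded
      simp: compact_eq_bounded_closed)
qed

lemma C0_infty_smooth: "\<phi> \<in> C0_infty U \<Longrightarrow> smooth \<phi>"
  by (simp add: C0_infty_def smooth_def)

lemma C0_infty_support:
  assumes "\<phi> \<in> C0_infty U"
  obtains K where "compact K" "K \<subseteq> U" "\<And>x. x \<notin> K \<Longrightarrow> \<phi> x = 0" "\<And>x. x \<notin> K \<Longrightarrow> deriv \<phi> x = 0"
proof
  let ?K = "closure (support_on UNIV \<phi>)"
  show "compact ?K" "?K \<subseteq> U" using assms by (auto simp: C0_infty_def)
  show 0: "\<phi> x = 0" if "x \<notin> ?K" for x
    using that closure_subset[of "support_on UNIV \<phi>"] by (auto simp: support_on_def)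
  show "deriv \<phi> x = 0" if x: "x \<notin> ?K" for x
  proof -
    have "((\<lambda>x. 0) has_real_derivative 0) (at x)" by simp
    then have "(\<phi> has_real_derivative 0) (at x)"
    proof (rule has_field_derivative_transform_within_open[where S="- ?K"])
      show "open (- ?K)" by (simp add: open_Compl)
    qed (use x 0 in auto)
    then show ?thesis by (rule DERIV_imp_deriv)
  qed
qed

lemma C0_infty_bounded_support:
  assumes "\<phi> \<in> C0_infty U"
  obtains R where "R > 0" "\<And>x. \<bar>x\<bar> \<ge> R \<Longrightarrow> \<phi> x = 0" "\<And>x. \<bar>x\<bar> \<ge> R \<Longrightarrow> deriv \<phi> x = 0"
proof -
  obtain K where K: "compact K" "K \<subseteq> U" "\<And>x. x \<notin> K \<Longrightarrow> \<phi> x = 0" "\<And>x. x \<notin> K \<Longrightarrow> deriv \<phi> x = 0"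
    by (rule C0_infty_support[OF assms]) blast
  obtain B where B: "B > 0" "\<And>x. x \<in> K \<Longrightarrow> norm x \<le> B"
    using compact_imp_bounded[OF K(1)] by (meson bounded_pos)
  show ?thesis
  proof
    show "B + 1 > 0" using B by simp
    show "\<phi> x = 0" "deriv \<phi> x = 0" if "\<bar>x\<bar> \<ge> B + 1" for x
      using B(2)[of x] K(3,4)[of x] that by force+
  qed
qed

lemma C0_infty_mono: "\<phi> \<in> C0_infty U \<Longrightarrow> U \<subseteq> V \<Longrightarrow> \<phi> \<in> C0_infty V"
  by (auto simp: C0_infty_def)

lemma C0_infty_linear_combination:
  assumes "\<phi> \<in> C0_infty U" "\<psi> \<in> C0_infty U"
  shows "(\<lambda>x. a * \<phi> x + b * \<psi> x) \<in> C0_infty U"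
proof -
  obtain K where K: "compact K" "K \<subseteq> U" "\<And>x. x \<notin> K \<Longrightarrow> \<phi> x = 0"
    by (rule C0_infty_support[OF assms(1)]) blast
  obtain L where L: "compact L" "L \<subseteq> U" "\<And>x. x \<notin> L \<Longrightarrow> \<psi> x = 0"
    by (rule C0_infty_support[OF assms(2)]) blast
  show ?thesis
    by (rule C0_inftyI[of _ "K \<union> L"])
       (use K L in \<open>auto intro!: smooth_linear_combination C0_infty_smooth[OF assms(1)] C0_infty_smooth[OF assms(2)]\<close>)
qed

lemma integrable_compact_support:
  fixes \<phi> :: "real \<Rightarrow> real" and h :: "real \<Rightarrow> complex"
  assumes "continuous_on UNIV \<phi>" "\<And>x. \<bar>x\<bar> \<ge> R \<Longrightarrow> \<phi> x = 0" "set_integrable lborel {-R..R} h"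
  shows "integrable lborel (\<lambda>x. \<phi> x *\<^sub>R h x)"
proof -
  obtain B where B: "\<And>x. x \<in> {-R..R} \<Longrightarrow> norm (\<phi> x) \<le> B"
    using compact_imp_bounded[OF compact_continuous_image[OF continuous_on_subset[OF assms(1)] compact_Icc[of "-R" R]]]
    unfolding bounded_iff by blast
  have eq: "\<phi> x *\<^sub>R h x = \<phi> x *\<^sub>R (indicator {-R..R} x *\<^sub>R h x)" for x
    using assms(2)[of x] by (cases "\<bar>x\<bar> \<ge> R") (auto split: split_indicator)
  have m1: "\<phi> \<in> borel_measurable lborel"
    using assms(1) by (simp add: borel_measurable_continuous_onI)
  have i: "integrable lborel (\<lambda>x. B *\<^sub>R (indicator {-R..R} x *\<^sub>R h x))"
    using assms(3) unfolding set_integrable_def by (rule integrable_scaleR_right)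
  have m2: "(\<lambda>x. indicator {-R..R} x *\<^sub>R h x) \<in> borel_measurable lborel"
    using assms(3) unfolding set_integrable_def by auto
  have "norm (\<phi> x *\<^sub>R (indicator {-R..R} x *\<^sub>R h x)) \<le> norm (B *\<^sub>R (indicator {-R..R} x *\<^sub>R h x))" for x
  proof (cases "x \<in> {-R..R}")
    case True then have "\<bar>\<phi> x\<bar> \<le> \<bar>B\<bar>" using B[of x] by auto
    then show ?thesis using True by (simp add: mult_right_mono)
  qed auto
  then show ?thesis unfolding eq
    by (intro Bochner_Integration.integrable_bound[OF i] borel_measurable_scaleR m1 m2) simp
qed

lemma integral_by_parts_Icc:
  fixes \<phi> :: "real \<Rightarrow> real"
  assumes \<phi>: "smooth \<phi>" and "a \<le> b" "\<phi> a = 0" "\<phi> b = 0" and Y: "primitive_on {a..b} Y Y1"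
  shows "(LBINT x:{a..b}. deriv \<phi> x *\<^sub>R Y x) = - (LBINT x:{a..b}. \<phi> x *\<^sub>R Y1 x)"
    and "set_integrable lborel {a..b} (\<lambda>x. deriv \<phi> x *\<^sub>R Y x)"
    and "set_integrable lborel {a..b} (\<lambda>x. \<phi> x *\<^sub>R Y1 x)"
proof -
  have c: "continuous_on {a..b} (\<lambda>x. deriv \<phi> x)"
    using smooth_continuous[OF smooth_deriv[OF \<phi>]] .
  have P: "primitive_on {a..b} (\<lambda>x. of_real (\<phi> x)) (\<lambda>x. of_real (deriv \<phi> x))"
  proof (rule primitive_on_derivative)
    show "((\<lambda>x. complex_of_real (\<phi> x)) has_vector_derivative of_real (deriv \<phi> x)) (at x within {a..b})" for x
      using has_vector_derivative_of_real[OF smooth_DERIV[OF \<phi>, of x, THEN has_field_derivative_at_within], of "{a..b}"]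
      by simp
  qed (use c in \<open>auto intro!: continuous_intros simp: is_interval_cc\<close>)
  have *: "set_integrable lborel {a..b} (\<lambda>x. of_real (deriv \<phi> x) * Y x + of_real (\<phi> x) * Y1 x)"
    "(LBINT x:{a..b}. of_real (deriv \<phi> x) * Y x + of_real (\<phi> x) * Y1 x) = 0"
    using primitive_on_mult_Icc[OF P Y \<open>a \<le> b\<close>] assms(3,4) by auto
  show 1: "set_integrable lborel {a..b} (\<lambda>x. deriv \<phi> x *\<^sub>R Y x)"
    by (intro borel_integrable_atLeastAtMost' continuous_intros c continuous_on_primitive_Icc[OF Y])
  then show 2: "set_integrable lborel {a..b} (\<lambda>x. \<phi> x *\<^sub>R Y1 x)"
    using set_integral_diff(1)[OF *(1) 1] by (simp add: scaleR_conv_of_real)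
  show "(LBINT x:{a..b}. deriv \<phi> x *\<^sub>R Y x) = - (LBINT x:{a..b}. \<phi> x *\<^sub>R Y1 x)"
    using *(2) set_integral_add(2)[OF 1 2] by (simp add: scaleR_conv_of_real add_eq_0_iff)
qed

lemma integral_restrict_support:
  assumes "\<And>x. x \<notin> A \<Longrightarrow> f x = 0"
  shows "(LBINT x:A. f x) = (LBINT x. f x)"
  unfolding set_lebesgue_integral_def
  by (rule Bochner_Integration.integral_cong) (use assms in \<open>auto split: split_indicator\<close>)

lemma integral_by_parts_test:
  assumes "\<phi> \<in> C0_infty U" and Y: "primitive_on UNIV Y Y1"
  shows "(LBINT x. deriv \<phi> x *\<^sub>R Y x) = - (LBINT x. \<phi> x *\<^sub>R Y1 x)"
proof -
  obtain R where R: "R > 0" "\<And>x. \<bar>x\<bar> \<ge> R \<Longrightarrow> \<phi> x = 0" "\<And>x. \<bar>x\<bar> \<ge> R \<Longrightarrow> deriv \<phi> x = 0"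
    by (rule C0_infty_bounded_support[OF assms(1)]) blast
  have "(LBINT x:{-R..R}. deriv \<phi> x *\<^sub>R Y x) = - (LBINT x:{-R..R}. \<phi> x *\<^sub>R Y1 x)"
    by (rule integral_by_parts_Icc(1)[OF C0_infty_smooth[OF assms(1)] _ _ _ primitive_on_subset[OF Y]])
       (use R in auto)
  then show ?thesis
    using R by (subst (asm) (1 2) integral_restrict_support) auto
qed

text \<open>A test function with support off the origin vanishes at \<open>0\<close>; the boundary terms of the two
  half-lines are zero even if \<open>Ym 0\<close> and \<open>Yp 0\<close> differ.\<close>

lemma integral_by_parts_test_punctured:
  assumes "\<phi> \<in> C0_infty U" "0 \<notin> U" "primitive_on {..0} Ym Y1" "primitive_on {0..} Yp Y1"
    and Y: "Y \<in> borel_measurable lborel" "AE x in lborel. Y x = (if x < 0 then Ym x else Yp x)"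
  shows "(LBINT x. deriv \<phi> x *\<^sub>R Y x) = - (LBINT x. \<phi> x *\<^sub>R Y1 x)"
proof -
  obtain R where R: "R > 0" "\<And>x. \<bar>x\<bar> \<ge> R \<Longrightarrow> \<phi> x = 0" "\<And>x. \<bar>x\<bar> \<ge> R \<Longrightarrow> deriv \<phi> x = 0"
    by (rule C0_infty_bounded_support[OF assms(1)]) blast
  have [measurable]: "deriv \<phi> \<in> borel_measurable lborel"
    using smooth_continuous[OF smooth_deriv[OF C0_infty_smooth[OF assms(1)]], of UNIV]
    by (simp add: borel_measurable_continuous_onI)
  note [measurable] = Y(1)
  have 0: "\<phi> 0 = 0"
    by (rule C0_infty_support[OF assms(1)]) (use \<open>0 \<notin> U\<close> in blast)
  note l = integral_by_parts_Icc[OF C0_infty_smooth[OF assms(1)] _ _ _ primitive_on_subset[OF assms(3)], of "-R" 0]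
  note r = integral_by_parts_Icc[OF C0_infty_smooth[OF assms(1)] _ _ _ primitive_on_subset[OF assms(4)], of 0 R]
  have un: "{-R..R} = {-R..0} \<union> {0..R}" using R by auto
  have ae: "AE x in lborel. \<not> (x \<in> {-R..0} \<and> x \<in> {0..R})"
    using AE_lborel_singleton[of 0] by eventually_elim auto
  have aeL: "AE x in lborel. indicator {-R..0} x *\<^sub>R (deriv \<phi> x *\<^sub>R Y x) = indicator {-R..0} x *\<^sub>R (deriv \<phi> x *\<^sub>R Ym x)"
    using AE_lborel_singleton[of 0] Y(2) by eventually_elim (auto split: split_indicator)
  have aeR: "AE x in lborel. indicator {0..R} x *\<^sub>R (deriv \<phi> x *\<^sub>R Y x) = indicator {0..R} x *\<^sub>R (deriv \<phi> x *\<^sub>R Yp x)"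
    using AE_lborel_singleton[of 0] Y(2) by eventually_elim (auto split: split_indicator)
  have iL: "integrable lborel (\<lambda>x. indicator {-R..0} x *\<^sub>R (deriv \<phi> x *\<^sub>R Ym x))"
    and iR: "integrable lborel (\<lambda>x. indicator {0..R} x *\<^sub>R (deriv \<phi> x *\<^sub>R Yp x))"
    using l(2) r(2) R 0 by (auto simp: set_integrable_def)
  have iL': "set_integrable lborel {-R..0} (\<lambda>x. deriv \<phi> x *\<^sub>R Y x)"
    unfolding set_integrable_def by (subst integrable_cong_AE[OF _ _ aeL]) (use iL in auto)
  have iR': "set_integrable lborel {0..R} (\<lambda>x. deriv \<phi> x *\<^sub>R Y x)"
    unfolding set_integrable_def by (subst integrable_cong_AE[OF _ _ aeR]) (use iR in auto)
  have eL: "(LBINT x:{-R..0}. deriv \<phi> x *\<^sub>R Y x) = (LBINT x:{-R..0}. deriv \<phi> x *\<^sub>R Ym x)"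
    unfolding set_lebesgue_integral_def by (rule integral_cong_AE[OF _ _ aeL]) (use iL in auto)
  have eR: "(LBINT x:{0..R}. deriv \<phi> x *\<^sub>R Y x) = (LBINT x:{0..R}. deriv \<phi> x *\<^sub>R Yp x)"
    unfolding set_lebesgue_integral_def by (rule integral_cong_AE[OF _ _ aeR]) (use iR in auto)
  have "(LBINT x:{-R..R}. deriv \<phi> x *\<^sub>R Y x) = - (LBINT x:{-R..R}. \<phi> x *\<^sub>R Y1 x)"
    unfolding un using l r R 0 iL' iR' eL eR
    by (subst (1 2) set_integral_Un_AE[OF ae]) auto
  then show ?thesis
    using R by (subst (asm) (1 2) integral_restrict_support) auto
qed

text \<open>The primitive from the left of the support vanishes to its right because the total integral is zero.
  As \<open>I\<close> is an interval, the hull of the support stays in \<open>I\<close>.\<close>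

lemma C0_infty_primitive:
  assumes \<psi>: "\<psi> \<in> C0_infty I" "(LBINT x. \<psi> x) = 0" and I: "is_interval I" "I \<noteq> {}"
  obtains \<phi> where "\<phi> \<in> C0_infty I" "\<And>x. (\<phi> has_real_derivative \<psi> x) (at x)"
proof -
  obtain K where K: "compact K" "K \<subseteq> I" "\<And>x. x \<notin> K \<Longrightarrow> \<psi> x = 0"
    by (rule C0_infty_support[OF \<psi>(1)]) blast
  obtain a b where ab: "a \<in> I" "b \<in> I" "a \<le> b" "\<And>x. x \<notin> {a..b} \<Longrightarrow> \<psi> x = 0"
  proof (cases "K = {}")
    case True
    then show ?thesis using that I(2) K(3) by blast
  next
    case False
    then have "Inf K \<in> K" "Sup K \<in> K"
      using closed_contains_Inf[OF False bounded_imp_bdd_below] closed_contains_Sup[OF False bounded_imp_bdd_above]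
        compact_imp_bounded[OF K(1)] compact_imp_closed[OF K(1)] by blast+
    moreover have "Inf K \<le> x \<and> x \<le> Sup K" if "x \<in> K" for x
      using cInf_lower[OF that bounded_imp_bdd_below] cSup_upper[OF that bounded_imp_bdd_above]
        compact_imp_bounded[OF K(1)] by blast
    ultimately show ?thesis using that[of "Inf K" "Sup K"] K by fastforce
  qed
  have sub: "{a..b} \<subseteq> I"
    using I(1) ab by (meson atLeastAtMost_iff is_interval_1 subsetI)
  have c: "continuous_on A \<psi>" for A using smooth_continuous[OF C0_infty_smooth[OF \<psi>(1)]] .
  define \<phi> where "\<phi> x = integral {a - 1..x} \<psi>" for x
  have d1: "(\<phi> has_real_derivative \<psi> x) (at x)" if "x > a - 1" for x
  proof -
    have "(\<phi> has_real_derivative \<psi> x) (at x within {a - 1..x + 1})"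
      unfolding \<phi>_def using that by (intro integral_has_real_derivative c) auto
    then show ?thesis using that by (subst (asm) at_within_interior) auto
  qed
  have lt: "\<phi> x = 0" if "x < a" for x
  proof -
    have "integral {a - 1..x} \<psi> = integral {a - 1..x} (\<lambda>x. 0)"
      by (rule Henstock_Kurzweil_Integration.integral_cong) (use that ab(4) in auto)
    then show ?thesis by (simp add: \<phi>_def)
  qed
  have gt: "\<phi> x = 0" if "x > b" for x
  proof -
    have "integral {a - 1..x} \<psi> = (LBINT t:{a - 1..x}. \<psi> t)"
      by (rule set_borel_integral_eq_integral(2)[symmetric, OF borel_integrable_atLeastAtMost'[OF c]])
    also have "\<dots> = (LBINT t. \<psi> t)"
      unfolding set_lebesgue_integral_def
      by (rule Bochner_Integration.integral_cong) (use that ab in \<open>auto split: split_indicator\<close>)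
    finally show ?thesis using \<psi>(2) by (simp add: \<phi>_def)
  qed
  have d: "(\<phi> has_real_derivative \<psi> x) (at x)" for x
  proof (cases "x > a - 1")
    case False
    have "((\<lambda>x. 0) has_real_derivative 0) (at x)" by simp
    then have "(\<phi> has_real_derivative 0) (at x)"
      by (rule has_field_derivative_transform_within_open[where S="{..<a}"]) (use False lt in auto)
    then show ?thesis using ab(4)[of x] False by simp
  qed (rule d1)
  show ?thesis
  proof
    show "\<phi> \<in> C0_infty I"
    proof (rule C0_inftyI[OF _ compact_Icc sub])
      show "smooth \<phi>" using smooth_primitive[OF C0_infty_smooth[OF \<psi>(1)] d] .
    qed (use lt gt in force)
  qed (rule d)
qed

text \<open>A \<open>\<delta>'\<close>-like potential is the derivative of a test function with integral one: its zeroth moment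
  makes its primitive compactly supported, and integration by parts turns its first moment \<open>-1\<close> into
  the integral \<open>1\<close> of the primitive. This supplies the mollifier that the regularity theory needs.\<close>

lemma delta'_like_mollifier:
  assumes "delta'_like \<Psi>"
  obtains \<rho> where "\<rho> \<in> C0_infty UNIV" "(LBINT x. \<rho> x) = 1"
proof -
  have P: "\<Psi> \<in> C0_infty UNIV" "(LBINT x. \<Psi> x) = 0" "(LBINT x. x * \<Psi> x) = -1"
    using assms by (auto simp: delta'_like_def)
  obtain \<rho> where \<rho>: "\<rho> \<in> C0_infty UNIV" "\<And>x. (\<rho> has_real_derivative \<Psi> x) (at x)"
    by (rule C0_infty_primitive[OF P(1,2)]) auto
  obtain R where R: "R > 0" "\<And>x. \<bar>x\<bar> \<ge> R \<Longrightarrow> \<rho> x = 0" "\<And>x. \<bar>x\<bar> \<ge> R \<Longrightarrow> deriv \<rho> x = 0"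
    by (rule C0_infty_bounded_support[OF \<rho>(1)]) blast
  have d: "deriv \<rho> = \<Psi>" using \<rho>(2) by (auto intro: DERIV_imp_deriv)
  have c: "continuous_on A \<Psi>" "continuous_on A \<rho>" for A
    using smooth_continuous C0_infty_smooth P(1) \<rho>(1) by blast+
  have i: "set_integrable lborel {-R..R} \<rho>" "set_integrable lborel {-R..R} (\<lambda>x. x * \<Psi> x)"
    by (intro borel_integrable_atLeastAtMost' continuous_intros c)+
  have "(LBINT x:{-R..R}. \<rho> x + x * \<Psi> x) = R * \<rho> R - (-R) * \<rho> (-R)"
    unfolding set_lebesgue_integral_def
  proof (rule integral_FTC_atLeastAtMost)
    fix x :: real
    have "((\<lambda>x. x * \<rho> x) has_real_derivative \<rho> x + x * \<Psi> x) (at x)"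
      by (auto intro!: derivative_eq_intros \<rho>(2))
    then show "((\<lambda>x. x * \<rho> x) has_vector_derivative \<rho> x + x * \<Psi> x) (at x within {-R..R})"
      by (simp add: has_real_derivative_iff_has_vector_derivative has_vector_derivative_at_within)
  qed (use R in \<open>auto intro!: continuous_intros c\<close>)
  then have "(LBINT x:{-R..R}. \<rho> x) + (LBINT x:{-R..R}. x * \<Psi> x) = 0"
    using R by (subst (asm) set_integral_add(2)[OF i]) auto
  moreover have "(LBINT x:{-R..R}. \<rho> x) = (LBINT x. \<rho> x)"
    "(LBINT x:{-R..R}. x * \<Psi> x) = (LBINT x. x * \<Psi> x)"
    unfolding set_lebesgue_integral_def
    by (rule Bochner_Integration.integral_cong; use R d in \<open>auto split: split_indicator\<close>)+
  ultimately have "(LBINT x. \<rho> x) = 1" using P(3) by simp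
  with \<rho>(1) that show ?thesis by blast
qed

section \<open>Weak derivatives and absolutely continuous representatives\<close>

text \<open>The primitive of the mollifier is a smooth step; its translates and dilates give smooth
  approximations of indicator functions.\<close>

lemma mollifier_step:
  assumes \<rho>: "\<rho> \<in> C0_infty UNIV" "(LBINT x. \<rho> x) = 1"
  obtains S R B where "R > 0" "smooth S" "\<And>x. x \<le> -R \<Longrightarrow> S x = 0" "\<And>x. x \<ge> R \<Longrightarrow> S x = 1"
    "\<And>x. \<bar>S x\<bar> \<le> B"
proof -
  obtain R where R: "R > 0" "\<And>x. \<bar>x\<bar> \<ge> R \<Longrightarrow> \<rho> x = 0" "\<And>x. \<bar>x\<bar> \<ge> R \<Longrightarrow> deriv \<rho> x = 0"
    by (rule C0_infty_bounded_support[OF \<rho>(1)]) blast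
  have c: "continuous_on A \<rho>" for A using smooth_continuous[OF C0_infty_smooth[OF \<rho>(1)]] .
  define S where "S x = integral {-R - 1..x} \<rho>" for x
  have lt: "S x = 0" if "x \<le> -R" for x
  proof -
    have "integral {-R - 1..x} \<rho> = integral {-R - 1..x} (\<lambda>x. 0)"
      by (rule Henstock_Kurzweil_Integration.integral_cong) (use that R(1) R(2) in auto)
    then show ?thesis by (simp add: S_def)
  qed
  have gt: "S x = 1" if "x \<ge> R" for x
  proof -
    have "integral {-R - 1..x} \<rho> = (LBINT t:{-R - 1..x}. \<rho> t)"
      by (rule set_borel_integral_eq_integral(2)[symmetric, OF borel_integrable_atLeastAtMost'[OF c]])
    also have "\<dots> = (LBINT t. \<rho> t)"
      unfolding set_lebesgue_integral_def
      by (rule Bochner_Integration.integral_cong) (use that R in \<open>auto split: split_indicator\<close>)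
    finally show ?thesis using \<rho>(2) by (simp add: S_def)
  qed
  have d: "(S has_real_derivative \<rho> x) (at x)" for x
  proof (cases "x > -R - 1")
    case True
    have "(S has_real_derivative \<rho> x) (at x within {-R - 1..x + 1})"
      unfolding S_def using True by (intro integral_has_real_derivative c) auto
    then show ?thesis using True by (subst (asm) at_within_interior) auto
  next
    case False
    have "((\<lambda>x. 0) has_real_derivative 0) (at x)" by simp
    then have "(S has_real_derivative 0) (at x)"
      by (rule has_field_derivative_transform_within_open[where S="{..<-R}"]) (use False lt in auto)
    then show ?thesis using R(1) R(2)[of x] False by simp
  qed
  have s: "smooth S" using smooth_primitive[OF C0_infty_smooth[OF \<rho>(1)] d] .
  obtain B where B: "\<And>x. x \<in> {-R..R} \<Longrightarrow> norm (S x) \<le> B"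
    using compact_imp_bounded[OF compact_continuous_image[OF smooth_continuous[OF s] compact_Icc[of "-R" R]]]
    unfolding bounded_iff by blast
  have "\<bar>S x\<bar> \<le> max B 1" for x
    using B[of x] lt[of x] gt[of x] by (cases "x \<le> -R"; cases "x \<ge> R") auto
  then show ?thesis using that R(1) s lt gt by blast
qed

text \<open>Smoothed indicator functions of \<open>[a, b]\<close> are test functions, and they converge boundedly to
  the indicator function off the two end points.\<close>

lemma smoothed_indicator_limit:
  assumes S: "smooth S" "R > 0" "\<And>x. x \<le> -R \<Longrightarrow> S x = 0" "\<And>x. x \<ge> R \<Longrightarrow> S x = 1"
    "\<And>x. \<bar>S x\<bar> \<le> B"
    and I: "is_interval I" "open I" "a \<in> I" "b \<in> I" "a \<le> b"
    and h: "h \<in> borel_measurable lborel" "\<And>a b. set_integrable lborel {a..b} h"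
  shows "\<exists>\<eta>. (\<forall>n::nat. \<eta> n \<in> C0_infty I) \<and>
    (\<lambda>n. LBINT x. \<eta> n x *\<^sub>R h x) \<longlonglongrightarrow> (LBINT x:{a..b}. h x :: complex)"
proof -
  obtain e where e: "e > 0" "\<And>x. \<bar>x - a\<bar> < e \<Longrightarrow> x \<in> I" "\<And>x. \<bar>x - b\<bar> < e \<Longrightarrow> x \<in> I"
  proof -
    obtain e1 e2 where "e1 > 0" "ball a e1 \<subseteq> I" "e2 > 0" "ball b e2 \<subseteq> I"
      using I(2,3,4) open_contains_ball by metis
    then show ?thesis
      by (intro that[of "min e1 e2"]) (auto simp: dist_real_def subset_iff abs_minus_commute)
  qed
  define N where "N n = (R + 1) / e + real n + 1" for n :: nat
  have N: "N n > 0" "R / N n < e" "N n \<ge> 1" for n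
  proof -
    show 1: "N n \<ge> 1" using e(1) S(2) by (simp add: N_def)
    then show "N n > 0" by simp
    have "R < N n * e"
      using e(1) S(2) unfolding N_def by (simp add: field_simps add_pos_nonneg)
    then show "R / N n < e" using \<open>N n > 0\<close> by (simp add: field_simps)
  qed
  define \<eta> where "\<eta> n x = S (N n * (x - a)) - S (N n * (x - b))" for n x
  have z1: "\<eta> n x = 0" if "x \<le> a - R / N n" for n x
  proof -
    have "N n * (x - a) \<le> -R"
      using that N(1)[of n] by (simp add: field_simps)
    moreover have "N n * (x - b) \<le> N n * (x - a)"
      using N(1)[of n] I(5) by (intro mult_left_mono) auto
    ultimately show ?thesis using S(3) by (simp add: \<eta>_def)
  qed
  have z2: "\<eta> n x = 0" if "x \<ge> b + R / N n" for n x
  proof -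
    have "N n * (x - b) \<ge> R"
      using that N(1)[of n] by (simp add: field_simps)
    moreover have "N n * (x - b) \<le> N n * (x - a)"
      using N(1)[of n] I(5) by (intro mult_left_mono) auto
    ultimately show ?thesis using S(4) by (simp add: \<eta>_def)
  qed
  have sub: "{a - R / N n..b + R / N n} \<subseteq> I" for n
  proof
    fix x assume x: "x \<in> {a - R / N n..b + R / N n}"
    consider "x < a" | "x > b" | "x \<in> {a..b}" by force
    then show "x \<in> I"
    proof cases
      case 1 then show ?thesis using e(2)[of x] x N(2)[of n] by auto
    next
      case 2 then show ?thesis using e(3)[of x] x N(2)[of n] by auto
    next
      case 3 then show ?thesis using I by (meson atLeastAtMost_iff is_interval_1)
    qed
  qed
  have sm: "smooth (\<eta> n)" for n
  proof -
    have "smooth (\<lambda>x. 1 * S (N n * x + (- N n * a)) + (-1) * S (N n * x + (- N n * b)))"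
      by (intro smooth_linear_combination smooth_affine S)
    then show ?thesis by (simp add: \<eta>_def[abs_def] algebra_simps)
  qed
  have test: "\<eta> n \<in> C0_infty I" for n
    by (rule C0_inftyI[OF sm compact_Icc sub[of n]]) (use z1[where n=n] z2[where n=n] in force)
  define J where "J = {a - R..b + R}"
  have RN: "R / N n \<le> R" for n using N(3)[of n] S(2) by (simp add: divide_le_eq)
  have supp: "\<eta> n x = 0" if "x \<notin> J" for n x
    using that z1[where n=n and x=x] z2[where n=n and x=x] RN[of n] unfolding J_def by force
  have m: "(\<lambda>x. \<eta> n x *\<^sub>R h x) \<in> borel_measurable lborel" for n
    using smooth_continuous[OF sm, of UNIV n] h(1)
    by (intro borel_measurable_scaleR) (auto intro: borel_measurable_continuous_onI)
  have w: "integrable lborel (\<lambda>x. (2 * B) * norm (indicator J x *\<^sub>R h x))"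
    using h(2)[of "a - R" "b + R"] unfolding J_def set_integrable_def by (intro integrable_mult_right integrable_norm)
  have bd: "norm (\<eta> n x *\<^sub>R h x) \<le> (2 * B) * norm (indicator J x *\<^sub>R h x)" for n x
  proof (cases "x \<in> J")
    case True
    have "\<bar>\<eta> n x\<bar> \<le> 2 * B"
      using S(5)[of "N n * (x - a)"] S(5)[of "N n * (x - b)"] unfolding \<eta>_def by linarith
    then show ?thesis using True by (simp add: mult_right_mono)
  qed (simp add: supp)
  have conv: "(\<lambda>n. \<eta> n x) \<longlonglongrightarrow> indicator {a..b} x" if x: "x \<noteq> a" "x \<noteq> b" for x
  proof -
    have Ninf: "filterlim N at_top sequentially"
    proof (rule filterlim_at_top_mono[OF filterlim_real_sequentially])
      show "\<forall>\<^sub>F n in sequentially. real n \<le> N n" using e(1) S(2) by (auto simp: N_def)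
    qed
    have st: "\<forall>\<^sub>F n in sequentially. S (N n * (x - c)) = (if x < c then 0 else 1)" if "x \<noteq> c" for c
    proof -
      have "\<forall>\<^sub>F n in sequentially. N n \<ge> R / \<bar>x - c\<bar>"
        using Ninf by (simp add: filterlim_at_top)
      then show ?thesis
      proof eventually_elim
        case (elim n)
        then have R: "R \<le> N n * \<bar>x - c\<bar>" using that by (simp add: divide_le_eq)
        show ?case
        proof (cases "x < c")
          case True then show ?thesis using R S(3)[of "N n * (x - c)"] by (simp add: algebra_simps)
        next
          case False then show ?thesis using R S(4)[of "N n * (x - c)"] that by (simp add: algebra_simps)
        qed
      qed
    qed
    have "\<forall>\<^sub>F n in sequentially. \<eta> n x = indicator {a..b} x"
      using st[OF x(1)] st[OF x(2)]
      by eventually_elim (use x I(5) in \<open>auto simp: \<eta>_def split: split_indicator\<close>)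
    then show ?thesis by (rule tendsto_eventually)
  qed
  have lim: "(\<lambda>n. LBINT x. \<eta> n x *\<^sub>R h x) \<longlonglongrightarrow> (LBINT x. indicator {a..b} x *\<^sub>R h x)"
  proof (rule integral_dominated_convergence[OF _ m w])
    show "(\<lambda>x. indicat_real {a..b} x *\<^sub>R h x) \<in> borel_measurable lborel"
      using h(2)[of a b] by (auto simp: set_integrable_def)
    show "AE x in lborel. (\<lambda>i. \<eta> i x *\<^sub>R h x) \<longlonglongrightarrow> indicat_real {a..b} x *\<^sub>R h x"
      using AE_lborel_singleton[of a] AE_lborel_singleton[of b]
      by eventually_elim (intro tendsto_intros conv; simp)
    show "AE x in lborel. norm (\<eta> i x *\<^sub>R h x) \<le> 2 * B * norm (indicat_real J x *\<^sub>R h x)" for i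
      using bd by simp
  qed
  show ?thesis
    using test lim by (auto simp: set_lebesgue_integral_def)
qed

text \<open>The half-lines generate the Borel sets and are stable under intersection, so the integral of \<open>f\<close>
  vanishes on every Borel set.\<close>

lemma AE_zero_if_integrals_zero:
  fixes f :: "real \<Rightarrow> complex"
  assumes f: "integrable lborel f" "(LBINT t. f t) = 0" "\<And>x. (LBINT t:{..x}. f t) = 0"
  shows "AE x in lborel. f x = 0"
proof (rule sigma_finite_measure.density_zero[OF sigma_finite_lborel f(1)])
  have int: "set_integrable lborel A f" if "A \<in> sets borel" for A
    unfolding set_integrable_def using integrable_mult_indicator[OF _ f(1), of A] that by simp
  fix A assume "A \<in> sets (lborel :: real measure)"
  then have A: "A \<in> sigma_sets UNIV (range (\<lambda>a::real. {..a}))"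
    by (simp add: borel_eq_atMost)
  have S: "sigma_sets UNIV (range (\<lambda>a::real. {..a})) = sets borel"
    by (simp add: borel_eq_atMost)
  have sub: "range (\<lambda>a::real. {..a}) \<subseteq> Pow UNIV" by simp
  have stable: "Int_stable (range (\<lambda>a::real. {..a}))"
    by (auto simp: Int_stable_def intro: rev_image_eqI[of "min _ _"])
  from A show "(LBINT x:A. f x) = 0"
  proof (induction rule: sigma_sets_induct_disjoint[OF stable sub, consumes 1, case_names basic empty compl union])
    case (basic A) then show ?case using f(3) by auto
  next
    case (compl A)
    then have m: "A \<in> sets borel" "UNIV - A \<in> sets borel" using S by auto
    have "(LBINT x:A \<union> (UNIV - A). f x) = (LBINT x:A. f x) + (LBINT x:UNIV - A. f x)"
      by (rule set_integral_Un) (use int[OF m(1)] int[OF m(2)] in auto)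
    moreover have "(LBINT x:A \<union> (UNIV - A). f x) = (LBINT x. f x)"
      by (simp add: set_lebesgue_integral_def)
    ultimately show ?case using compl f(2) by simp
  next
    case (union A)
    then have m: "\<And>i. A i \<in> sets borel" using S by blast
    have "(LBINT x:(\<Union>i. A i). f x) = (\<Sum>i. LBINT x:(A i). f x)"
      by (rule lebesgue_integral_countable_add)
         (use m union int[of "\<Union>i. A i"] in \<open>auto simp: disjoint_family_on_def\<close>)
    then show ?case using union by simp
  qed (auto simp: set_lebesgue_integral_def)
qed

text \<open>The lemma of du Bois-Reymond. Subtracting a multiple of a fixed bump makes any test function a
  derivative, so \<open>h\<close> minus a constant integrates to zero against all test functions; smoothed
  indicator functions then show that all integrals over intervals vanish.\<close>

lemma du_Bois_Reymond:
  fixes h :: "real \<Rightarrow> complex"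
  assumes \<rho>: "\<rho> \<in> C0_infty UNIV" "(LBINT x. \<rho> x) = 1"
    and h: "h \<in> borel_measurable lborel" "\<And>a b. set_integrable lborel {a..b} h"
    and I: "is_interval I" "open I" "I \<noteq> {}"
    and 0: "\<And>\<phi>. \<phi> \<in> C0_infty I \<Longrightarrow> (LBINT x. deriv \<phi> x *\<^sub>R h x) = 0"
  shows "\<exists>c. AE x in lborel. x \<in> I \<longrightarrow> h x = c"
proof -
  obtain S R B where S: "R > 0" "smooth S" "\<And>x. x \<le> -R \<Longrightarrow> S x = 0" "\<And>x. x \<ge> R \<Longrightarrow> S x = 1"
    "\<And>x. \<bar>S x\<bar> \<le> B"
    by (rule mollifier_step[OF \<rho>]) blast
  have itest: "integrable lborel (\<lambda>x. \<psi> x *\<^sub>R g x)"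
    if \<psi>: "\<psi> \<in> C0_infty I" and g: "\<And>a b. set_integrable lborel {a..b} g"
    for \<psi> and g :: "real \<Rightarrow> complex"
  proof -
    obtain R where R: "\<And>x. \<bar>x\<bar> \<ge> R \<Longrightarrow> \<psi> x = 0"
      by (rule C0_infty_bounded_support[OF \<psi>]) blast
    show ?thesis
      by (rule integrable_compact_support[OF smooth_continuous[OF C0_infty_smooth[OF \<psi>]] R g])
  qed
  have one: "set_integrable lborel {a..b} (\<lambda>x. c)" for a b :: real and c :: complex
    by (intro borel_integrable_atLeastAtMost' continuous_intros)
  have itest1: "integrable lborel \<psi>" if "\<psi> \<in> C0_infty I" for \<psi>
    using integrable_Re[OF itest[OF that one[of _ _ 1]]] by (simp add: scaleR_conv_of_real)
  obtain a0 b0 where ab0: "a0 \<in> I" "b0 \<in> I" "a0 < b0"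
  proof -
    obtain a e where "a \<in> I" "e > 0" "ball a e \<subseteq> I" using I(2,3) open_contains_ball by blast
    then show ?thesis by (intro that[of a "a + e / 2"]) (auto simp: dist_real_def subset_iff)
  qed
  obtain \<rho>0 where \<rho>0: "\<rho>0 \<in> C0_infty I" "(LBINT x. \<rho>0 x) = 1"
  proof -
    obtain \<eta> where \<eta>: "\<And>n::nat. \<eta> n \<in> C0_infty I"
      "(\<lambda>n. LBINT x. \<eta> n x *\<^sub>R (1::complex)) \<longlonglongrightarrow> (LBINT x:{a0..b0}. 1 :: complex)"
      using smoothed_indicator_limit[OF S(2,1,3,4,5) I(1,2) ab0(1,2) less_imp_le[OF ab0(3)]
        borel_measurable_const one[of _ _ 1]] by blast
    have "(LBINT x:{a0..b0}. 1 :: complex) = b0 - a0"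
      using ab0(3) by (subst set_integral_const) (auto simp: scaleR_conv_of_real)
    with \<eta>(2) have lim: "(\<lambda>n. complex_of_real (LBINT x. \<eta> n x)) \<longlonglongrightarrow> of_real (b0 - a0)"
      by (simp add: scaleR_conv_of_real)
    have "\<exists>n. (LBINT x. \<eta> n x) \<noteq> 0"
    proof (rule ccontr)
      assume "\<not> (\<exists>n. (LBINT x. \<eta> n x) \<noteq> 0)"
      then have "(\<lambda>n. complex_of_real (LBINT x. \<eta> n x)) \<longlonglongrightarrow> 0" by simp
      from LIMSEQ_unique[OF lim this] ab0(3) show False
        by (metis eq_iff_diff_eq_0 less_irrefl of_real_eq_0_iff)
    qed
    then obtain n where n: "(LBINT x. \<eta> n x) \<noteq> 0" by blast
    have "(\<lambda>x. (1 / (LBINT x. \<eta> n x)) * \<eta> n x + 0 * \<eta> n x) \<in> C0_infty I"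
      by (intro C0_infty_linear_combination \<eta>)
    then show ?thesis using n by (intro that[of "\<lambda>x. (1 / (LBINT x. \<eta> n x)) * \<eta> n x"]) auto
  qed
  define c where "c = (LBINT x. \<rho>0 x *\<^sub>R h x)"
  define k where "k x = h x - c" for x
  have k: "k \<in> borel_measurable lborel" "\<And>a b. set_integrable lborel {a..b} k"
    using h one[of _ _ c] unfolding k_def[abs_def] by (auto intro: set_integral_diff(1))
  have ktest: "(LBINT x. \<psi> x *\<^sub>R k x) = 0" if \<psi>: "\<psi> \<in> C0_infty I" for \<psi>
  proof -
    define m where "m = (LBINT x. \<psi> x)"
    have t: "(\<lambda>x. 1 * \<psi> x + (- m) * \<rho>0 x) \<in> C0_infty I"
      by (intro C0_infty_linear_combination \<psi> \<rho>0(1))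
    have "(LBINT x. 1 * \<psi> x + (- m) * \<rho>0 x) = 0"
      using itest1[OF \<psi>] itest1[OF \<rho>0(1)] \<rho>0(2) by (simp add: m_def)
    from C0_infty_primitive[OF t this I(1,3)] obtain \<phi> where \<phi>: "\<phi> \<in> C0_infty I"
      "\<And>x. (\<phi> has_real_derivative 1 * \<psi> x + (- m) * \<rho>0 x) (at x)" by blast
    have d: "deriv \<phi> x = \<psi> x - m * \<rho>0 x" for x using DERIV_imp_deriv[OF \<phi>(2)[of x]] by simp
    have ih: "integrable lborel (\<lambda>x. \<psi> x *\<^sub>R h x)" "integrable lborel (\<lambda>x. \<rho>0 x *\<^sub>R h x)"
      using itest[OF \<psi> h(2)] itest[OF \<rho>0(1) h(2)] .
    have "0 = (LBINT x. \<psi> x *\<^sub>R h x - m *\<^sub>R (\<rho>0 x *\<^sub>R h x))"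
      using 0[OF \<phi>(1)] by (simp add: d algebra_simps)
    also have "\<dots> = (LBINT x. \<psi> x *\<^sub>R h x) - m *\<^sub>R c"
      unfolding c_def using ih by (simp del: scaleR_scaleR)
    finally have "(LBINT x. \<psi> x *\<^sub>R h x) = m *\<^sub>R c" by simp
    moreover have "(LBINT x. \<psi> x *\<^sub>R k x) = (LBINT x. \<psi> x *\<^sub>R h x) - (LBINT x. \<psi> x *\<^sub>R c)"
      unfolding k_def scaleR_diff_right
      using ih(1) itest[OF \<psi> one[of _ _ c]] by (rule Bochner_Integration.integral_diff)
    moreover have "(LBINT x. \<psi> x *\<^sub>R c) = m *\<^sub>R c"
      unfolding m_def using itest1[OF \<psi>] by (intro integral_scaleR_left) auto
    ultimately show ?thesis by simp
  qed
  have kint: "(LBINT x:{a..b}. k x) = 0" if ab: "a \<in> I" "b \<in> I" "a \<le> b" for a b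
  proof -
    obtain \<eta> where \<eta>: "\<And>n::nat. \<eta> n \<in> C0_infty I"
      "(\<lambda>n. LBINT x. \<eta> n x *\<^sub>R k x) \<longlonglongrightarrow> (LBINT x:{a..b}. k x)"
      using smoothed_indicator_limit[OF S(2,1,3,4,5) I(1,2) ab k] by blast
    then show ?thesis using ktest[OF \<eta>(1)] LIMSEQ_unique[OF \<eta>(2), of 0] by simp
  qed
  have AEk: "AE x in lborel. x \<in> {a..b} \<longrightarrow> k x = 0" if ab: "a \<in> I" "b \<in> I" "a \<le> b" for a b
  proof -
    have "AE x in lborel. indicator {a..b} x *\<^sub>R k x = 0"
    proof (rule AE_zero_if_integrals_zero)
      show "integrable lborel (\<lambda>x. indicat_real {a..b} x *\<^sub>R k x)"
        using k(2)[of a b] by (simp add: set_integrable_def)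
      show "(LBINT t. indicat_real {a..b} t *\<^sub>R k t) = 0"
        using kint[OF ab] by (simp add: set_lebesgue_integral_def)
      show "(LBINT t:{..x}. indicat_real {a..b} t *\<^sub>R k t) = 0" for x
      proof -
        have eq: "(LBINT t:{..x}. indicat_real {a..b} t *\<^sub>R k t) = (LBINT t:{a..min x b}. k t)"
          unfolding set_lebesgue_integral_def
          by (rule Bochner_Integration.integral_cong) (auto split: split_indicator)
        show ?thesis
        proof (cases "a \<le> x")
          case True
          then have "min x b = x \<and> a \<le> x \<and> x \<le> b \<or> min x b = b" by linarith
          then have "min x b \<in> I" using I(1)[unfolded is_interval_1] ab(1,2) by metis
          moreover have "a \<le> min x b" using True ab(3) by simp
          ultimately show ?thesis unfolding eq by (intro kint ab(1))
        next
          case False then show ?thesis unfolding eq by (simp add: set_lebesgue_integral_def)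
        qed
      qed
    qed
    then show ?thesis by eventually_elim (simp add: indicator_def)
  qed
  define Q where "Q = {(p, q). p \<in> \<rat> \<and> q \<in> \<rat> \<and> p \<in> I \<and> q \<in> I \<and> p \<le> q}"
  have "countable Q"
    by (rule countable_subset[OF _ countable_SIGMA[OF countable_rat countable_rat]]) (auto simp: Q_def)
  then have "AE x in lborel. \<forall>(p, q)\<in>Q. x \<in> {p..q} \<longrightarrow> k x = 0"
    by (subst AE_ball_countable) (use AEk in \<open>auto simp: Q_def\<close>)
  then have "AE x in lborel. x \<in> I \<longrightarrow> h x = c"
  proof eventually_elim
    case (elim x)
    show ?case
    proof
      assume "x \<in> I"
      then obtain e where e: "e > 0" "ball x e \<subseteq> I" using I(2) open_contains_ball by blast
      obtain p where p: "p \<in> \<rat>" "x - e < p" "p < x" using Rats_dense_in_real[of "x - e" x] e by auto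
      obtain q where q: "q \<in> \<rat>" "x < q" "q < x + e" using Rats_dense_in_real[of x "x + e"] e by auto
      have "p \<in> I" "q \<in> I" using p q e by (auto simp: dist_real_def subset_iff)
      then have "(p, q) \<in> Q" using p q by (simp add: Q_def)
      then show "h x = c" using elim p q by (auto simp: k_def)
    qed
  qed
  then show ?thesis ..
qed

lemma square_integrable_imp_set_integrable:
  assumes "square_integrable f"
  shows "set_integrable lborel {a..b} f"
proof -
  have m: "f \<in> borel_measurable lborel" "integrable lborel (\<lambda>x. (norm (f x))\<^sup>2)"
    using assms by (auto simp: square_integrable_def)
  have i: "integrable lborel (\<lambda>x. indicator {a..b} x + (norm (f x))\<^sup>2)"
    using m(2) borel_integrable_compact[OF compact_Icc[of a b] continuous_on_const[of _ "1::real"]]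
    by (intro Bochner_Integration.integrable_add) simp_all
  show ?thesis unfolding set_integrable_def
  proof (rule Bochner_Integration.integrable_bound[OF i])
    show "(\<lambda>x. indicat_real {a..b} x *\<^sub>R f x) \<in> borel_measurable lborel"
      using m(1) by (intro borel_measurable_scaleR) auto
    have "norm (f x) \<le> 1 + (norm (f x))\<^sup>2" for x
    proof -
      have "0 \<le> (norm (f x) - 1)\<^sup>2 + (norm (f x))\<^sup>2 + 1" by simp
      then show ?thesis by (simp add: power2_diff)
    qed
    then show "AE x in lborel. norm (indicat_real {a..b} x *\<^sub>R f x) \<le> norm (indicat_real {a..b} x + (norm (f x))\<^sup>2)"
      by (auto split: split_indicator)
  qed
qed

lemma l2_rep_measurable: "l2_rep u \<in> borel_measurable lborel"
  using square_integrable_l2_rep by (rule square_integrable_measurable)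

lemma l2_rep_set_integrable: "set_integrable lborel {a..b} (l2_rep u)"
  using square_integrable_l2_rep by (rule square_integrable_imp_set_integrable)

lemma primitive_l2_rep: "\<exists>F. primitive_on UNIV F (l2_rep u)"
  by (intro exists_primitive l2_rep_set_integrable)

text \<open>Let \<open>F\<close> be a primitive of the weak derivative. Integration by parts shows that \<open>y - F\<close> is
  orthogonal to all derivatives of test functions, so it is constant on \<open>I\<close>. The representative is
  defined on the whole line, which makes its one-sided limits at the ends of \<open>I\<close> available as values.\<close>

lemma weak_derivative_representative:
  assumes \<rho>: "\<rho> \<in> C0_infty UNIV" "(LBINT x. \<rho> x) = 1"
    and y: "weak_derivative U y y1" and I: "is_interval I" "open I" "I \<noteq> {}" "I \<subseteq> U"
  shows "\<exists>Y. primitive_on UNIV Y (l2_rep y1) \<and> (AE x in lborel. x \<in> I \<longrightarrow> l2_rep y x = Y x)"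
proof -
  obtain F where F: "primitive_on UNIV F (l2_rep y1)" using primitive_l2_rep by blast
  have cF: "continuous_on A F" for A
    using continuous_on_primitive_UNIV[OF F] continuous_on_subset by blast
  have iF: "set_integrable lborel {a..b} F" for a b
    by (intro borel_integrable_atLeastAtMost' cF)
  have "\<exists>c. AE x in lborel. x \<in> I \<longrightarrow> l2_rep y x - F x = c"
  proof (rule du_Bois_Reymond[OF \<rho> _ _ I(1-3)])
    show "(\<lambda>x. l2_rep y x - F x) \<in> borel_measurable lborel"
      using l2_rep_measurable[of y] borel_measurable_continuous_onI[OF cF] by auto
    show "set_integrable lborel {a..b} (\<lambda>x. l2_rep y x - F x)" for a b
      by (rule set_integral_diff(1)[OF l2_rep_set_integrable iF])
    fix \<phi> assume \<phi>: "\<phi> \<in> C0_infty I"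
    obtain R where R: "\<And>x. \<bar>x\<bar> \<ge> R \<Longrightarrow> deriv \<phi> x = 0"
      by (rule C0_infty_bounded_support[OF \<phi>]) blast
    have c: "continuous_on UNIV (deriv \<phi>)"
      using smooth_continuous[OF smooth_deriv[OF C0_infty_smooth[OF \<phi>]]] .
    have "(LBINT x. deriv \<phi> x *\<^sub>R (l2_rep y x - F x)) = (LBINT x. deriv \<phi> x *\<^sub>R l2_rep y x) - (LBINT x. deriv \<phi> x *\<^sub>R F x)"
      unfolding scaleR_diff_right
      by (rule Bochner_Integration.integral_diff[OF
          integrable_compact_support[OF c R l2_rep_set_integrable] integrable_compact_support[OF c R iF]])
    also have "\<dots> = 0"
      using y C0_infty_mono[OF \<phi> I(4)] integral_by_parts_test[OF \<phi> F] by (simp add: weak_derivative_def)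
    finally show "(LBINT x. deriv \<phi> x *\<^sub>R (l2_rep y x - F x)) = 0" .
  qed
  then obtain c where c: "AE x in lborel. x \<in> I \<longrightarrow> l2_rep y x - F x = c" ..
  have "primitive_on UNIV (\<lambda>x. F x + c) (l2_rep y1)"
    using F by (auto simp: primitive_on_def)
  moreover have "AE x in lborel. x \<in> I \<longrightarrow> l2_rep y x = F x + c"
    using c by eventually_elim auto
  ultimately show ?thesis by blast
qed

lemma weak_derivative_if_primitive:
  assumes "primitive_on UNIV Y Y1" "Y1 \<in> borel_measurable lborel"
    and "AE x in lborel. l2_rep y x = Y x" "AE x in lborel. l2_rep y1 x = Y1 x"
  shows "weak_derivative U y y1"
  unfolding weak_derivative_def
proof
  fix \<phi> assume \<phi>: "\<phi> \<in> C0_infty U"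
  have Y: "Y \<in> borel_measurable lborel"
    using borel_measurable_continuous_onI[OF continuous_on_primitive_UNIV[OF assms(1)]] by simp
  have m: "\<phi> \<in> borel_measurable lborel" "deriv \<phi> \<in> borel_measurable lborel"
    using smooth_continuous[OF C0_infty_smooth[OF \<phi>], of UNIV] smooth_continuous[OF smooth_deriv[OF C0_infty_smooth[OF \<phi>]], of UNIV]
    by (auto intro: borel_measurable_continuous_onI)
  have "(LBINT x. deriv \<phi> x *\<^sub>R l2_rep y x) = (LBINT x. deriv \<phi> x *\<^sub>R Y x)"
    by (rule integral_cong_AE; (intro borel_measurable_scaleR m Y l2_rep_measurable)?) (use assms(3) in auto)
  moreover have "(LBINT x. \<phi> x *\<^sub>R l2_rep y1 x) = (LBINT x. \<phi> x *\<^sub>R Y1 x)"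
    by (rule integral_cong_AE; (intro borel_measurable_scaleR m assms(2) l2_rep_measurable)?) (use assms(4) in auto)
  ultimately show "(LBINT x. deriv \<phi> x *\<^sub>R l2_rep y x) = - (LBINT x. \<phi> x *\<^sub>R l2_rep y1 x)"
    using integral_by_parts_test[OF \<phi> assms(1)] by simp
qed

text \<open>Test functions vanish at the origin, so integrating by parts on the two half-lines produces no
  boundary terms although the function may jump there.\<close>

lemma weak_derivative_if_primitive_punctured:
  assumes "primitive_on {..0} Ym Y1" "primitive_on {0..} Yp Y1" "Y1 \<in> borel_measurable lborel"
    and "AE x in lborel. l2_rep y x = (if x < 0 then Ym x else Yp x)" "AE x in lborel. l2_rep y1 x = Y1 x"
    and "0 \<notin> U"
  shows "weak_derivative U y y1"
  unfolding weak_derivative_def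
proof
  fix \<phi> assume \<phi>: "\<phi> \<in> C0_infty U"
  have m: "\<phi> \<in> borel_measurable lborel"
    using smooth_continuous[OF C0_infty_smooth[OF \<phi>], of UNIV]
    by (auto intro: borel_measurable_continuous_onI)
  have "(LBINT x. \<phi> x *\<^sub>R l2_rep y1 x) = (LBINT x. \<phi> x *\<^sub>R Y1 x)"
    by (rule integral_cong_AE; (intro borel_measurable_scaleR m assms(3) l2_rep_measurable)?) (use assms(5) in auto)
  then show "(LBINT x. deriv \<phi> x *\<^sub>R l2_rep y x) = - (LBINT x. \<phi> x *\<^sub>R l2_rep y1 x)"
    using integral_by_parts_test_punctured[OF \<phi> assms(6,1,2) l2_rep_measurable assms(4)] by simp
qed

section \<open>Elements of the Hilbert space and their representatives\<close>

lemma l2_rep_class: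
  assumes "square_integrable F"
  shows "AE x in lborel. l2_rep (l2_class F) x = F x"
proof -
  have "l2_eq F F" using assms by (simp add: l2_eq_def)
  from Quotient3_rep_abs[OF Quotient3_l2, OF this] show ?thesis by (simp add: l2_eq_def)
qed

lemma l2_class_rep: "l2_class (l2_rep u) = u"
  by (rule Quotient3_abs_rep[OF Quotient3_l2])

lemma l2_eq_iff: "u = v \<longleftrightarrow> (AE x in lborel. l2_rep u x = l2_rep v x)"
proof -
  have "l2_eq (l2_rep u) (l2_rep v) \<longleftrightarrow> u = v" by (rule Quotient3_rel_rep[OF Quotient3_l2])
  then show ?thesis by (auto simp: l2_eq_def square_integrable_l2_rep)
qed

lemma l2_eq_refl: "l2_eq (l2_rep u) (l2_rep u)"
  by (simp add: l2_eq_def square_integrable_l2_rep)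

lemma l2_rep_add: "AE x in lborel. l2_rep (u + v) x = l2_rep u x + l2_rep v x"
proof -
  have "u + v = l2_class (\<lambda>x. l2_rep u x + l2_rep v x)"
    using plus_l2.abs_eq[OF l2_eq_refl[of u] l2_eq_refl[of v]] by (simp add: l2_class_rep)
  then show ?thesis
    using l2_rep_class[OF square_integrable_add[OF square_integrable_l2_rep[of u] square_integrable_l2_rep[of v]]] by simp
qed

lemma l2_rep_scaleC: "AE x in lborel. l2_rep (c *\<^sub>C u) x = c * l2_rep u x"
proof -
  have "c *\<^sub>C u = l2_class (\<lambda>x. c * l2_rep u x)"
    using scaleC_l2.abs_eq[OF l2_eq_refl[of u], of c] by (simp add: l2_class_rep)
  then show ?thesis
    using l2_rep_class[OF square_integrable_mult[OF square_integrable_l2_rep[of u]]] by simp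
qed

lemma l2_rep_scaleR: "AE x in lborel. l2_rep (r *\<^sub>R u) x = complex_of_real r * l2_rep u x"
proof -
  have "r *\<^sub>R u = l2_class (\<lambda>x. of_real r * l2_rep u x)"
    using scaleR_l2.abs_eq[OF l2_eq_refl[of u], of r] by (simp add: l2_class_rep)
  then show ?thesis
    using l2_rep_class[OF square_integrable_mult[OF square_integrable_l2_rep[of u]]] by simp
qed

lemma l2_rep_uminus: "AE x in lborel. l2_rep (- u) x = - l2_rep u x"
  using l2_rep_scaleR[of "-1" u] by simp

lemma l2_rep_diff: "AE x in lborel. l2_rep (u - v) x = l2_rep u x - l2_rep v x"
  using l2_rep_add[of u "- v"] l2_rep_uminus[of v] by eventually_elim simp

lemma l2_rep_zero: "AE x in lborel. l2_rep 0 x = 0"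
  using l2_rep_scaleR[of 0 0] by simp

lemma scaleC_add_right: "c *\<^sub>C (u + v) = c *\<^sub>C u + c *\<^sub>C v"
  unfolding l2_eq_iff
  using l2_rep_scaleC[of c "u + v"] l2_rep_add[of u v] l2_rep_add[of "c *\<^sub>C u" "c *\<^sub>C v"]
    l2_rep_scaleC[of c u] l2_rep_scaleC[of c v]
  by eventually_elim (simp add: algebra_simps)

lemma scaleC_scaleR: "c *\<^sub>C (r *\<^sub>R u) = r *\<^sub>R (c *\<^sub>C u)"
  unfolding l2_eq_iff
  using l2_rep_scaleC[of c "r *\<^sub>R u"] l2_rep_scaleR[of r u] l2_rep_scaleR[of r "c *\<^sub>C u"]
    l2_rep_scaleC[of c u]
  by eventually_elim (simp add: algebra_simps)

lemma norm_l2_class: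
  assumes "square_integrable F"
  shows "norm (l2_class F) = sqrt (LBINT x. (norm (F x))\<^sup>2)"
proof -
  have m: "F \<in> borel_measurable lborel" using assms by (rule square_integrable_measurable)
  have "(LBINT x. (norm (l2_rep (l2_class F) x))\<^sup>2) = (LBINT x. (norm (F x))\<^sup>2)"
    using l2_rep_class[OF assms] m l2_rep_measurable[of "l2_class F"]
    by (intro integral_cong_AE) (auto elim: eventually_mono)
  then show ?thesis by (simp add: norm_l2_eq)
qed

lemma square_integrable_bound:
  assumes "f \<in> borel_measurable lborel" "square_integrable g" "\<And>x. norm (f x) \<le> C * norm (g x)"
  shows "square_integrable f"
proof -
  have i: "integrable lborel (\<lambda>x. C\<^sup>2 * (norm (g x))\<^sup>2)"
    using assms(2) by (simp add: square_integrable_def)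
  have "(norm (f x))\<^sup>2 \<le> C\<^sup>2 * (norm (g x))\<^sup>2" for x
    using power_mono[OF assms(3)[of x], of 2] by (simp add: power_mult_distrib)
  then show ?thesis
    unfolding square_integrable_def
    by (intro conjI assms(1) Bochner_Integration.integrable_bound[OF i]) (use assms(1) in auto)
qed

lemma square_integrable_norm: "square_integrable f \<Longrightarrow> square_integrable (\<lambda>x. of_real (norm (f x)))"
  by (auto simp: square_integrable_def)

text \<open>The Cauchy-Schwarz inequality of the inner product on \<open>l2\<close>, applied to the classes of the absolute
  values.\<close>

lemma l2_Cauchy_Schwarz:
  assumes f: "square_integrable f" and g: "square_integrable g"
  shows "integrable lborel (\<lambda>x. f x * g x)"
    and "(LBINT x. norm (f x * g x)) \<le> sqrt (LBINT x. (norm (f x))\<^sup>2) * sqrt (LBINT x. (norm (g x))\<^sup>2)"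
proof -
  have m: "f \<in> borel_measurable lborel" "g \<in> borel_measurable lborel"
    using f g by (auto simp: square_integrable_def)
  let ?f = "\<lambda>x. complex_of_real (norm (f x))" and ?g = "\<lambda>x. complex_of_real (norm (g x))"
  have e: "l2_eq ?f ?f" "l2_eq ?g ?g"
    using square_integrable_norm[OF f] square_integrable_norm[OF g] by (auto simp: l2_eq_def)
  have in1: "?f x \<bullet> ?g x = norm (f x * g x)" for x
    by (simp add: norm_mult inner_complex_def)
  have i: "integrable lborel (\<lambda>x. norm (f x * g x))"
    using square_integrable_inner[OF square_integrable_norm[OF f] square_integrable_norm[OF g]]
    by (simp add: in1)
  show "integrable lborel (\<lambda>x. f x * g x)"
    by (rule Bochner_Integration.integrable_bound[OF i]) (use m in auto)
  have "(LBINT x. norm (f x * g x)) = l2_class ?f \<bullet> l2_class ?g"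
    using inner_l2.abs_eq[OF e] by (simp add: in1)
  also have "\<dots> \<le> norm (l2_class ?f) * norm (l2_class ?g)"
    by (rule norm_cauchy_schwarz)
  also have "\<dots> = sqrt (LBINT x. (norm (f x))\<^sup>2) * sqrt (LBINT x. (norm (g x))\<^sup>2)"
    by (simp add: norm_l2_class square_integrable_norm f g)
  finally show "(LBINT x. norm (f x * g x)) \<le> sqrt (LBINT x. (norm (f x))\<^sup>2) * sqrt (LBINT x. (norm (g x))\<^sup>2)" .
qed

section \<open>Linear graphs and norm resolvent convergence\<close>

text \<open>Linearity over the reals, the notion to which \<open>bounded_linear\<close> refers.\<close>

definition linear_graph :: "l2_operator \<Rightarrow> bool" where
  "linear_graph T \<longleftrightarrow>
     (\<forall>u f v g. (u, f) \<in> T \<longrightarrow> (v, g) \<in> T \<longrightarrow> (u + v, f + g) \<in> T) \<and>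
     (\<forall>r u f. (u, f) \<in> T \<longrightarrow> (r *\<^sub>R u, r *\<^sub>R f) \<in> T)"

lemma resolvent_unique:
  assumes T: "linear_graph T" and ker: "\<And>u. (u, z *\<^sub>C u) \<in> T \<Longrightarrow> u = 0"
    and uv: "(u, f + z *\<^sub>C u) \<in> T" "(v, f + z *\<^sub>C v) \<in> T"
  shows "u = v"
proof -
  have "(u + (-1) *\<^sub>R v, (f + z *\<^sub>C u) + (-1) *\<^sub>R (f + z *\<^sub>C v)) \<in> T"
    using T uv unfolding linear_graph_def by blast
  moreover have "(f + z *\<^sub>C u) + (-1) *\<^sub>R (f + z *\<^sub>C v) = z *\<^sub>C (u + (-1) *\<^sub>R v)"
    by (simp only: scaleC_add_right scaleC_scaleR) (simp add: algebra_simps)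
  ultimately have "u + (-1) *\<^sub>R v = 0" using ker by metis
  then show ?thesis by simp
qed

lemma resolvent_eq:
  assumes T: "linear_graph T" and ker: "\<And>u. (u, z *\<^sub>C u) \<in> T \<Longrightarrow> u = 0"
    and u: "(u, f + z *\<^sub>C u) \<in> T"
  shows "resolvent T z f = u"
  unfolding resolvent_def
  by (rule the_equality[where a=u]) (use u resolvent_unique[OF T ker] in blast)+

lemma resolvent_set_if_bounded_solutions:
  assumes T: "linear_graph T" and ker: "\<And>u. (u, z *\<^sub>C u) \<in> T \<Longrightarrow> u = 0"
    and ex: "\<And>f. \<exists>u. (u, f + z *\<^sub>C u) \<in> T \<and> norm u \<le> C * norm f"
  shows "z \<in> resolvent_set T"
proof -
  let ?R = "resolvent T z"
  have R: "(?R f, f + z *\<^sub>C ?R f) \<in> T \<and> norm (?R f) \<le> C * norm f" for f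
    using ex[of f] resolvent_eq[OF T ker] by blast
  have "bounded_linear ?R"
  proof (rule bounded_linear_intro[where K=C])
    fix f g
    have "(?R f + ?R g, (f + z *\<^sub>C ?R f) + (g + z *\<^sub>C ?R g)) \<in> T"
      using T R unfolding linear_graph_def by blast
    moreover have "(f + z *\<^sub>C ?R f) + (g + z *\<^sub>C ?R g) = (f + g) + z *\<^sub>C (?R f + ?R g)"
      by (simp add: scaleC_add_right algebra_simps)
    ultimately show "?R (f + g) = ?R f + ?R g" by (intro resolvent_eq[OF T ker]) auto
  next
    fix r f
    have "(r *\<^sub>R ?R f, r *\<^sub>R (f + z *\<^sub>C ?R f)) \<in> T"
      using T R unfolding linear_graph_def by blast
    then show "?R (r *\<^sub>R f) = r *\<^sub>R ?R f"
      by (intro resolvent_eq[OF T ker]) (auto simp: scaleC_scaleR algebra_simps)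
  next
    show "norm (?R f) \<le> norm f * C" for f using R[of f] by (simp add: mult.commute)
  qed
  moreover have "\<exists>!u. (u, f + z *\<^sub>C u) \<in> T" for f
    using R[of f] resolvent_unique[OF T ker] by blast
  ultimately show ?thesis by (simp add: resolvent_set_def)
qed

text \<open>Solvability with bounds and a trivial kernel identify the resolvents, so that norm resolvent
  convergence becomes an estimate between solutions \<open>u\<close> and \<open>u0\<close> for the same right-hand side. The
  bound for \<open>u0\<close> and the estimate of the difference also bound \<open>u\<close>.\<close>

lemma norm_resolvent_convergentI:
  assumes A: "linear_graph A" "\<And>z u. z \<notin> \<real> \<Longrightarrow> (u, z *\<^sub>C u) \<in> A \<Longrightarrow> u = 0"
    and T: "\<And>\<epsilon>. \<epsilon> > 0 \<Longrightarrow> linear_graph (T \<epsilon>)"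
      "\<And>\<epsilon> z u. \<epsilon> > 0 \<Longrightarrow> z \<notin> \<real> \<Longrightarrow> (u, z *\<^sub>C u) \<in> T \<epsilon> \<Longrightarrow> u = 0"
    and ex: "\<And>z. z \<notin> \<real> \<Longrightarrow> \<exists>C \<delta>. (\<delta> \<longlongrightarrow> 0) (at_right 0) \<and>
      (\<forall>f. \<exists>u0. (u0, f + z *\<^sub>C u0) \<in> A \<and> norm u0 \<le> C * norm f \<and>
        (\<forall>\<epsilon>>0. \<exists>u. (u, f + z *\<^sub>C u) \<in> T \<epsilon> \<and> norm (u - u0) \<le> \<delta> \<epsilon> * norm f))"
  shows "norm_resolvent_convergent T A"
  unfolding norm_resolvent_convergent_def
proof (intro allI impI)
  fix z :: complex assume z: "z \<notin> \<real>"
  obtain C and \<delta> :: "real \<Rightarrow> real" where \<delta>: "(\<delta> \<longlongrightarrow> 0) (at_right 0)"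
    and C: "\<forall>f. \<exists>u0. (u0, f + z *\<^sub>C u0) \<in> A \<and> norm u0 \<le> C * norm f \<and>
        (\<forall>\<epsilon>>0. \<exists>u. (u, f + z *\<^sub>C u) \<in> T \<epsilon> \<and> norm (u - u0) \<le> \<delta> \<epsilon> * norm f)"
    using ex[OF z] by blast
  have kA: "\<And>u. (u, z *\<^sub>C u) \<in> A \<Longrightarrow> u = 0" using A(2)[OF z] .
  have RA: "z \<in> resolvent_set A"
  proof (rule resolvent_set_if_bounded_solutions[OF A(1) kA, where C=C])
    show "\<exists>u. (u, f + z *\<^sub>C u) \<in> A \<and> norm u \<le> C * norm f" for f
      using spec[OF C, of f] by blast
  qed
  have main: "z \<in> resolvent_set (T \<epsilon>) \<and> onorm (\<lambda>f. resolvent (T \<epsilon>) z f - resolvent A z f) \<le> \<bar>\<delta> \<epsilon>\<bar> \<and>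
     0 \<le> onorm (\<lambda>f. resolvent (T \<epsilon>) z f - resolvent A z f)" if \<epsilon>: "\<epsilon> > 0" for \<epsilon>
  proof -
    have kT: "\<And>u. (u, z *\<^sub>C u) \<in> T \<epsilon> \<Longrightarrow> u = 0" using T(2)[OF \<epsilon> z] .
    have RT: "z \<in> resolvent_set (T \<epsilon>)"
    proof (rule resolvent_set_if_bounded_solutions[OF T(1)[OF \<epsilon>] kT, where C="C + \<bar>\<delta> \<epsilon>\<bar>"])
      fix f
      obtain u0 u where u: "norm u0 \<le> C * norm f" "(u, f + z *\<^sub>C u) \<in> T \<epsilon>" "norm (u - u0) \<le> \<delta> \<epsilon> * norm f"
        using C \<epsilon> by metis
      have "norm u \<le> norm u0 + norm (u - u0)" by (metis add.commute diff_add_cancel norm_triangle_ineq)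
      also have "\<dots> \<le> C * norm f + \<bar>\<delta> \<epsilon>\<bar> * norm f"
        using u by (intro add_mono order_trans[OF u(3)] mult_right_mono) auto
      finally show "\<exists>u. (u, f + z *\<^sub>C u) \<in> T \<epsilon> \<and> norm u \<le> (C + \<bar>\<delta> \<epsilon>\<bar>) * norm f"
        using u(2) by (auto simp: algebra_simps)
    qed
    have "norm (resolvent (T \<epsilon>) z f - resolvent A z f) \<le> \<bar>\<delta> \<epsilon>\<bar> * norm f" for f
    proof -
      obtain u0 u where u: "(u0, f + z *\<^sub>C u0) \<in> A" "(u, f + z *\<^sub>C u) \<in> T \<epsilon>" "norm (u - u0) \<le> \<delta> \<epsilon> * norm f"
        using C \<epsilon> by metis
      have "\<delta> \<epsilon> * norm f \<le> \<bar>\<delta> \<epsilon>\<bar> * norm f" by (intro mult_right_mono) auto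
      then show ?thesis
        using resolvent_eq[OF A(1) kA u(1)] resolvent_eq[OF T(1)[OF \<epsilon>] kT u(2)] u(3) by simp
    qed
    then have "onorm (\<lambda>f. resolvent (T \<epsilon>) z f - resolvent A z f) \<le> \<bar>\<delta> \<epsilon>\<bar>"
      by (intro onorm_bound) auto
    moreover have "bounded_linear (\<lambda>f. resolvent (T \<epsilon>) z f - resolvent A z f)"
      using RT RA by (intro bounded_linear_sub) (auto simp: resolvent_set_def)
    ultimately show ?thesis using RT onorm_pos_le by blast
  qed
  have "((\<lambda>\<epsilon>. \<bar>\<delta> \<epsilon>\<bar>) \<longlongrightarrow> 0) (at_right 0)" using tendsto_rabs_zero[OF \<delta>] .
  then have "((\<lambda>\<epsilon>. onorm (\<lambda>f. resolvent (T \<epsilon>) z f - resolvent A z f)) \<longlongrightarrow> 0) (at_right 0)"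
    by (rule real_tendsto_sandwich[OF _ _ tendsto_const, rotated 2])
       (use main in \<open>auto simp: eventually_at_right_less eventually_at_topological intro!: eventually_at_rightI[of 0 1]\<close>)
  with RA main show "z \<in> resolvent_set A \<and> (\<forall>\<epsilon>>0. z \<in> resolvent_set (T \<epsilon>)) \<and>
      ((\<lambda>\<epsilon>. onorm (\<lambda>f. resolvent (T \<epsilon>) z f - resolvent A z f)) \<longlongrightarrow> 0) (at_right 0)"
    by blast
qed

lemma test_integrable:
  assumes "\<phi> \<in> C0_infty U"
  shows "integrable lborel (\<lambda>x. \<phi> x *\<^sub>R l2_rep u x)" "integrable lborel (\<lambda>x. deriv \<phi> x *\<^sub>R l2_rep u x)"
proof -
  obtain R where R: "\<And>x. \<bar>x\<bar> \<ge> R \<Longrightarrow> \<phi> x = 0" "\<And>x. \<bar>x\<bar> \<ge> R \<Longrightarrow> deriv \<phi> x = 0"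
    by (rule C0_infty_bounded_support[OF assms]) blast
  note s = C0_infty_smooth[OF assms]
  show "integrable lborel (\<lambda>x. \<phi> x *\<^sub>R l2_rep u x)"
    by (rule integrable_compact_support[OF smooth_continuous[OF s] R(1) l2_rep_set_integrable])
  show "integrable lborel (\<lambda>x. deriv \<phi> x *\<^sub>R l2_rep u x)"
    by (rule integrable_compact_support[OF smooth_continuous[OF smooth_deriv[OF s]] R(2) l2_rep_set_integrable])
qed

lemma weak_derivative_add:
  assumes "weak_derivative U u v" "weak_derivative U u' v'"
  shows "weak_derivative U (u + u') (v + v')"
  unfolding weak_derivative_def
proof
  fix \<phi> assume \<phi>: "\<phi> \<in> C0_infty U"
  note s = C0_infty_smooth[OF \<phi>]
  have m: "\<phi> \<in> borel_measurable lborel" "deriv \<phi> \<in> borel_measurable lborel"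
    using smooth_continuous[OF s, of UNIV] smooth_continuous[OF smooth_deriv[OF s], of UNIV]
    by (auto intro: borel_measurable_continuous_onI)
  have e: "(LBINT x. \<psi> x *\<^sub>R l2_rep (a + b) x) = (LBINT x. \<psi> x *\<^sub>R l2_rep a x) + (LBINT x. \<psi> x *\<^sub>R l2_rep b x)"
    if "\<psi> \<in> borel_measurable lborel" "\<And>u. integrable lborel (\<lambda>x. \<psi> x *\<^sub>R l2_rep u x)" for a b and \<psi> :: "real \<Rightarrow> real"
  proof -
    have "(LBINT x. \<psi> x *\<^sub>R l2_rep (a + b) x) = (LBINT x. \<psi> x *\<^sub>R l2_rep a x + \<psi> x *\<^sub>R l2_rep b x)"
    proof (rule integral_cong_AE)
      show "AE x in lborel. \<psi> x *\<^sub>R l2_rep (a + b) x = \<psi> x *\<^sub>R l2_rep a x + \<psi> x *\<^sub>R l2_rep b x"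
        using l2_rep_add[of a b] by eventually_elim (simp add: scaleR_add_right)
    qed (intro borel_measurable_add borel_measurable_scaleR that(1) l2_rep_measurable)+
    then show ?thesis using that(2) by simp
  qed
  show "(LBINT x. deriv \<phi> x *\<^sub>R l2_rep (u + u') x) = - (LBINT x. \<phi> x *\<^sub>R l2_rep (v + v') x)"
    using assms \<phi> by (simp add: e[OF m(1) test_integrable(1)[OF \<phi>]] e[OF m(2) test_integrable(2)[OF \<phi>]] weak_derivative_def)
qed

lemma weak_derivative_scaleR:
  assumes "weak_derivative U u v"
  shows "weak_derivative U (r *\<^sub>R u) (r *\<^sub>R v)"
  unfolding weak_derivative_def
proof
  fix \<phi> assume \<phi>: "\<phi> \<in> C0_infty U"
  note s = C0_infty_smooth[OF \<phi>]
  have m: "\<phi> \<in> borel_measurable lborel" "deriv \<phi> \<in> borel_measurable lborel"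
    using smooth_continuous[OF s, of UNIV] smooth_continuous[OF smooth_deriv[OF s], of UNIV]
    by (auto intro: borel_measurable_continuous_onI)
  have e: "(LBINT x. \<psi> x *\<^sub>R l2_rep (r *\<^sub>R a) x) = of_real r * (LBINT x. \<psi> x *\<^sub>R l2_rep a x)"
    if "\<psi> \<in> borel_measurable lborel" for a and \<psi> :: "real \<Rightarrow> real"
  proof -
    have "(LBINT x. \<psi> x *\<^sub>R l2_rep (r *\<^sub>R a) x) = (LBINT x. of_real r * (\<psi> x *\<^sub>R l2_rep a x))"
    proof (rule integral_cong_AE)
      show "AE x in lborel. \<psi> x *\<^sub>R l2_rep (r *\<^sub>R a) x = of_real r * (\<psi> x *\<^sub>R l2_rep a x)"
        using l2_rep_scaleR[of r a] by eventually_elim simp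
    qed (intro borel_measurable_times borel_measurable_const borel_measurable_scaleR that l2_rep_measurable)+
    then show ?thesis by (simp del: mult_scaleR_right)
  qed
  show "(LBINT x. deriv \<phi> x *\<^sub>R l2_rep (r *\<^sub>R u) x) = - (LBINT x. \<phi> x *\<^sub>R l2_rep (r *\<^sub>R v) x)"
    using assms \<phi> by (simp add: e[OF m(1)] e[OF m(2)] weak_derivative_def)
qed

lemma l2_on_add:
  assumes "u \<in> l2_on U" "v \<in> l2_on U"
  shows "u + v \<in> l2_on U"
proof -
  have "AE x in lborel. x \<notin> U \<longrightarrow> l2_rep u x = 0" "AE x in lborel. x \<notin> U \<longrightarrow> l2_rep v x = 0"
    using assms by (auto simp: l2_on_def)
  with l2_rep_add[of u v] have "AE x in lborel. x \<notin> U \<longrightarrow> l2_rep (u + v) x = 0"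
    by eventually_elim auto
  then show ?thesis by (simp add: l2_on_def)
qed

lemma l2_on_scaleR:
  assumes "u \<in> l2_on U"
  shows "r *\<^sub>R u \<in> l2_on U"
proof -
  have "AE x in lborel. x \<notin> U \<longrightarrow> l2_rep u x = 0"
    using assms by (auto simp: l2_on_def)
  with l2_rep_scaleR[of r u] have "AE x in lborel. x \<notin> U \<longrightarrow> l2_rep (r *\<^sub>R u) x = 0"
    by eventually_elim auto
  then show ?thesis by (simp add: l2_on_def)
qed

lemma sobolev_2_2_add:
  "(y, y1, y2) \<in> sobolev_2_2 U \<Longrightarrow> (w, w1, w2) \<in> sobolev_2_2 U \<Longrightarrow> (y + w, y1 + w1, y2 + w2) \<in> sobolev_2_2 U"
  by (simp add: sobolev_2_2_def l2_on_add weak_derivative_add)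

lemma sobolev_2_2_scaleR:
  "(y, y1, y2) \<in> sobolev_2_2 U \<Longrightarrow> (r *\<^sub>R y, r *\<^sub>R y1, r *\<^sub>R y2) \<in> sobolev_2_2 U"
  by (simp add: sobolev_2_2_def l2_on_scaleR weak_derivative_scaleR)

lemma has_limit_value_add:
  assumes "has_limit_value u F a" "has_limit_value v F b"
  shows "has_limit_value (u + v) F (a + b)"
proof -
  obtain f g where f: "continuous_on (- {0}) f" "AE x in lborel. l2_rep u x = f x" "(f \<longlongrightarrow> a) F"
    and g: "continuous_on (- {0}) g" "AE x in lborel. l2_rep v x = g x" "(g \<longlongrightarrow> b) F"
    using assms by (auto simp: has_limit_value_def)
  have "AE x in lborel. l2_rep (u + v) x = f x + g x"
    using l2_rep_add[of u v] f(2) g(2) by eventually_elim simp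
  then show ?thesis unfolding has_limit_value_def
    using continuous_on_add[OF f(1) g(1)] tendsto_add[OF f(3) g(3)] by blast
qed

lemma has_limit_value_scaleR:
  assumes "has_limit_value u F a"
  shows "has_limit_value (r *\<^sub>R u) F (of_real r * a)"
proof -
  obtain f where f: "continuous_on (- {0}) f" "AE x in lborel. l2_rep u x = f x" "(f \<longlongrightarrow> a) F"
    using assms by (auto simp: has_limit_value_def)
  have "AE x in lborel. l2_rep (r *\<^sub>R u) x = of_real r * f x"
    using l2_rep_scaleR[of r u] f(2) by eventually_elim simp
  then show ?thesis unfolding has_limit_value_def
    using continuous_on_mult_left[OF f(1)] tendsto_mult_left[OF f(3)] by blast
qed

lemma linear_graph_H_eps: "linear_graph (H_eps \<epsilon> \<alpha> \<Psi>)"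
  unfolding linear_graph_def
proof (intro conjI allI impI)
  fix y f w g assume "(y, f) \<in> H_eps \<epsilon> \<alpha> \<Psi>" "(w, g) \<in> H_eps \<epsilon> \<alpha> \<Psi>"
  then obtain y1 y2 w1 w2 where *: "(y, y1, y2) \<in> sobolev_2_2 UNIV" "(w, w1, w2) \<in> sobolev_2_2 UNIV"
    "AE x in lborel. l2_rep f x = - l2_rep y2 x + (\<alpha> / \<epsilon>\<^sup>2 * \<Psi> (x / \<epsilon>)) *\<^sub>R l2_rep y x"
    "AE x in lborel. l2_rep g x = - l2_rep w2 x + (\<alpha> / \<epsilon>\<^sup>2 * \<Psi> (x / \<epsilon>)) *\<^sub>R l2_rep w x"
    by (auto simp: H_eps_def)
  have "AE x in lborel. l2_rep (f + g) x = - l2_rep (y2 + w2) x + (\<alpha> / \<epsilon>\<^sup>2 * \<Psi> (x / \<epsilon>)) *\<^sub>R l2_rep (y + w) x"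
    using *(3,4) l2_rep_add[of f g] l2_rep_add[of y2 w2] l2_rep_add[of y w]
    by eventually_elim (simp add: scaleR_add_right)
  then show "(y + w, f + g) \<in> H_eps \<epsilon> \<alpha> \<Psi>"
    using sobolev_2_2_add[OF *(1,2)] by (auto simp: H_eps_def)
next
  fix r y f assume "(y, f) \<in> H_eps \<epsilon> \<alpha> \<Psi>"
  then obtain y1 y2 where *: "(y, y1, y2) \<in> sobolev_2_2 UNIV"
    "AE x in lborel. l2_rep f x = - l2_rep y2 x + (\<alpha> / \<epsilon>\<^sup>2 * \<Psi> (x / \<epsilon>)) *\<^sub>R l2_rep y x"
    by (auto simp: H_eps_def)
  have "AE x in lborel. l2_rep (r *\<^sub>R f) x = - l2_rep (r *\<^sub>R y2) x + (\<alpha> / \<epsilon>\<^sup>2 * \<Psi> (x / \<epsilon>)) *\<^sub>R l2_rep (r *\<^sub>R y) x"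
    using *(2) l2_rep_scaleR[of r f] l2_rep_scaleR[of r y2] l2_rep_scaleR[of r y]
    by eventually_elim (simp only: scaleR_conv_of_real distrib_left mult_minus_right mult.left_commute)
  then show "(r *\<^sub>R y, r *\<^sub>R f) \<in> H_eps \<epsilon> \<alpha> \<Psi>"
    using sobolev_2_2_scaleR[OF *(1)] by (auto simp: H_eps_def)
qed

lemma linear_graph_S_op: "linear_graph (S_op \<theta>)"
  unfolding linear_graph_def
proof (intro conjI allI impI)
  fix y f w g assume "(y, f) \<in> S_op \<theta>" "(w, g) \<in> S_op \<theta>"
  then obtain y1 y2 w1 w2 a b c d a' b' c' d' where *: "f = - y2" "g = - w2"
    "(y, y1, y2) \<in> sobolev_2_2 (- {0})" "(w, w1, w2) \<in> sobolev_2_2 (- {0})"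
    "has_limit_value y (at_left 0) a" "has_limit_value y (at_right 0) b" "b = of_real \<theta> * a"
    "has_limit_value y1 (at_left 0) c" "has_limit_value y1 (at_right 0) d" "of_real \<theta> * d = c"
    "has_limit_value w (at_left 0) a'" "has_limit_value w (at_right 0) b'" "b' = of_real \<theta> * a'"
    "has_limit_value w1 (at_left 0) c'" "has_limit_value w1 (at_right 0) d'" "of_real \<theta> * d' = c'"
    unfolding S_op_def by blast
  have "f + g = - (y2 + w2)" using * by simp
  moreover have "b + b' = of_real \<theta> * (a + a')" "of_real \<theta> * (d + d') = c + c'"
    using * by (auto simp: algebra_simps)
  ultimately show "(y + w, f + g) \<in> S_op \<theta>"
    using sobolev_2_2_add[OF *(3,4)] has_limit_value_add[OF *(5) *(11)] has_limit_value_add[OF *(6) *(12)]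
      has_limit_value_add[OF *(8) *(14)] has_limit_value_add[OF *(9) *(15)]
    unfolding S_op_def by blast
next
  fix r y f assume "(y, f) \<in> S_op \<theta>"
  then obtain y1 y2 a b c d where *: "f = - y2" "(y, y1, y2) \<in> sobolev_2_2 (- {0})"
    "has_limit_value y (at_left 0) a" "has_limit_value y (at_right 0) b" "b = of_real \<theta> * a"
    "has_limit_value y1 (at_left 0) c" "has_limit_value y1 (at_right 0) d" "of_real \<theta> * d = c"
    unfolding S_op_def by blast
  have "r *\<^sub>R f = - (r *\<^sub>R y2)" using * by simp
  moreover have "of_real r * b = of_real \<theta> * (of_real r * a)" "of_real \<theta> * (of_real r * d) = of_real r * c"
    using * by (auto simp: algebra_simps)
  ultimately show "(r *\<^sub>R y, r *\<^sub>R f) \<in> S_op \<theta>"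
    using sobolev_2_2_scaleR[OF *(2)] has_limit_value_scaleR[OF *(3)] has_limit_value_scaleR[OF *(4)]
      has_limit_value_scaleR[OF *(6)] has_limit_value_scaleR[OF *(7)]
    unfolding S_op_def by blast
qed

lemma linear_graph_Dirichlet:
  "linear_graph {(y, - y2) | y y1 y2. (y, y1, y2) \<in> sobolev_2_2 U \<and> has_limit_value y F 0}"
  (is "linear_graph ?T")
  unfolding linear_graph_def
proof (intro conjI allI impI)
  fix y f w g assume "(y, f) \<in> ?T" "(w, g) \<in> ?T"
  then obtain y1 y2 w1 w2 where *: "f = - y2" "g = - w2"
    "(y, y1, y2) \<in> sobolev_2_2 U" "(w, w1, w2) \<in> sobolev_2_2 U"
    "has_limit_value y F 0" "has_limit_value w F 0"
    by blast
  have "f + g = - (y2 + w2)" using * by simp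
  then show "(y + w, f + g) \<in> ?T"
    using sobolev_2_2_add[OF *(3,4)] has_limit_value_add[OF *(5,6)] unfolding add_0 by blast
next
  fix r y f assume "(y, f) \<in> ?T"
  then obtain y1 y2 where *: "f = - y2" "(y, y1, y2) \<in> sobolev_2_2 U" "has_limit_value y F 0"
    by blast
  have "r *\<^sub>R f = - (r *\<^sub>R y2)" using * by simp
  then show "(r *\<^sub>R y, r *\<^sub>R f) \<in> ?T"
    using sobolev_2_2_scaleR[OF *(2)] has_limit_value_scaleR[OF *(3)] unfolding mult_zero_right by blast
qed

lemma linear_graph_direct_sum:
  assumes A: "linear_graph A" and B: "linear_graph B"
  shows "linear_graph (A \<oplus>\<^sub>o\<^sub>p B)"
  unfolding linear_graph_def
proof (intro conjI allI impI)
  fix y f w g assume "(y, f) \<in> A \<oplus>\<^sub>o\<^sub>p B" "(w, g) \<in> A \<oplus>\<^sub>o\<^sub>p B"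
  then obtain u v a b u' v' a' b' where *: "y = u + v" "f = a + b" "w = u' + v'" "g = a' + b'"
    "(u, a) \<in> A" "(v, b) \<in> B" "(u', a') \<in> A" "(v', b') \<in> B"
    unfolding direct_sum_def by blast
  have "(u + u', a + a') \<in> A" "(v + v', b + b') \<in> B"
    using A B * unfolding linear_graph_def by blast+
  moreover have "y + w = (u + u') + (v + v')" "f + g = (a + a') + (b + b')"
    using * by simp_all
  ultimately show "(y + w, f + g) \<in> A \<oplus>\<^sub>o\<^sub>p B" unfolding direct_sum_def by blast
next
  fix r y f assume "(y, f) \<in> A \<oplus>\<^sub>o\<^sub>p B"
  then obtain u v a b where *: "y = u + v" "f = a + b" "(u, a) \<in> A" "(v, b) \<in> B"
    unfolding direct_sum_def by blast
  have "(r *\<^sub>R u, r *\<^sub>R a) \<in> A" "(r *\<^sub>R v, r *\<^sub>R b) \<in> B"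
    using A B * unfolding linear_graph_def by blast+
  moreover have "r *\<^sub>R y = r *\<^sub>R u + r *\<^sub>R v" "r *\<^sub>R f = r *\<^sub>R a + r *\<^sub>R b"
    using * by (simp_all add: scaleR_add_right)
  ultimately show "(r *\<^sub>R y, r *\<^sub>R f) \<in> A \<oplus>\<^sub>o\<^sub>p B" unfolding direct_sum_def by blast
qed

section \<open>Uniqueness\<close>

lemma primitive_on_reflect:
  assumes "primitive_on {..0} F f"
  shows "primitive_on {0..} (\<lambda>x. F (- x)) (\<lambda>x. - f (- x))"
proof (rule primitive_onI)
  fix a b :: real assume "a \<in> {0..}" "b \<in> {0..}" "a \<le> b"
  then have ab: "- b \<in> {..0}" "- a \<in> {..0}" "- b \<le> - a" by auto
  note P = primitive_onD[OF assms ab]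
  have ind: "indicator {- b..- a} (- x) = (indicator {a..b} x :: real)" for x
    by (auto split: split_indicator)
  have "integrable lborel (\<lambda>x. indicator {- b..- a} (0 + (-1) * x) *\<^sub>R f (0 + (-1) * x))"
    using P(1) unfolding set_integrable_def by (intro lborel_integrable_real_affine) auto
  then have i: "set_integrable lborel {a..b} (\<lambda>x. f (- x))"
    by (simp add: ind set_integrable_def)
  then show "set_integrable lborel {a..b} (\<lambda>x. - f (- x))"
    by (simp add: set_integrable_def)
  have "(LBINT x:{- b..- a}. f x) = (LBINT x:{a..b}. f (- x))"
    unfolding set_lebesgue_integral_def
    by (subst lborel_integral_real_affine[where c="-1" and t=0]) (simp_all add: ind)
  then show "F (- b) - F (- a) = (LBINT x:{a..b}. - f (- x))"
    using P(2) by (simp add: set_integral_uminus[OF i] algebra_simps)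
qed

text \<open>The flux \<open>Im (cnj Y * Y')\<close> of a solution of \<open>- Y'' + V * Y = z * Y\<close> with real \<open>V\<close> has derivative
  \<open>- Im z * norm Y ^ 2\<close>, so its product with \<open>Im z\<close> is nonincreasing. It is integrable because \<open>Y\<close> and
  \<open>Y'\<close> are square integrable; a nonincreasing function with a negative value would not be integrable
  up to \<open>\<infinity>\<close>. If the product is zero at the origin, it is zero throughout, and so is its derivative.\<close>

lemma flux_right:
  assumes Y: "primitive_on {0..} Y Y1" and Y1: "primitive_on {0..} Y1 (\<lambda>x. (of_real (V x) - z) * Y x)"
    and int: "set_integrable lborel {0..} (\<lambda>x. Y x * Y1 x)" and z: "Im z \<noteq> 0"
  shows "0 \<le> Im z * Im (cnj (Y 0) * Y1 0)"
    and "Im z * Im (cnj (Y 0) * Y1 0) = 0 \<Longrightarrow> x \<ge> 0 \<Longrightarrow> Y x = 0"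
proof -
  define j where "j x = Im z * Im (cnj (Y x) * Y1 x)" for x
  have cY: "continuous_on {a..b} Y" if "0 \<le> a" for a b
    by (rule continuous_on_primitive_Icc[OF primitive_on_subset[OF Y]]) (use that in auto)
  have cY1: "continuous_on {a..b} Y1" if "0 \<le> a" for a b
    by (rule continuous_on_primitive_Icc[OF primitive_on_subset[OF Y1]]) (use that in auto)
  have P: "primitive_on {0..} (\<lambda>x. cnj (Y x) * Y1 x)
      (\<lambda>x. cnj (Y1 x) * Y1 x + cnj (Y x) * ((of_real (V x) - z) * Y x))"
    by (rule primitive_on_mult[OF primitive_on_cnj[OF Y] Y1]) (rule is_interval_ci)
  have Im: "Im (cnj (Y1 x) * Y1 x + cnj (Y x) * ((of_real (V x) - z) * Y x)) = - Im z * (norm (Y x))\<^sup>2" for x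
    by (simp add: cmod_power2) (simp add: power2_eq_square algebra_simps)
  have diff: "j b - j a = - (Im z)\<^sup>2 * integral {a..b} (\<lambda>x. (norm (Y x))\<^sup>2)" if ab: "0 \<le> a" "a \<le> b" for a b
  proof -
    let ?g = "\<lambda>x. cnj (Y1 x) * Y1 x + cnj (Y x) * ((of_real (V x) - z) * Y x)"
    have PD: "set_integrable lborel {a..b} ?g"
      "cnj (Y b) * Y1 b - cnj (Y a) * Y1 a = (LBINT x:{a..b}. ?g x)"
      using primitive_onD[OF P, of a b] ab by auto
    have "Im (LBINT x:{a..b}. ?g x) = (LBINT x. Im (indicator {a..b} x *\<^sub>R ?g x))"
      using PD(1) unfolding set_integrable_def set_lebesgue_integral_def by (rule integral_Im[symmetric])
    also have "\<dots> = (LBINT x:{a..b}. - Im z * (norm (Y x))\<^sup>2)"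
      unfolding set_lebesgue_integral_def scaleR_complex.simps Im by simp
    also have "\<dots> = - Im z * (LBINT x:{a..b}. (norm (Y x))\<^sup>2)"
      by (rule set_integral_mult_right)
    also have "(LBINT x:{a..b}. (norm (Y x))\<^sup>2) = integral {a..b} (\<lambda>x. (norm (Y x))\<^sup>2)"
      by (intro set_borel_integral_eq_integral(2) borel_integrable_atLeastAtMost' continuous_intros cY ab)
    finally have "Im (cnj (Y b) * Y1 b - cnj (Y a) * Y1 a) = - Im z * integral {a..b} (\<lambda>x. (norm (Y x))\<^sup>2)"
      using PD(2) by simp
    then show ?thesis
      unfolding j_def by (simp add: power2_eq_square right_diff_distrib[symmetric] del: complex_cnj_mult)
  qed
  have I0: "0 \<le> integral {a..b} (\<lambda>x. (norm (Y x))\<^sup>2)" if "0 \<le> a" for a b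
    by (intro Henstock_Kurzweil_Integration.integral_nonneg integrable_continuous_interval continuous_intros cY that) simp
  have nonneg: "0 \<le> j a" if a: "0 \<le> a" for a
  proof (rule ccontr)
    assume "\<not> 0 \<le> j a"
    define c where "c = - j a"
    have c: "c > 0" using \<open>\<not> 0 \<le> j a\<close> by (simp add: c_def)
    have le: "\<bar>Im z\<bar> * norm (Y x * Y1 x) \<ge> c" if "x \<ge> a" for x
    proof -
      have "0 \<le> (Im z)\<^sup>2 * integral {a..x} (\<lambda>x. (norm (Y x))\<^sup>2)" using I0[OF a, of x] by simp
      then have "j x \<le> - c" using diff[OF a that] by (simp add: c_def)
      then have "c \<le> \<bar>j x\<bar>" using c by simp
      also have "\<dots> \<le> \<bar>Im z\<bar> * norm (cnj (Y x) * Y1 x)"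
        unfolding j_def abs_mult by (intro mult_left_mono abs_Im_le_cmod) auto
      finally show ?thesis by (simp add: norm_mult)
    qed
    have i: "integrable lborel (\<lambda>x. indicator {0..} x *\<^sub>R (\<bar>Im z\<bar> * norm (Y x * Y1 x)))"
      using integrable_mult_right[OF integrable_norm[OF int[unfolded set_integrable_def]], of "\<bar>Im z\<bar>"]
      by (simp add: mult_ac)
    define T where "T = (LBINT x. indicator {0..} x *\<^sub>R (\<bar>Im z\<bar> * norm (Y x * Y1 x)))"
    have "c * n \<le> T" if "n \<ge> 0" for n
    proof -
      have ic: "integrable lborel (\<lambda>x. indicator {a..a + n} x *\<^sub>R c)"
        by (intro borel_integrable_compact) auto
      have "c * n = (LBINT x:{a..a + n}. c)"
        using that by (subst set_integral_const) auto
      also have "\<dots> \<le> T"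
        unfolding set_lebesgue_integral_def T_def
        by (intro integral_mono ic i) (use le a c in \<open>auto split: split_indicator\<close>)
      finally show ?thesis .
    qed
    from this[of "(\<bar>T\<bar> + 1) / c"] show False using c by simp
  qed
  show "0 \<le> Im z * Im (cnj (Y 0) * Y1 0)" using nonneg[of 0] by (simp add: j_def)
  assume 0: "Im z * Im (cnj (Y 0) * Y1 0) = 0" and x: "x \<ge> 0"
  have "integral {0..x + 1} (\<lambda>x. (norm (Y x))\<^sup>2) \<le> 0"
  proof -
    have "j 0 = 0" using 0 by (simp add: j_def)
    then have "(Im z)\<^sup>2 * integral {0..x + 1} (\<lambda>x. (norm (Y x))\<^sup>2) \<le> 0"
      using diff[of 0 "x + 1"] nonneg[of "x + 1"] x by simp
    then show ?thesis using z by (simp add: mult_le_0_iff)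
  qed
  then have "integral {0..x + 1} (\<lambda>x. (norm (Y x))\<^sup>2) = 0"
    using I0[of 0 "x + 1"] by simp
  moreover have "continuous_on {0..x + 1} (\<lambda>x. (norm (Y x))\<^sup>2)"
    by (intro continuous_intros cY) simp
  ultimately have "\<forall>t\<in>{0..x + 1}. (norm (Y t))\<^sup>2 = 0"
    using x by (subst (asm) integral_eq_0_iff) auto
  then show "Y x = 0" using x by auto
qed

text \<open>Reflection reverses the sign of the derivative and hence of the flux.\<close>

lemma flux_left:
  assumes Y: "primitive_on {..0} Y Y1" and Y1: "primitive_on {..0} Y1 (\<lambda>x. (of_real (V x) - z) * Y x)"
    and int: "set_integrable lborel {..0} (\<lambda>x. Y x * Y1 x)" and z: "Im z \<noteq> 0"
  shows "Im z * Im (cnj (Y 0) * Y1 0) \<le> 0"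
    and "Im z * Im (cnj (Y 0) * Y1 0) = 0 \<Longrightarrow> x \<le> 0 \<Longrightarrow> Y x = 0"
proof -
  have 1: "primitive_on {0..} (\<lambda>x. Y (- x)) (\<lambda>x. - Y1 (- x))"
    by (rule primitive_on_reflect[OF Y])
  have 2: "primitive_on {0..} (\<lambda>x. - Y1 (- x)) (\<lambda>x. (of_real (V (- x)) - z) * Y (- x))"
    using primitive_on_cmult[OF primitive_on_reflect[OF Y1], of "-1"] by simp
  have ind: "indicator {..0} (- x) = (indicator {0..} x :: real)" for x :: real
    by (auto split: split_indicator)
  have "integrable lborel (\<lambda>x. indicator {..0} (0 + (-1) * x) *\<^sub>R (Y (0 + (-1) * x) * Y1 (0 + (-1) * x)))"
    using int unfolding set_integrable_def by (intro lborel_integrable_real_affine) auto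
  then have 3: "set_integrable lborel {0..} (\<lambda>x. Y (- x) * - Y1 (- x))"
    by (simp add: ind set_integrable_def)
  note F = flux_right[OF 1 2 3 z]
  show "Im z * Im (cnj (Y 0) * Y1 0) \<le> 0" using F(1) by (simp add: algebra_simps)
  show "Y x = 0" if "Im z * Im (cnj (Y 0) * Y1 0) = 0" "x \<le> 0"
  proof -
    have "Im z * Im (cnj (Y (- 0)) * - Y1 (- 0)) = - (Im z * Im (cnj (Y 0) * Y1 0))"
      by (simp add: algebra_simps)
    then show ?thesis using F(2)[of "- x"] that by simp
  qed
qed

lemma AE_open_interval_witness:
  assumes "AE x in lborel. P x" "a < (b::real)"
  obtains x where "x \<in> {a<..<b}" "P x"
proof (rule ccontr)
  assume "\<not> thesis"
  with that have "\<And>x. x \<in> {a<..<b} \<Longrightarrow> \<not> P x" by blast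
  with assms(1) have "AE x in lborel. x \<notin> {a<..<b}" by (auto elim!: eventually_mono)
  then have "{a<..<b} \<in> null_sets lborel" by (subst AE_iff_null_sets) auto
  then have "emeasure lborel {a<..<b} = 0" by auto
  then show False using assms(2) by simp
qed

lemma AE_eq_imp_eq_continuous:
  fixes f g :: "real \<Rightarrow> complex"
  assumes "open S" "continuous_on S f" "continuous_on S g" "AE x in lborel. x \<in> S \<longrightarrow> f x = g x" "x \<in> S"
  shows "f x = g x"
proof (rule ccontr)
  assume ne: "f x \<noteq> g x"
  have "open {x \<in> S. f x - g x \<in> - {0}}"
    by (rule continuous_open_preimage[OF continuous_on_diff[OF assms(2,3)] assms(1), simplified vimage_def Int_def mem_Collect_eq])
       auto
  moreover have "x \<in> {x \<in> S. f x - g x \<in> - {0}}" using ne assms(5) by simp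
  ultimately obtain e where e: "e > 0" "ball x e \<subseteq> {x \<in> S. f x - g x \<in> - {0}}"
    using open_contains_ball by blast
  obtain y where "y \<in> {x - e<..<x + e}" "y \<in> S \<longrightarrow> f y = g y"
    by (rule AE_open_interval_witness[OF assms(4), of "x - e" "x + e"]) (use e in auto)
  moreover from this have "y \<in> ball x e" by (auto simp: dist_real_def)
  ultimately show False using e(2) by auto
qed

lemma has_limit_value_right:
  assumes u: "has_limit_value u (at_right 0) a" and Y: "continuous_on UNIV Y"
    and eq: "AE x in lborel. x > 0 \<longrightarrow> l2_rep u x = Y x"
  shows "Y 0 = a"
proof -
  obtain f where f: "continuous_on (- {0}) f" "AE x in lborel. l2_rep u x = f x" "(f \<longlongrightarrow> a) (at_right 0)"
    using u by (auto simp: has_limit_value_def)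
  have "AE x in lborel. x \<in> {0<..} \<longrightarrow> f x = Y x"
    using f(2) eq by eventually_elim auto
  then have "f x = Y x" if "x > 0" for x
    using AE_eq_imp_eq_continuous[OF open_greaterThan continuous_on_subset[OF f(1)] continuous_on_subset[OF Y]] that
    by auto
  then have "(Y \<longlongrightarrow> a) (at_right 0)"
    using f(3) by (auto intro!: filterlim_cong[THEN iffD1, OF refl refl _ f(3)] eventually_at_rightI[of 0 1])
  moreover have "(Y \<longlongrightarrow> Y 0) (at_right 0)"
    using Y by (auto simp: continuous_on_eq_continuous_at continuous_at intro: tendsto_within_subset)
  ultimately show ?thesis using tendsto_unique[OF trivial_limit_at_right_real] by blast
qed

lemma has_limit_value_left:
  assumes u: "has_limit_value u (at_left 0) a" and Y: "continuous_on UNIV Y"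
    and eq: "AE x in lborel. x < 0 \<longrightarrow> l2_rep u x = Y x"
  shows "Y 0 = a"
proof -
  obtain f where f: "continuous_on (- {0}) f" "AE x in lborel. l2_rep u x = f x" "(f \<longlongrightarrow> a) (at_left 0)"
    using u by (auto simp: has_limit_value_def)
  have "AE x in lborel. x \<in> {..<0} \<longrightarrow> f x = Y x"
    using f(2) eq by eventually_elim auto
  then have "f x = Y x" if "x < 0" for x
    using AE_eq_imp_eq_continuous[OF open_lessThan continuous_on_subset[OF f(1)] continuous_on_subset[OF Y]] that
    by auto
  then have "(Y \<longlongrightarrow> a) (at_left 0)"
    using f(3) by (auto intro!: filterlim_cong[THEN iffD1, OF refl refl _ f(3)] eventually_at_leftI[of "-1" 0])
  moreover have "(Y \<longlongrightarrow> Y 0) (at_left 0)"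
    using Y by (auto simp: continuous_on_eq_continuous_at continuous_at intro: tendsto_within_subset)
  ultimately show ?thesis using tendsto_unique[OF trivial_limit_at_left_real] by blast
qed

text \<open>Applying the regularity lemma to \<open>y\<close> and to \<open>y1\<close> turns a weak solution into a pair of primitives.
  The interval \<open>J\<close> may be the closure of \<open>I\<close>, so that the pair can be evaluated at the interface.\<close>

lemma weak_solution_representative:
  assumes \<rho>: "\<rho> \<in> C0_infty UNIV" "(LBINT x. \<rho> x) = 1"
    and y: "weak_derivative U y y1" "weak_derivative U y1 y2"
    and I: "is_interval I" "open I" "I \<noteq> {}" "I \<subseteq> U"
    and J: "is_interval J" "AE x in lborel. x \<in> J \<longrightarrow> x \<in> I"
    and V: "continuous_on UNIV V"
    and eq: "AE x in lborel. x \<in> I \<longrightarrow> l2_rep y2 x = (complex_of_real (V x) - z) * l2_rep y x"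
  obtains Y Y1 where "continuous_on UNIV Y" "continuous_on UNIV Y1"
    "AE x in lborel. x \<in> I \<longrightarrow> l2_rep y x = Y x" "AE x in lborel. x \<in> I \<longrightarrow> l2_rep y1 x = Y1 x"
    "primitive_on J Y Y1" "primitive_on J Y1 (\<lambda>x. (of_real (V x) - z) * Y x)"
    "set_integrable lborel J (\<lambda>x. Y x * Y1 x)"
proof -
  obtain Y where Y: "primitive_on UNIV Y (l2_rep y1)" "AE x in lborel. x \<in> I \<longrightarrow> l2_rep y x = Y x"
    using weak_derivative_representative[OF \<rho> y(1) I] by blast
  obtain Y1 where Y1: "primitive_on UNIV Y1 (l2_rep y2)" "AE x in lborel. x \<in> I \<longrightarrow> l2_rep y1 x = Y1 x"
    using weak_derivative_representative[OF \<rho> y(2) I] by blast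
  have c: "continuous_on UNIV Y" "continuous_on UNIV Y1"
    using continuous_on_primitive_UNIV Y Y1 by blast+
  have m: "Y \<in> borel_measurable lborel" "Y1 \<in> borel_measurable lborel"
    using c by (auto intro: borel_measurable_continuous_onI)
  have "continuous_on UNIV (\<lambda>x. (complex_of_real (V x) - z) * Y x)"
    by (intro continuous_intros c V)
  then have m2: "(\<lambda>x. (complex_of_real (V x) - z) * Y x) \<in> borel_measurable lborel"
    by (auto intro: borel_measurable_continuous_onI)
  have 1: "primitive_on J Y Y1"
  proof (rule primitive_on_cong_AE[OF primitive_on_subset[OF Y(1)] J(1) l2_rep_measurable m(2)])
    show "AE x in lborel. x \<in> J \<longrightarrow> l2_rep y1 x = Y1 x"
      using Y1(2) J(2) by eventually_elim auto
  qed simp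
  have 2: "primitive_on J Y1 (\<lambda>x. (of_real (V x) - z) * Y x)"
  proof (rule primitive_on_cong_AE[OF primitive_on_subset[OF Y1(1)] J(1) l2_rep_measurable m2])
    show "AE x in lborel. x \<in> J \<longrightarrow> l2_rep y2 x = (of_real (V x) - z) * Y x"
      using eq Y(2) J(2) by eventually_elim auto
  qed simp
  have Jm: "J \<in> sets lborel"
    using real_interval_borel_measurable[OF J(1)] by simp
  have i: "integrable lborel (\<lambda>x. l2_rep y x * l2_rep y1 x)"
    by (rule l2_Cauchy_Schwarz(1)[OF square_integrable_l2_rep square_integrable_l2_rep])
  have "set_integrable lborel J (\<lambda>x. l2_rep y x * l2_rep y1 x)"
    unfolding set_integrable_def by (rule integrable_mult_indicator[OF Jm i])
  moreover have "AE x \<in> J in lborel. l2_rep y x * l2_rep y1 x = Y x * Y1 x"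
    using Y(2) Y1(2) J(2) by eventually_elim auto
  ultimately have 3: "set_integrable lborel J (\<lambda>x. Y x * Y1 x)"
    using set_integrable_cong_AE[of "\<lambda>x. l2_rep y x * l2_rep y1 x" lborel "\<lambda>x. Y x * Y1 x" J] Jm m
      l2_rep_measurable[of y] l2_rep_measurable[of y1] by auto
  show ?thesis using that[OF c Y(2) Y1(2) 1 2 3] .
qed

lemma AE_closed_half_line_open: "(AE x in lborel. x \<in> {0::real..} \<longrightarrow> x \<in> {0<..})" "(AE x in lborel. x \<in> {..0::real} \<longrightarrow> x \<in> {..<0})"
  using AE_lborel_singleton[of "0::real"] by (eventually_elim, force)+

lemma l2_eq_zero_halves:
  assumes "AE x in lborel. x > 0 \<longrightarrow> l2_rep u x = 0" "AE x in lborel. x < 0 \<longrightarrow> l2_rep u x = 0"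
  shows "u = 0"
  unfolding l2_eq_iff
  using assms l2_rep_zero AE_lborel_singleton[of "0::real"] by eventually_elim (metis linorder_neqE_linordered_idom)

text \<open>On the whole line the flux at the origin is bounded from both sides by zero.\<close>

lemma H_eps_kernel:
  assumes \<rho>: "\<rho> \<in> C0_infty UNIV" "(LBINT x. \<rho> x) = 1" and \<Psi>: "continuous_on UNIV \<Psi>" and "\<epsilon> > 0"
    and z: "Im z \<noteq> 0" and u: "(y, z *\<^sub>C y) \<in> H_eps \<epsilon> \<alpha> \<Psi>"
  shows "y = 0"
proof -
  obtain y1 y2 where y: "(y, y1, y2) \<in> sobolev_2_2 UNIV"
    and ae: "AE x in lborel. l2_rep (z *\<^sub>C y) x = - l2_rep y2 x + (\<alpha> / \<epsilon>\<^sup>2 * \<Psi> (x / \<epsilon>)) *\<^sub>R l2_rep y x"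
    using u by (auto simp: H_eps_def)
  define V where "V x = \<alpha> / \<epsilon>\<^sup>2 * \<Psi> (x / \<epsilon>)" for x
  have V: "continuous_on UNIV V" unfolding V_def[abs_def]
    by (intro continuous_intros continuous_on_compose2[OF \<Psi>]) (use \<open>\<epsilon> > 0\<close> in auto)
  have w: "weak_derivative UNIV y y1" "weak_derivative UNIV y1 y2" using y by (auto simp: sobolev_2_2_def)
  have eq: "AE x in lborel. x \<in> UNIV \<longrightarrow> l2_rep y2 x = (of_real (V x) - z) * l2_rep y x"
    using ae l2_rep_scaleC[of z y] by eventually_elim (simp add: V_def scaleR_conv_of_real algebra_simps)
  obtain Y Y1 where Y: "AE x in lborel. x \<in> UNIV \<longrightarrow> l2_rep y x = Y x"
    "primitive_on UNIV Y Y1" "primitive_on UNIV Y1 (\<lambda>x. (of_real (V x) - z) * Y x)"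
    "set_integrable lborel UNIV (\<lambda>x. Y x * Y1 x)"
    by (rule weak_solution_representative[OF \<rho> w _ _ _ _ _ _ V eq, of UNIV]) auto
  have P: "primitive_on J Y Y1" "primitive_on J Y1 (\<lambda>x. (of_real (V x) - z) * Y x)" for J
    using Y(2,3) primitive_on_subset by blast+
  have i: "set_integrable lborel {0..} (\<lambda>x. Y x * Y1 x)" "set_integrable lborel {..0} (\<lambda>x. Y x * Y1 x)"
    by (rule set_integrable_subset[OF Y(4)]; simp)+
  have 0: "Im z * Im (cnj (Y 0) * Y1 0) = 0"
    using flux_right(1)[OF P i(1) z] flux_left(1)[OF P i(2) z] by linarith
  have "Y x = 0" for x
    using flux_right(2)[OF P i(1) z 0, of x] flux_left(2)[OF P i(2) z 0, of x] by linarith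
  then show "y = 0"
    unfolding l2_eq_iff using Y(1) l2_rep_zero by (auto elim: eventually_elim2)
qed

lemma S_op_kernel:
  assumes \<rho>: "\<rho> \<in> C0_infty UNIV" "(LBINT x. \<rho> x) = 1" and z: "Im z \<noteq> 0"
    and u: "(y, z *\<^sub>C y) \<in> S_op \<theta>"
  shows "y = 0"
proof -
  obtain y1 y2 a b c d where y: "(y, y1, y2) \<in> sobolev_2_2 (- {0})" and f: "z *\<^sub>C y = - y2"
    and lim: "has_limit_value y (at_left 0) a" "has_limit_value y (at_right 0) b" "b = of_real \<theta> * a"
      "has_limit_value y1 (at_left 0) c" "has_limit_value y1 (at_right 0) d" "of_real \<theta> * d = c"
    using u unfolding S_op_def by blast
  have w: "weak_derivative (- {0}) y y1" "weak_derivative (- {0}) y1 y2" using y by (auto simp: sobolev_2_2_def)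
  have "AE x in lborel. l2_rep y2 x = - z * l2_rep y x"
    using l2_rep_scaleC[of z y] l2_rep_uminus[of "z *\<^sub>C y"] unfolding f minus_minus by eventually_elim simp
  then have eq: "AE x in lborel. x \<in> I \<longrightarrow> l2_rep y2 x = (of_real 0 - z) * l2_rep y x" for I
    by eventually_elim simp
  have c0: "continuous_on UNIV (\<lambda>x::real. 0::real)" by simp
  obtain Yp Yp1 where p: "continuous_on UNIV Yp" "continuous_on UNIV Yp1"
    "AE x in lborel. x \<in> {0<..} \<longrightarrow> l2_rep y x = Yp x" "AE x in lborel. x \<in> {0<..} \<longrightarrow> l2_rep y1 x = Yp1 x"
    "primitive_on {0..} Yp Yp1" "primitive_on {0..} Yp1 (\<lambda>x. (of_real 0 - z) * Yp x)"
    "set_integrable lborel {0..} (\<lambda>x. Yp x * Yp1 x)"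
    by (rule weak_solution_representative[OF \<rho> w is_interval_oi open_greaterThan _ _ is_interval_ci AE_closed_half_line_open(1) c0 eq]) auto
  obtain Ym Ym1 where m: "continuous_on UNIV Ym" "continuous_on UNIV Ym1"
    "AE x in lborel. x \<in> {..<0} \<longrightarrow> l2_rep y x = Ym x" "AE x in lborel. x \<in> {..<0} \<longrightarrow> l2_rep y1 x = Ym1 x"
    "primitive_on {..0} Ym Ym1" "primitive_on {..0} Ym1 (\<lambda>x. (of_real 0 - z) * Ym x)"
    "set_integrable lborel {..0} (\<lambda>x. Ym x * Ym1 x)"
    by (rule weak_solution_representative[OF \<rho> w is_interval_io open_lessThan _ _ is_interval_ic AE_closed_half_line_open(2) c0 eq]) auto
  have v: "Yp 0 = b" "Yp1 0 = d" "Ym 0 = a" "Ym1 0 = c"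
    using has_limit_value_right[OF lim(2) p(1)] has_limit_value_right[OF lim(5) p(2)]
      has_limit_value_left[OF lim(1) m(1)] has_limit_value_left[OF lim(4) m(2)] p(3,4) m(3,4) by auto
  \<comment> \<open>The flux passes the interface unchanged because \<open>\<theta>\<close> is real.\<close>
  have "cnj b * d = cnj a * c" using lim(3,6) by (simp add: algebra_simps)
  then have 0: "Im z * Im (cnj (Yp 0) * Yp1 0) = 0" "Im z * Im (cnj (Ym 0) * Ym1 0) = 0"
    using flux_right(1)[OF p(5,6,7) z] flux_left(1)[OF m(5,6,7) z] unfolding v by auto
  show "y = 0"
  proof (rule l2_eq_zero_halves)
    show "AE x in lborel. 0 < x \<longrightarrow> l2_rep y x = 0"
      using p(3) by eventually_elim (use flux_right(2)[OF p(5,6,7) z 0(1)] in auto)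
    show "AE x in lborel. x < 0 \<longrightarrow> l2_rep y x = 0"
      using m(3) by eventually_elim (use flux_left(2)[OF m(5,6,7) z 0(2)] in auto)
  qed
qed

text \<open>Each component of the direct sum solves the equation on its own half-line, since the other component
  and its second derivative vanish there; the Dirichlet condition annihilates the flux.\<close>

lemma Dirichlet_kernel:
  assumes \<rho>: "\<rho> \<in> C0_infty UNIV" "(LBINT x. \<rho> x) = 1" and z: "Im z \<noteq> 0"
    and u: "(y, z *\<^sub>C y) \<in> S_minus \<oplus>\<^sub>o\<^sub>p S_plus"
  shows "y = 0"
proof -
  obtain u v f g where yuv: "y = u + v" "z *\<^sub>C y = f + g" "(u, f) \<in> S_minus" "(v, g) \<in> S_plus"
    using u unfolding direct_sum_def by blast
  obtain u1 u2 where u: "f = - u2" "(u, u1, u2) \<in> sobolev_2_2 {..<0}" "has_limit_value u (at_left 0) 0"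
    using yuv(3) unfolding S_minus_def by blast
  obtain v1 v2 where v: "g = - v2" "(v, v1, v2) \<in> sobolev_2_2 {0<..}" "has_limit_value v (at_right 0) 0"
    using yuv(4) unfolding S_plus_def by blast
  have on: "AE x in lborel. x \<notin> {..<0} \<longrightarrow> l2_rep u x = 0" "AE x in lborel. x \<notin> {..<0} \<longrightarrow> l2_rep u2 x = 0"
    "AE x in lborel. x \<notin> {0<..} \<longrightarrow> l2_rep v x = 0" "AE x in lborel. x \<notin> {0<..} \<longrightarrow> l2_rep v2 x = 0"
    using u(2) v(2) by (auto simp: sobolev_2_2_def l2_on_def)
  have w: "weak_derivative {..<0} u u1" "weak_derivative {..<0} u1 u2"
    "weak_derivative {0<..} v v1" "weak_derivative {0<..} v1 v2"
    using u(2) v(2) by (auto simp: sobolev_2_2_def)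
  have "z *\<^sub>C u + z *\<^sub>C v = - u2 + - v2"
    using yuv(1,2) u(1) v(1) by (simp add: scaleC_add_right)
  then have "AE x in lborel. l2_rep (z *\<^sub>C u + z *\<^sub>C v) x = l2_rep (- u2 + - v2) x" by simp
  then have e: "AE x in lborel. z * l2_rep u x + z * l2_rep v x = - l2_rep u2 x - l2_rep v2 x"
    using l2_rep_add[of "z *\<^sub>C u" "z *\<^sub>C v"] l2_rep_add[of "- u2" "- v2"] l2_rep_scaleC[of z u] l2_rep_scaleC[of z v]
      l2_rep_uminus[of u2] l2_rep_uminus[of v2] by eventually_elim simp
  have eu: "AE x in lborel. x \<in> {..<0} \<longrightarrow> l2_rep u2 x = (of_real 0 - z) * l2_rep u x"
    using e on(3,4) by eventually_elim (auto simp: eq_neg_iff_add_eq_0 algebra_simps)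
  have ev: "AE x in lborel. x \<in> {0<..} \<longrightarrow> l2_rep v2 x = (of_real 0 - z) * l2_rep v x"
    using e on(1,2) by eventually_elim (auto simp: eq_neg_iff_add_eq_0 algebra_simps)
  have c0: "continuous_on UNIV (\<lambda>x::real. 0::real)" by simp
  obtain Yp Yp1 where p: "continuous_on UNIV Yp"
    "AE x in lborel. x \<in> {0<..} \<longrightarrow> l2_rep v x = Yp x"
    "primitive_on {0..} Yp Yp1" "primitive_on {0..} Yp1 (\<lambda>x. (of_real 0 - z) * Yp x)"
    "set_integrable lborel {0..} (\<lambda>x. Yp x * Yp1 x)"
    by (rule weak_solution_representative[OF \<rho> w(3,4) is_interval_oi open_greaterThan _ _ is_interval_ci AE_closed_half_line_open(1) c0 ev]) auto
  obtain Ym Ym1 where m: "continuous_on UNIV Ym"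
    "AE x in lborel. x \<in> {..<0} \<longrightarrow> l2_rep u x = Ym x"
    "primitive_on {..0} Ym Ym1" "primitive_on {..0} Ym1 (\<lambda>x. (of_real 0 - z) * Ym x)"
    "set_integrable lborel {..0} (\<lambda>x. Ym x * Ym1 x)"
    by (rule weak_solution_representative[OF \<rho> w(1,2) is_interval_io open_lessThan _ _ is_interval_ic AE_closed_half_line_open(2) c0 eu]) auto
  have "Yp 0 = 0" "Ym 0 = 0"
    using has_limit_value_right[OF v(3) p(1)] has_limit_value_left[OF u(3) m(1)] p(2) m(2) by auto
  then have 0: "Im z * Im (cnj (Yp 0) * Yp1 0) = 0" "Im z * Im (cnj (Ym 0) * Ym1 0) = 0" by auto
  have "AE x in lborel. 0 < x \<longrightarrow> l2_rep v x = 0"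
    using p(2) by eventually_elim (use flux_right(2)[OF p(3,4,5) z 0(1)] in auto)
  moreover have "AE x in lborel. x < 0 \<longrightarrow> l2_rep v x = 0"
    using on(3) by eventually_elim auto
  ultimately have v0: "v = 0" by (rule l2_eq_zero_halves)
  have "AE x in lborel. x < 0 \<longrightarrow> l2_rep u x = 0"
    using m(2) by eventually_elim (use flux_left(2)[OF m(3,4,5) z 0(2)] in auto)
  moreover have "AE x in lborel. 0 < x \<longrightarrow> l2_rep u x = 0"
    using on(1) by eventually_elim auto
  ultimately have "u = 0" by (intro l2_eq_zero_halves)
  with v0 show "y = 0" using yuv(1) by simp
qed

section \<open>Linear second order equations on the unit interval\<close>

text \<open>The weight \<open>exp (- L * (t - a))\<close> with \<open>L > 2 * K\<close> makes the integral operator a contraction on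
  the whole interval at once.\<close>

lemma picard_lindelof:
  fixes F :: "real \<Rightarrow> 'a::banach \<Rightarrow> 'a"
  assumes "a \<le> b" and cont: "continuous_on ({a..b} \<times> UNIV) (\<lambda>(t, x). F t x)"
    and lip: "\<And>t x y. t \<in> {a..b} \<Longrightarrow> norm (F t x - F t y) \<le> K * norm (x - y)" and "K \<ge> 0"
  shows "\<exists>X. X a = x0 \<and> (\<forall>t\<in>{a..b}. (X has_vector_derivative F t (X t)) (at t within {a..b}))"
proof -
  define L where "L = 2 * K + 1"
  have L: "L > 0" "K / L \<le> 1 / 2" using \<open>K \<ge> 0\<close> by (auto simp: L_def field_simps)
  define cl where "cl t = max a (min b t)" for t
  have cl: "cl t \<in> {a..b}" "t \<in> {a..b} \<Longrightarrow> cl t = t" for t using \<open>a \<le> b\<close> by (auto simp: cl_def)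
  define G where "G v \<tau> = F \<tau> (exp (L * (\<tau> - a)) *\<^sub>R v \<tau>)" for v :: "real \<Rightarrow> 'a" and \<tau>
  have G: "continuous_on {a..b} (G v)" if "continuous_on {a..b} v" for v
  proof -
    have "continuous_on {a..b} (\<lambda>\<tau>. (\<lambda>(t, x). F t x) (\<tau>, exp (L * (\<tau> - a)) *\<^sub>R v \<tau>))"
      by (rule continuous_on_compose2[OF cont]) (auto intro!: continuous_intros that)
    then show ?thesis by (simp add: G_def[abs_def])
  qed
  define Q where "Q v t = exp (- L * (t - a)) *\<^sub>R (x0 + integral {a..t} (G v))" for v t
  have Q: "continuous_on {a..b} (Q v)" if "continuous_on {a..b} v" for v
    unfolding Q_def[abs_def]
    by (intro continuous_intros indefinite_integral_continuous_1 integrable_continuous_interval G that)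
  have Qcl: "(\<lambda>s. Q v (cl s)) \<in> bcontfun" if "continuous_on {a..b} v" for v
    unfolding bcontfun_def
  proof (intro CollectI conjI)
    show "continuous_on UNIV (\<lambda>s. Q v (cl s))"
      by (rule continuous_on_compose2[OF Q[OF that]]) (auto simp: cl_def[abs_def] \<open>a \<le> b\<close> intro!: continuous_intros)
    have "bounded (Q v ` {a..b})"
      by (intro compact_imp_bounded compact_continuous_image Q that compact_Icc)
    then show "bounded (range (\<lambda>s. Q v (cl s)))"
      by (rule bounded_subset) (use cl in auto)
  qed
  define P where "P v = Bcontfun (\<lambda>s. Q (apply_bcontfun v) (cl s))" for v
  have P: "apply_bcontfun (P v) s = Q (apply_bcontfun v) (cl s)" for v s
    unfolding P_def by (subst Bcontfun_inverse[OF Qcl]) auto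
  have "dist (P v) (P w) \<le> 1 / 2 * dist v w" for v w
  proof (rule dist_bound)
    fix s
    define t where "t = cl s"
    have t: "t \<in> {a..b}" using cl by (simp add: t_def)
    have sub: "{a..t} \<subseteq> {a..b}" using t by auto
    have int: "G (apply_bcontfun u) integrable_on {a..t}" for u
      by (intro integrable_continuous_interval continuous_on_subset[OF G sub]) simp
    have e: "((\<lambda>\<tau>. (K * dist v w) * exp (L * (\<tau> - a))) has_integral
        (K * dist v w) * exp (L * (t - a)) / L - (K * dist v w) * exp (L * (a - a)) / L) {a..t}"
      using t L by (intro fundamental_theorem_of_calculus)
        (auto intro!: derivative_eq_intros simp: has_real_derivative_iff_has_vector_derivative[symmetric])
    have "norm (integral {a..t} (\<lambda>\<tau>. G (apply_bcontfun v) \<tau> - G (apply_bcontfun w) \<tau>)) \<le>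
        integral {a..t} (\<lambda>\<tau>. (K * dist v w) * exp (L * (\<tau> - a)))"
    proof (rule integral_norm_bound_integral)
      fix \<tau> assume "\<tau> \<in> {a..t}"
      then have "norm (G (apply_bcontfun v) \<tau> - G (apply_bcontfun w) \<tau>) \<le>
          K * norm (exp (L * (\<tau> - a)) *\<^sub>R v \<tau> - exp (L * (\<tau> - a)) *\<^sub>R w \<tau>)"
        unfolding G_def using sub by (intro lip) auto
      also have "\<dots> = K * (exp (L * (\<tau> - a)) * dist (v \<tau>) (w \<tau>))"
        by (simp add: dist_norm flip: scaleR_diff_right)
      also have "\<dots> \<le> K * (exp (L * (\<tau> - a)) * dist v w)"
        using \<open>K \<ge> 0\<close> dist_bounded[of v \<tau> w] by (intro mult_left_mono) auto
      finally show "norm (G (apply_bcontfun v) \<tau> - G (apply_bcontfun w) \<tau>) \<le> (K * dist v w) * exp (L * (\<tau> - a))"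
        by (simp add: mult_ac)
    qed (use int e in \<open>auto intro!: Henstock_Kurzweil_Integration.integrable_diff\<close>)
    also have "\<dots> = (K * dist v w) * exp (L * (t - a)) / L - (K * dist v w) / L"
      using integral_unique[OF e] by simp
    also have "\<dots> \<le> (K * dist v w) * exp (L * (t - a)) / L"
      using \<open>K \<ge> 0\<close> L by simp
    also have "\<dots> = (K / L) * dist v w * exp (L * (t - a))" by simp
    also have "\<dots> \<le> (1 / 2) * dist v w * exp (L * (t - a))"
      using L(2) by (intro mult_right_mono) auto
    finally have b: "norm (integral {a..t} (\<lambda>\<tau>. G (apply_bcontfun v) \<tau> - G (apply_bcontfun w) \<tau>)) \<le>
      (1 / 2) * dist v w * exp (L * (t - a))" .
    have "dist (Q (apply_bcontfun v) t) (Q (apply_bcontfun w) t) =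
        exp (- L * (t - a)) * norm (integral {a..t} (\<lambda>\<tau>. G (apply_bcontfun v) \<tau> - G (apply_bcontfun w) \<tau>))"
      unfolding Q_def dist_norm using int
      by (simp add: Henstock_Kurzweil_Integration.integral_diff flip: scaleR_diff_right)
    also have "\<dots> \<le> exp (- L * (t - a)) * ((1 / 2) * dist v w * exp (L * (t - a)))"
      by (intro mult_left_mono b) auto
    also have "\<dots> = (exp (- L * (t - a)) * exp (L * (t - a))) * (1 / 2 * dist v w)" by simp
    also have "\<dots> = 1 / 2 * dist v w"
      unfolding mult_exp_exp by simp
    finally show "dist (apply_bcontfun (P v) s) (apply_bcontfun (P w) s) \<le> 1 / 2 * dist v w"
      by (simp add: P t_def)
  qed
  then have "\<exists>!v. P v = v"
    by (intro banach_fix_type[of "1 / 2"]) auto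
  then obtain v where v: "P v = v" by blast
  have vt: "v t = Q (apply_bcontfun v) t" if "t \<in> {a..b}" for t
    using P[of v t] v cl(2)[OF that] by simp
  define X where "X t = x0 + integral {a..t} (G (apply_bcontfun v))" for t
  have X: "X t = exp (L * (t - a)) *\<^sub>R v t" if "t \<in> {a..b}" for t
    using vt[OF that] by (simp add: Q_def X_def exp_minus)
  have "(X has_vector_derivative F t (X t)) (at t within {a..b})" if "t \<in> {a..b}" for t
  proof -
    have "((\<lambda>u. integral {a..u} (G (apply_bcontfun v))) has_vector_derivative G (apply_bcontfun v) t) (at t within {a..b})"
      by (intro integral_has_vector_derivative G that) simp
    then have "(X has_vector_derivative G (apply_bcontfun v) t) (at t within {a..b})"
      unfolding X_def[abs_def] by (auto intro!: derivative_eq_intros)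
    then show ?thesis using X[OF that] by (simp add: G_def)
  qed
  moreover have "X a = x0" by (simp add: X_def)
  ultimately show ?thesis by blast
qed

text \<open>The equation \<open>w'' = Q * w + r\<close> as a pair. The derivatives are one-sided at the end points, so that
  Cauchy data there make sense.\<close>

definition solves :: "(real \<Rightarrow> complex) \<Rightarrow> (real \<Rightarrow> complex) \<Rightarrow> (real \<Rightarrow> complex) \<Rightarrow> (real \<Rightarrow> complex) \<Rightarrow> bool" where
  "solves Q r w w1 \<longleftrightarrow>
     (\<forall>x\<in>{-1..1}. (w has_vector_derivative w1 x) (at x within {-1..1}) \<and>
                   (w1 has_vector_derivative Q x * w x + r x) (at x within {-1..1}))"

lemma solves_continuous:
  assumes "solves Q r w w1"
  shows "continuous_on {-1..1} w" "continuous_on {-1..1} w1"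
  using assms unfolding solves_def continuous_on_eq_continuous_within
  by (auto intro: has_vector_derivative_continuous)

lemma solves_reflect:
  assumes "solves Q r w w1"
  shows "solves (\<lambda>x. Q (- x)) (\<lambda>x. r (- x)) (\<lambda>x. w (- x)) (\<lambda>x. - w1 (- x))"
  unfolding solves_def
proof (intro ballI conjI)
  fix x :: real assume x: "x \<in> {-1..1}"
  have u: "(uminus has_vector_derivative (-1)) (at x within {-1..1::real})"
    by (auto intro!: derivative_eq_intros)
  have im: "uminus ` {-1..1::real} = {-1..1}" by simp
  have *: "((\<lambda>x. f (- x)) has_vector_derivative - f' (- x)) (at x within {-1..1})"
    if "(f has_vector_derivative f' (- x)) (at (- x) within {-1..1})" for f f' :: "real \<Rightarrow> complex"
    using vector_diff_chain_within[OF u, of f "f' (- x)"] that unfolding im by (simp add: o_def)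
  have mx: "- x \<in> {-1..1}" using x by auto
  show "((\<lambda>x. w (- x)) has_vector_derivative - w1 (- x)) (at x within {-1..1})"
    using * assms mx unfolding solves_def by blast
  have "((\<lambda>x. w1 (- x)) has_vector_derivative - (Q (- x) * w (- x) + r (- x))) (at x within {-1..1})"
    using *[of w1 "\<lambda>x. Q x * w x + r x"] assms mx unfolding solves_def by blast
  from has_vector_derivative_minus[OF this]
  show "((\<lambda>x. - w1 (- x)) has_vector_derivative Q (- x) * w (- x) + r (- x)) (at x within {-1..1})"
    by (simp add: add.commute)
qed

text \<open>A perturbation of the coefficient acts like a source term.\<close>

lemma solves_diff:
  assumes "solves Q r w w1" "solves P (\<lambda>x. 0) v v1"
  shows "solves Q (\<lambda>x. (Q x - P x) * v x + r x) (\<lambda>x. w x - v x) (\<lambda>x. w1 x - v1 x)"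
  using assms unfolding solves_def
  by (auto intro!: derivative_eq_intros simp: algebra_simps)

lemma solves_exists_initial:
  assumes Q: "continuous_on {-1..1} Q" and r: "continuous_on {-1..1} r"
  shows "\<exists>w w1. solves Q r w w1 \<and> w (-1) = a \<and> w1 (-1) = b"
proof -
  define F where "F t X = (snd X, Q t * fst X + r t)" for t and X :: "complex \<times> complex"
  obtain M where M: "\<And>t. t \<in> {-1..1} \<Longrightarrow> norm (Q t) \<le> M"
    using compact_imp_bounded[OF compact_continuous_image[OF Q compact_Icc]] unfolding bounded_iff by blast
  have M0: "M \<ge> 0" using order_trans[OF norm_ge_zero M[of 0]] by simp
  have "\<exists>X. X (-1) = (a, b) \<and> (\<forall>t\<in>{-1..1}. (X has_vector_derivative F t (X t)) (at t within {-1..1}))"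
  proof (rule picard_lindelof[where K="1 + M"])
    have 1: "continuous_on ({-1..1} \<times> UNIV) (\<lambda>p. Q (fst p))" "continuous_on ({-1..1} \<times> UNIV) (\<lambda>p. r (fst p))"
      by (rule continuous_on_compose2[OF Q] continuous_on_compose2[OF r]; auto intro!: continuous_intros)+
    show "continuous_on ({- 1..1} \<times> UNIV) (\<lambda>(t, x). F t x)"
      unfolding F_def case_prod_beta' by (intro continuous_intros 1)
    fix t x y assume t: "t \<in> {-1..1::real}"
    have "norm (F t x - F t y) = norm (snd (x - y), Q t * fst (x - y))"
      by (simp add: F_def algebra_simps)
    also have "\<dots> \<le> norm (snd (x - y)) + norm (Q t * fst (x - y))"
      by (rule norm_Pair_le)
    also have "\<dots> \<le> norm (x - y) + M * norm (x - y)"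
    proof (rule add_mono)
      show "norm (snd (x - y)) \<le> norm (x - y)" by (metis norm_snd_le prod.collapse)
      have "norm (fst (x - y)) \<le> norm (x - y)" by (metis norm_fst_le prod.collapse)
      then show "norm (Q t * fst (x - y)) \<le> M * norm (x - y)"
        unfolding norm_mult using M[OF t] M0 by (intro mult_mono) auto
    qed
    finally show "norm (F t x - F t y) \<le> (1 + M) * norm (x - y)" by (simp add: algebra_simps)
  qed (use M0 in auto)
  then obtain X where X: "X (-1) = (a, b)"
    "\<And>t. t \<in> {-1..1} \<Longrightarrow> (X has_vector_derivative F t (X t)) (at t within {-1..1})" by blast
  have "solves Q r (\<lambda>t. fst (X t)) (\<lambda>t. snd (X t))"
    unfolding solves_def
  proof (intro ballI conjI)
    fix t assume t: "t \<in> {-1..1::real}"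
    show "((\<lambda>t. fst (X t)) has_vector_derivative snd (X t)) (at t within {-1..1})"
      using bounded_linear.has_vector_derivative[OF bounded_linear_fst X(2)[OF t]] by (simp add: F_def)
    show "((\<lambda>t. snd (X t)) has_vector_derivative Q t * fst (X t) + r t) (at t within {-1..1})"
      using bounded_linear.has_vector_derivative[OF bounded_linear_snd X(2)[OF t]] by (simp add: F_def)
  qed
  then show ?thesis using X(1)
    by (intro exI[of _ "\<lambda>t. fst (X t)"] exI[of _ "\<lambda>t. snd (X t)"]) simp
qed

lemma solves_exists_terminal:
  assumes Q: "continuous_on {-1..1} Q" and r: "continuous_on {-1..1} r"
  shows "\<exists>w w1. solves Q r w w1 \<and> w 1 = a \<and> w1 1 = b"
proof -
  have c: "continuous_on {-1..1} (\<lambda>x. Q (- x))" "continuous_on {-1..1} (\<lambda>x. r (- x))"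
    by (rule continuous_on_compose2[OF Q] continuous_on_compose2[OF r]; auto intro!: continuous_intros)+
  obtain w w1 where w: "solves (\<lambda>x. Q (- x)) (\<lambda>x. r (- x)) w w1" "w (-1) = a" "w1 (-1) = - b"
    using solves_exists_initial[OF c] by blast
  from solves_reflect[OF w(1)] show ?thesis using w(2,3)
    by (intro exI[of _ "\<lambda>x. w (- x)"] exI[of _ "\<lambda>x. - w1 (- x)"]) simp
qed

text \<open>The energy \<open>N = norm w ^ 2 + norm w1 ^ 2\<close> satisfies \<open>N' \<le> (2 + M) * N + R ^ 2\<close>; this is Gronwall's
  inequality for it, in the form that \<open>exp (- (2 + M) * (x + 1)) * N x - R ^ 2 * (x + 1)\<close> is
  nonincreasing.\<close>

lemma solves_bound_initial:
  assumes s: "solves Q r w w1" and M: "\<And>x. x \<in> {-1..1} \<Longrightarrow> norm (Q x) \<le> M"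
    and R: "\<And>x. x \<in> {-1..1} \<Longrightarrow> norm (r x) \<le> R" and x: "x \<in> {-1..1}"
  shows "(norm (w x))\<^sup>2 + (norm (w1 x))\<^sup>2 \<le>
    exp (2 * (2 + M)) * ((norm (w (-1)))\<^sup>2 + (norm (w1 (-1)))\<^sup>2 + 2 * R\<^sup>2)"
proof -
  define N where "N x = w x \<bullet> w x + w1 x \<bullet> w1 x" for x
  have N: "N x = (norm (w x))\<^sup>2 + (norm (w1 x))\<^sup>2" for x by (simp add: N_def power2_norm_eq_inner)
  have M0: "M \<ge> 0" using order_trans[OF norm_ge_zero M[of 0]] by simp
  have R0: "R \<ge> 0" using order_trans[OF norm_ge_zero R[of 0]] by simp
  define L where "L = 2 + M"
  define E where "E x = exp (- L * (x + 1)) * N x - R\<^sup>2 * (x + 1)" for x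
  have cE: "continuous_on {-1..x} E" unfolding E_def[abs_def] N_def
    using x by (intro continuous_intros continuous_on_subset[OF solves_continuous(1)[OF s]]
       continuous_on_subset[OF solves_continuous(2)[OF s]]) auto
  have "E x \<le> E (-1)"
  proof (rule DERIV_nonpos_imp_decreasing_open[OF _ _ cE])
    fix y assume y: "-1 < y" "y < x"
    have y1: "y \<in> {-1..1}" using y x by simp
    have y2: "at y within {-1..1} = at y"
      using y x by (intro at_within_Icc_at) simp_all
    have d: "(w has_vector_derivative w1 y) (at y)" "(w1 has_vector_derivative Q y * w y + r y) (at y)"
      using bspec[OF s[unfolded solves_def] y1] unfolding y2 by blast+
    define N' where "N' = 2 * (w y \<bullet> w1 y) + 2 * (w1 y \<bullet> (Q y * w y + r y))"
    have dN: "(N has_real_derivative N') (at y)"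
      unfolding has_real_derivative_iff_has_vector_derivative N_def[abs_def] N'_def
      by (rule has_vector_derivative_eq_rhs[OF has_vector_derivative_add[OF
            bounded_bilinear.has_vector_derivative[OF bounded_bilinear_inner d(1) d(1)]
            bounded_bilinear.has_vector_derivative[OF bounded_bilinear_inner d(2) d(2)]]])
         (simp add: inner_commute)
    have dE: "(E has_real_derivative exp (- L * (y + 1)) * (N' - L * N y) - R\<^sup>2) (at y)"
      unfolding E_def[abs_def] by (auto intro!: derivative_eq_intros dN simp: algebra_simps)
    have "N' \<le> 2 * (norm (w y) * norm (w1 y)) + 2 * (norm (w1 y) * (M * norm (w y) + R))"
    proof -
      have "w y \<bullet> w1 y \<le> norm (w y) * norm (w1 y)" by (rule norm_cauchy_schwarz)
      moreover have "w1 y \<bullet> (Q y * w y + r y) \<le> norm (w1 y) * (M * norm (w y) + R)"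
      proof -
        have "norm (Q y * w y + r y) \<le> norm (Q y) * norm (w y) + norm (r y)"
          by (metis norm_mult norm_triangle_ineq)
        also have "\<dots> \<le> M * norm (w y) + R"
          using M[OF y1] R[OF y1] by (intro add_mono mult_right_mono) auto
        finally show ?thesis
          by (intro order_trans[OF norm_cauchy_schwarz] mult_left_mono) auto
      qed
      ultimately show ?thesis by (simp add: N'_def)
    qed
    also have "\<dots> = (1 + M) * (2 * norm (w y) * norm (w1 y)) + 2 * R * norm (w1 y)"
      by (simp add: algebra_simps)
    also have "\<dots> \<le> (1 + M) * N y + (R\<^sup>2 + N y)"
    proof (rule add_mono)
      show "(1 + M) * (2 * norm (w y) * norm (w1 y)) \<le> (1 + M) * N y"
        using M0 sum_squares_bound[of "norm (w y)" "norm (w1 y)"] by (intro mult_left_mono) (auto simp: N)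
      have "2 * R * norm (w1 y) \<le> R\<^sup>2 + (norm (w1 y))\<^sup>2" by (rule sum_squares_bound)
      also have "\<dots> \<le> R\<^sup>2 + N y" by (simp add: N)
      finally show "2 * R * norm (w1 y) \<le> R\<^sup>2 + N y" .
    qed
    finally have "N' - L * N y \<le> R\<^sup>2" by (simp add: L_def algebra_simps)
    then have "exp (- L * (y + 1)) * (N' - L * N y) \<le> exp (- L * (y + 1)) * R\<^sup>2"
      by (intro mult_left_mono) auto
    also have "\<dots> \<le> 1 * R\<^sup>2"
      using y M0 by (intro mult_right_mono) (auto simp: L_def intro!: mult_nonpos_nonneg)
    finally show "\<exists>z. (E has_real_derivative z) (at y) \<and> z \<le> 0"
      using dE by (intro exI conjI) auto
  qed (use x in auto)
  then have "exp (- L * (x + 1)) * N x \<le> N (-1) + R\<^sup>2 * (x + 1)" by (simp add: E_def)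
  also have "\<dots> \<le> N (-1) + 2 * R\<^sup>2" using x by (simp add: mult_left_mono mult.commute[of 2])
  finally have "exp (L * (x + 1)) * (exp (- L * (x + 1)) * N x) \<le> exp (L * (x + 1)) * (N (-1) + 2 * R\<^sup>2)"
    by (intro mult_left_mono) auto
  also have "exp (L * (x + 1)) * (exp (- L * (x + 1)) * N x) = N x"
    by (simp add: exp_minus)
  also have "exp (L * (x + 1)) * (N (-1) + 2 * R\<^sup>2) \<le> exp (2 * (2 + M)) * (N (-1) + 2 * R\<^sup>2)"
  proof (rule mult_right_mono)
    have "L * (x + 1) \<le> L * 2" using x M0 by (intro mult_left_mono) (auto simp: L_def)
    then show "exp (L * (x + 1)) \<le> exp (2 * (2 + M))" by (simp add: L_def)
    show "0 \<le> N (-1) + 2 * R\<^sup>2" by (simp add: N)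
  qed
  finally show ?thesis by (simp add: N)
qed

lemma solves_bound_terminal:
  assumes s: "solves Q r w w1" and M: "\<And>x. x \<in> {-1..1} \<Longrightarrow> norm (Q x) \<le> M"
    and R: "\<And>x. x \<in> {-1..1} \<Longrightarrow> norm (r x) \<le> R" and x: "x \<in> {-1..1}"
  shows "(norm (w x))\<^sup>2 + (norm (w1 x))\<^sup>2 \<le>
    exp (2 * (2 + M)) * ((norm (w 1))\<^sup>2 + (norm (w1 1))\<^sup>2 + 2 * R\<^sup>2)"
  using solves_bound_initial[OF solves_reflect[OF s], of M R "- x"] M R x by auto

lemma solves_wronskian_constant:
  assumes u: "solves Q (\<lambda>x. 0) u u1" and v: "solves Q (\<lambda>x. 0) v v1" and x: "x \<in> {-1..1}"
  shows "u1 x * v x - u x * v1 x = u1 1 * v 1 - u 1 * v1 1"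
proof -
  have d: "((\<lambda>x. u1 x * v x - u x * v1 x) has_vector_derivative 0) (at x within {-1..1})" if x: "x \<in> {-1..1}" for x
  proof -
    have "(u has_vector_derivative u1 x) (at x within {-1..1})" "(u1 has_vector_derivative Q x * u x) (at x within {-1..1})"
      "(v has_vector_derivative v1 x) (at x within {-1..1})" "(v1 has_vector_derivative Q x * v x) (at x within {-1..1})"
      using u v x unfolding solves_def by auto
    then show ?thesis
      by (auto intro!: derivative_eq_intros simp: algebra_simps)
  qed
  obtain c where c: "\<And>x. x \<in> {-1..1} \<Longrightarrow> u1 x * v x - u x * v1 x = c"
    using has_vector_derivative_zero_constant[OF convex_real_interval(5)[of "-1" 1] d] by blast
  show ?thesis using c[OF x] c[of 1] by simp
qed

section \<open>The free resolvent\<close>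

text \<open>The kernel is dominated by the sum of its two one-sided versions.\<close>

lemma integrable_exp_abs:
  assumes "c > 0"
  shows "integrable lborel (\<lambda>x::real. exp (- c * \<bar>x - y\<bar>))"
proof -
  define h where "h x = exp (- c * x) * indicator {0..} x" for x :: real
  have hm: "h \<in> borel_measurable lborel" by (simp add: h_def[abs_def])
  have lim: "((\<lambda>x. - exp (- c * x) / c) \<longlongrightarrow> - 0 / c) at_top"
  proof (intro tendsto_intros)
    show "((\<lambda>x. exp (- c * x)) \<longlongrightarrow> 0) at_top"
      using assms
      by (intro filterlim_compose[OF exp_at_bot] filterlim_tendsto_neg_mult_at_bot[OF tendsto_const _ filterlim_ident]) auto
  qed (use assms in auto)
  have "(\<integral>\<^sup>+x. ennreal (exp (- c * x)) * indicator {0..} x \<partial>lborel) = ennreal (- 0 / c - - exp (- c * 0) / c)"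
    by (rule nn_integral_FTC_atLeast[OF _ _ _ lim]) (use assms in \<open>auto intro!: derivative_eq_intros\<close>)
  also have "\<dots> < \<infinity>" by simp
  finally have "(\<integral>\<^sup>+x. ennreal (h x) \<partial>lborel) < \<infinity>"
    by (simp add: h_def ennreal_mult ennreal_indicator)
  then have h: "integrable lborel h"
    by (intro integrableI_nonneg hm) (auto simp: h_def)
  have h1: "integrable lborel (\<lambda>x. h (- y + 1 * x))"
    by (rule lborel_integrable_real_affine[OF h]) simp
  have h2: "integrable lborel (\<lambda>x. h (y + (-1) * x))"
    by (rule lborel_integrable_real_affine[OF h]) simp
  show ?thesis
    by (rule Bochner_Integration.integrable_bound[OF Bochner_Integration.integrable_add[OF h1 h2]])
       (auto simp: h_def split: split_indicator)
qed

lemma integral_exp_abs_translate: "(LBINT x::real. exp (- c * \<bar>x - y\<bar>)) = (LBINT x. exp (- c * \<bar>x\<bar>))"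
  by (subst lborel_integral_real_affine[where c=1 and t="- y"]) (simp_all add: algebra_simps)

lemma integral_exp_abs_translate': "(LBINT x::real. exp (- c * \<bar>y - x\<bar>)) = (LBINT x. exp (- c * \<bar>x\<bar>))"
  using integral_exp_abs_translate[of c y] by (simp add: abs_minus_commute)

text \<open>Schur's test: by the Cauchy-Schwarz inequality with the kernel as weight, the square of \<open>E x\<close> is at most
  the mass of the kernel times the convolution of the kernel with \<open>norm (f t) ^ 2\<close>, whose integral is
  given by Fubini's theorem.\<close>

lemma exponential_convolution:
  fixes f :: "real \<Rightarrow> complex"
  assumes c: "c > 0" and f: "square_integrable f"
  defines "E \<equiv> \<lambda>x. LBINT t. exp (- c * \<bar>x - t\<bar>) * norm (f t)"
  shows "integrable lborel (\<lambda>t. exp (- c * \<bar>x - t\<bar>) * norm (f t))"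
    and "E x \<le> sqrt (LBINT x. exp (- (2 * c) * \<bar>x\<bar>)) * sqrt (LBINT t. (norm (f t))\<^sup>2)"
    and "integrable lborel (\<lambda>x. (E x)\<^sup>2)"
    and "(LBINT x. (E x)\<^sup>2) \<le> (LBINT x. exp (- c * \<bar>x\<bar>))\<^sup>2 * (LBINT t. (norm (f t))\<^sup>2)"
proof -
  have fm[measurable]: "f \<in> borel_measurable borel" and f2: "integrable lborel (\<lambda>t. (norm (f t))\<^sup>2)"
    using f by (auto simp: square_integrable_def)
  have exp2: "(exp (- c * \<bar>x - t\<bar>))\<^sup>2 = exp (- (2 * c) * \<bar>t - x\<bar>)" for c x t :: real
    by (simp add: power2_eq_square mult_exp_exp abs_minus_commute)
  have nexp: "(norm (complex_of_real (exp (- c * \<bar>x - t\<bar>))))\<^sup>2 = exp (- (2 * c) * \<bar>t - x\<bar>)" for c x t :: real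
    unfolding norm_of_real abs_exp_cancel by (rule exp2)
  have sq: "square_integrable (\<lambda>t. complex_of_real (exp (- c * \<bar>x - t\<bar>)))" if "c > 0" for c x
    unfolding square_integrable_def nexp
    using that by (intro conjI integrable_exp_abs) auto
  have e: "norm (complex_of_real (exp (- c * \<bar>x - t\<bar>)) * f t) = exp (- c * \<bar>x - t\<bar>) * norm (f t)" for x t
    by (simp add: norm_mult)
  show i: "integrable lborel (\<lambda>t. exp (- c * \<bar>x - t\<bar>) * norm (f t))" for x
    using integrable_norm[OF l2_Cauchy_Schwarz(1)[OF sq[OF c, of x] f]] unfolding e .
  have n2: "(LBINT t. (norm (complex_of_real (exp (- c * \<bar>x - t\<bar>))))\<^sup>2) = (LBINT x. exp (- (2 * c) * \<bar>x\<bar>))" for x c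
    unfolding nexp by (rule integral_exp_abs_translate)
  show "E x \<le> sqrt (LBINT x. exp (- (2 * c) * \<bar>x\<bar>)) * sqrt (LBINT t. (norm (f t))\<^sup>2)"
    using l2_Cauchy_Schwarz(2)[OF sq[OF c, of x] f] unfolding e n2 E_def .
  define c1 where "c1 = (LBINT x::real. exp (- c * \<bar>x\<bar>))"
  have inner_x: "integrable lborel (\<lambda>x. exp (- c * \<bar>x - t\<bar>))" "(LBINT x. exp (- c * \<bar>x - t\<bar>)) = c1" for t
    using integrable_exp_abs[OF c, of t] integral_exp_abs_translate[of c t] by (auto simp: c1_def)
  have c10: "c1 \<ge> 0" unfolding c1_def by simp
  let ?K = "\<lambda>t x. exp (- c * \<bar>x - t\<bar>) * (norm (f t))\<^sup>2"
  have K: "integrable (lborel \<Otimes>\<^sub>M lborel) (\<lambda>(t, x). ?K t x)"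
  proof (rule lborel_pair.Fubini_integrable)
    show "(\<lambda>(t, x). ?K t x) \<in> borel_measurable (lborel \<Otimes>\<^sub>M lborel)" by measurable
    show "integrable lborel (\<lambda>t. LBINT x. norm (case (t, x) of (t, x) \<Rightarrow> ?K t x))"
      using f2 by (simp add: abs_mult inner_x[simplified])
    show "AE t in lborel. integrable lborel (\<lambda>x. case (t, x) of (t, x) \<Rightarrow> ?K t x)"
      using inner_x(1) by simp
  qed
  define D where "D x = (LBINT t. ?K t x)" for x
  have Di: "integrable lborel D"
    unfolding D_def[abs_def] using lborel_pair.integrable_snd[OF K] by simp
  have Dint: "(LBINT x. D x) = c1 * (LBINT t. (norm (f t))\<^sup>2)"
  proof -
    have "(LBINT x. D x) = (LBINT t. (LBINT x. ?K t x))"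
      unfolding D_def using lborel_pair.Fubini_integral[OF K] by simp
    also have "\<dots> = (LBINT t. c1 * (norm (f t))\<^sup>2)"
      using inner_x(2) by simp
    finally show ?thesis by simp
  qed
  have Em[measurable]: "E \<in> borel_measurable lborel"
    unfolding E_def by (intro lborel.borel_measurable_lebesgue_integral) measurable
  have ED: "(E x)\<^sup>2 \<le> c1 * \<bar>D x\<bar>" for x
  proof -
    let ?h = "\<lambda>t. complex_of_real (exp (- (c / 2) * \<bar>x - t\<bar>))"
    have h: "square_integrable ?h" by (rule sq) (use c in simp)
    have hn: "(norm (?h t))\<^sup>2 = exp (- c * \<bar>x - t\<bar>)" for t
      by (simp add: power2_eq_square mult_exp_exp)
    show ?thesis
    proof (cases "integrable lborel (\<lambda>t. ?K t x)")
      case True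
      have hfn: "(norm (?h t * f t))\<^sup>2 = ?K t x" for t
        unfolding norm_mult power_mult_distrib hn ..
      have hf: "square_integrable (\<lambda>t. ?h t * f t)"
        unfolding square_integrable_def hfn using True by auto
      have p: "norm (?h t * (?h t * f t)) = exp (- c * \<bar>x - t\<bar>) * norm (f t)" for t
        by (simp add: norm_mult mult_exp_exp mult.assoc[symmetric])
      have "E x \<le> sqrt c1 * sqrt (D x)"
        using l2_Cauchy_Schwarz(2)[OF h hf]
        unfolding p hfn hn E_def D_def c1_def integral_exp_abs_translate' .
      moreover have "0 \<le> E x" by (simp add: E_def)
      ultimately have "(E x)\<^sup>2 \<le> (sqrt c1 * sqrt (D x))\<^sup>2" by (intro power_mono) auto
      also have "\<dots> = c1 * D x" using c10 by (simp add: power_mult_distrib D_def)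
      also have "\<dots> \<le> c1 * \<bar>D x\<bar>" using c10 by (intro mult_left_mono) auto
      finally show ?thesis .
    next
      case False
      have "?K t x \<le> (norm (f t))\<^sup>2" for t
        using c by (intro mult_left_le_one_le) auto
      then have "integrable lborel (\<lambda>t. ?K t x)"
        by (intro Bochner_Integration.integrable_bound[OF f2]) auto
      with False show ?thesis by simp
    qed
  qed
  have Dp: "integrable lborel (\<lambda>x. c1 * \<bar>D x\<bar>)" using Di by simp
  show "integrable lborel (\<lambda>x. (E x)\<^sup>2)"
    by (rule Bochner_Integration.integrable_bound[OF Dp]) (use ED c10 in \<open>auto simp: abs_mult\<close>)
  then have "(LBINT x. (E x)\<^sup>2) \<le> (LBINT x. c1 * \<bar>D x\<bar>)"
    by (intro integral_mono Dp ED)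
  also have "\<dots> = c1 * (LBINT x. D x)" by (simp add: D_def)
  finally show "(LBINT x. (E x)\<^sup>2) \<le> (LBINT x. exp (- c * \<bar>x\<bar>))\<^sup>2 * (LBINT t. (norm (f t))\<^sup>2)"
    by (simp add: Dint c1_def power2_eq_square mult_ac)
qed

lemma primitive_on_exp:
  "primitive_on UNIV (\<lambda>x. exp (k * complex_of_real x)) (\<lambda>x. k * exp (k * complex_of_real x))"
proof (rule primitive_on_derivative)
  show "((\<lambda>x. exp (k * complex_of_real x)) has_vector_derivative k * exp (k * complex_of_real x)) (at x within UNIV)" for x
  proof -
    have "((\<lambda>w. exp (k * w)) has_field_derivative k * exp (k * complex_of_real x)) (at (complex_of_real x))"
      by (auto intro!: derivative_eq_intros)
    from has_vector_derivative_real_field[OF this] show ?thesis by (simp add: o_def)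
  qed
qed (auto intro!: continuous_intros)

text \<open>Variation of constants: the free resolvent of \<open>f\<close> is a combination of \<open>exp (\<i> * k * x)\<close> and
  \<open>exp (- \<i> * k * x)\<close> whose coefficients are integrals of \<open>f\<close> from \<open>- \<infinity>\<close> and to \<open>\<infinity>\<close>.\<close>

lemma free_resolvent:
  assumes k: "Im k > 0"
  shows "\<exists>C\<ge>0. \<forall>f. \<exists>g g1. primitive_on UNIV g g1 \<and>
    primitive_on UNIV g1 (\<lambda>x. - k\<^sup>2 * g x - l2_rep f x) \<and>
    square_integrable g \<and> square_integrable g1 \<and> norm (l2_class g) \<le> C * norm f \<and>
    (\<forall>x. norm (g x) \<le> C * norm f \<and> norm (g1 x) \<le> C * norm f)"
proof -
  define c where "c = Im k"
  have c: "c > 0" and k0: "k \<noteq> 0" "norm k > 0" using k by (auto simp: c_def)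
  define C1 where "C1 = sqrt (LBINT x::real. exp (- (2 * c) * \<bar>x\<bar>))"
  define C2 where "C2 = (LBINT x::real. exp (- c * \<bar>x\<bar>))"
  define C where "C = (1 + 1 / norm k) * (C1 + C2)"
  have C1: "C1 \<ge> 0" "C2 \<ge> 0" unfolding C1_def C2_def by auto
  have "C \<ge> 0" unfolding C_def using C1 by simp
  moreover have "\<exists>g g1. primitive_on UNIV g g1 \<and>
    primitive_on UNIV g1 (\<lambda>x. - k\<^sup>2 * g x - l2_rep f x) \<and>
    square_integrable g \<and> square_integrable g1 \<and> norm (l2_class g) \<le> C * norm f \<and>
    (\<forall>x. norm (g x) \<le> C * norm f \<and> norm (g1 x) \<le> C * norm f)" for f
  proof -
    define F where "F = l2_rep f"
    have F: "square_integrable F" unfolding F_def by (rule square_integrable_l2_rep)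
    have Fm[measurable]: "F \<in> borel_measurable borel" using F by (simp add: square_integrable_def)
    have nF: "sqrt (LBINT t. (norm (F t))\<^sup>2) = norm f" by (simp add: norm_l2_eq F_def)
    define E where "E x = (LBINT t. exp (- c * \<bar>x - t\<bar>) * norm (F t))" for x
    note conv = exponential_convolution[OF c F, folded E_def]
    have E1: "E x \<le> C1 * norm f" for x using conv(2)[of x] unfolding nF C1_def .
    have E0: "E x \<ge> 0" for x by (simp add: E_def)
    define ep em where "ep x = exp (\<i> * k * complex_of_real x)" and "em x = exp (- \<i> * k * complex_of_real x)" for x
    have epm: "ep x * em x = 1" for x by (simp add: ep_def em_def mult_exp_exp)
    have ec: "continuous_on UNIV ep" "continuous_on UNIV em"
      unfolding ep_def[abs_def] em_def[abs_def] by (auto intro!: continuous_intros)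
    have [measurable]: "ep \<in> borel_measurable borel" "em \<in> borel_measurable borel"
      using ec by (auto intro: borel_measurable_continuous_onI)
    have nep: "norm (ep x) = exp (- c * x)" "norm (em x) = exp (c * x)" for x
      by (simp_all add: ep_def em_def c_def)
    have ind1: "norm (indicator {..x} t *\<^sub>R (em t * F t)) \<le> exp (c * x) * (exp (- c * \<bar>x - t\<bar>) * norm (F t))" for x t
    proof (cases "t \<le> x")
      case True
      then have "exp (c * t) = exp (c * x) * exp (- c * \<bar>x - t\<bar>)"
        unfolding mult_exp_exp by (simp add: algebra_simps)
      then show ?thesis using True by (simp add: norm_mult nep)
    qed simp
    have ind2: "norm (indicator {x..} t *\<^sub>R (ep t * F t)) \<le> exp (- c * x) * (exp (- c * \<bar>x - t\<bar>) * norm (F t))" for x t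
    proof (cases "t \<ge> x")
      case True
      then have "exp (- c * t) = exp (- c * x) * exp (- c * \<bar>x - t\<bar>)"
        unfolding mult_exp_exp by (simp add: algebra_simps)
      then show ?thesis using True by (simp add: norm_mult nep)
    qed simp
    have i1: "set_integrable lborel {..x} (\<lambda>t. em t * F t)" for x
      unfolding set_integrable_def
      by (rule Bochner_Integration.integrable_bound[OF integrable_mult_right[OF conv(1)[of x], of "exp (c * x)"]])
         (use ind1[of x] in \<open>auto simp: abs_mult\<close>)
    have i2: "set_integrable lborel {x..} (\<lambda>t. ep t * F t)" for x
      unfolding set_integrable_def
      by (rule Bochner_Integration.integrable_bound[OF integrable_mult_right[OF conv(1)[of x], of "exp (- c * x)"]])
         (use ind2[of x] in \<open>auto simp: abs_mult\<close>)
    define A where "A x = (LBINT t:{..x}. em t * F t)" for x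
    define B where "B x = (LBINT t:{x..}. ep t * F t)" for x
    have pA: "primitive_on UNIV A (\<lambda>t. em t * F t)"
    proof (rule primitive_onI)
      fix a b :: real assume ab: "a \<le> b"
      show i: "set_integrable lborel {a..b} (\<lambda>t. em t * F t)"
        by (rule set_integrable_subset[OF i1[of b]]) auto
      have un: "{..b} = {..a} \<union> {a..b}" using ab by auto
      have "A b = A a + (LBINT t:{a..b}. em t * F t)"
        unfolding A_def un
      proof (rule set_integral_Un_AE)
        show "AE x in lborel. \<not> (x \<in> {..a} \<and> x \<in> {a..b})"
          using AE_lborel_singleton[of a] by eventually_elim auto
      qed (use i i1 in auto)
      then show "A b - A a = (LBINT t:{a..b}. em t * F t)" by simp
    qed
    have pB: "primitive_on UNIV B (\<lambda>t. - (ep t * F t))"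
    proof (rule primitive_onI)
      fix a b :: real assume ab: "a \<le> b"
      have i: "set_integrable lborel {a..b} (\<lambda>t. ep t * F t)"
        by (rule set_integrable_subset[OF i2[of a]]) auto
      then show "set_integrable lborel {a..b} (\<lambda>t. - (ep t * F t))" by (simp add: set_integrable_def)
      have un: "{a..} = {a..b} \<union> {b..}" using ab by auto
      have "B a = (LBINT t:{a..b}. ep t * F t) + B b"
        unfolding B_def un
      proof (rule set_integral_Un_AE)
        show "AE x in lborel. \<not> (x \<in> {a..b} \<and> x \<in> {b..})"
          using AE_lborel_singleton[of b] by eventually_elim auto
      qed (use i i2 in auto)
      then show "B b - B a = (LBINT t:{a..b}. - (ep t * F t))"
        by (simp add: set_integral_uminus[OF i])
    qed
    have bA: "norm (ep x * A x) \<le> E x" for x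
    proof -
      have "norm (A x) \<le> (LBINT t. norm (indicator {..x} t *\<^sub>R (em t * F t)))"
        unfolding A_def set_lebesgue_integral_def by (rule integral_norm_bound)
      also have "\<dots> \<le> (LBINT t. exp (c * x) * (exp (- c * \<bar>x - t\<bar>) * norm (F t)))"
        using i1[of x] by (intro integral_mono integrable_norm integrable_mult_right conv(1) ind1) (simp add: set_integrable_def)
      also have "\<dots> = exp (c * x) * E x" by (simp add: E_def)
      finally have "exp (- c * x) * norm (A x) \<le> exp (- c * x) * (exp (c * x) * E x)"
        by (intro mult_left_mono) auto
      also have "\<dots> = (exp (- c * x) * exp (c * x)) * E x" by simp
      finally show ?thesis unfolding mult_exp_exp by (simp add: norm_mult nep)
    qed
    have bB: "norm (em x * B x) \<le> E x" for x
    proof -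
      have "norm (B x) \<le> (LBINT t. norm (indicator {x..} t *\<^sub>R (ep t * F t)))"
        unfolding B_def set_lebesgue_integral_def by (rule integral_norm_bound)
      also have "\<dots> \<le> (LBINT t. exp (- c * x) * (exp (- c * \<bar>x - t\<bar>) * norm (F t)))"
        using i2[of x] by (intro integral_mono integrable_norm integrable_mult_right conv(1) ind2) (simp add: set_integrable_def)
      also have "\<dots> = exp (- c * x) * E x" by (simp add: E_def)
      finally have "exp (c * x) * norm (B x) \<le> exp (c * x) * (exp (- c * x) * E x)"
        by (intro mult_left_mono) auto
      also have "\<dots> = (exp (c * x) * exp (- c * x)) * E x" by simp
      finally show ?thesis unfolding mult_exp_exp by (simp add: norm_mult nep)
    qed
    have ppm: "primitive_on UNIV ep (\<lambda>x. \<i> * k * ep x)" "primitive_on UNIV em (\<lambda>x. - \<i> * k * em x)"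
      unfolding ep_def[abs_def] em_def[abs_def] by (rule primitive_on_exp)+
    note pa = primitive_on_mult[OF ppm(1) pA is_interval_univ]
    note pb = primitive_on_mult[OF ppm(2) pB is_interval_univ]
    define g where "g x = (\<i> / (2 * k)) * (ep x * A x + em x * B x)" for x
    define g1 where "g1 x = (- 1 / 2) * (ep x * A x - em x * B x)" for x
    have epm': "ep x * (em x * w) = w" "em x * (ep x * w) = w" for x w
      using epm[of x] by (simp_all add: mult.assoc[symmetric] mult.commute[of "em x"])
    have pg: "primitive_on UNIV g g1"
      by (rule primitive_on_cong[OF primitive_on_cmult[OF primitive_on_add[OF pa pb], of "\<i> / (2 * k)"]])
         (use k0 in \<open>auto simp: g_def g1_def is_interval_univ epm' field_simps\<close>)
    have pg1: "primitive_on UNIV g1 (\<lambda>x. - k\<^sup>2 * g x - F x)"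
      by (rule primitive_on_cong[OF primitive_on_cmult[OF primitive_on_diff[OF pa pb], of "- 1 / 2"]])
         (use k0 in \<open>auto simp: g_def g1_def is_interval_univ epm' field_simps power2_eq_square\<close>)
    have bg: "norm (g x) \<le> E x / norm k" "norm (g1 x) \<le> E x" for x
    proof -
      have "norm (ep x * A x + em x * B x) \<le> 2 * E x"
        using norm_triangle_ineq[of "ep x * A x" "em x * B x"] bA[of x] bB[of x] by linarith
      moreover have "norm (g x) = norm (ep x * A x + em x * B x) / (2 * norm k)"
        by (simp add: g_def norm_mult norm_divide)
      ultimately show "norm (g x) \<le> E x / norm k"
        using k0 by (simp add: field_simps)
      have "norm (ep x * A x - em x * B x) \<le> 2 * E x"
        using norm_triangle_ineq4[of "ep x * A x" "em x * B x"] bA[of x] bB[of x] by linarith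
      then show "norm (g1 x) \<le> E x" by (simp add: g1_def norm_mult norm_divide)
    qed
    have gm: "g \<in> borel_measurable lborel" "g1 \<in> borel_measurable lborel"
      using continuous_on_primitive_UNIV[OF pg] continuous_on_primitive_UNIV[OF pg1]
      by (auto intro: borel_measurable_continuous_onI)
    have sE: "square_integrable (\<lambda>x. of_real (E x))"
      using conv(3) unfolding square_integrable_def E_def[abs_def]
      by (auto intro!: borel_measurable_of_real lborel.borel_measurable_lebesgue_integral)
    have sg: "square_integrable g" "square_integrable g1"
      by (rule square_integrable_bound[OF gm(1) sE, of "1 / norm k"], use bg E0 in simp)
         (rule square_integrable_bound[OF gm(2) sE, of 1], use bg E0 in simp)
    have "norm (l2_class g) \<le> C2 / norm k * norm f"
    proof -
      have "(LBINT x. (norm (g x))\<^sup>2) \<le> (LBINT x. (1 / norm k)\<^sup>2 * (E x)\<^sup>2)"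
      proof (intro integral_mono)
        show "integrable lborel (\<lambda>x. (norm (g x))\<^sup>2)" using sg by (simp add: square_integrable_def)
        show "integrable lborel (\<lambda>x. (1 / norm k)\<^sup>2 * (E x)\<^sup>2)" using conv(3) by (rule integrable_mult_right)
        show "(norm (g x))\<^sup>2 \<le> (1 / norm k)\<^sup>2 * (E x)\<^sup>2" for x
          using power_mono[OF bg(1)[of x], of 2] by (simp add: power_divide)
      qed
      also have "\<dots> \<le> (1 / norm k)\<^sup>2 * (C2\<^sup>2 * (LBINT t. (norm (F t))\<^sup>2))"
        using conv(4) unfolding integral_mult_right_zero C2_def by (intro mult_left_mono) auto
      finally have "sqrt (LBINT x. (norm (g x))\<^sup>2) \<le> sqrt ((1 / norm k)\<^sup>2 * (C2\<^sup>2 * (LBINT t. (norm (F t))\<^sup>2)))"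
        by (rule real_sqrt_le_mono)
      also have "\<dots> = C2 / norm k * norm f"
        using C1 k0 unfolding real_sqrt_mult nF by (simp add: real_sqrt_divide power_divide)
      finally show ?thesis by (simp add: norm_l2_class[OF sg(1)])
    qed
    moreover have "C2 / norm k * norm f \<le> C * norm f" "E x / norm k \<le> C * norm f" "E x \<le> C * norm f" for x
    proof -
      have CC: "C2 / norm k \<le> C" "C1 / norm k \<le> C" "C1 \<le> C"
        using C1 k0 by (simp_all add: C_def ring_distribs add_divide_distrib)
      show "C2 / norm k * norm f \<le> C * norm f" by (rule mult_right_mono[OF CC(1)]) simp
      have "E x / norm k \<le> C1 * norm f / norm k" using E1 k0 by (intro divide_right_mono) auto
      also have "\<dots> = (C1 / norm k) * norm f" by simp
      also have "\<dots> \<le> C * norm f" by (rule mult_right_mono[OF CC(2)]) simp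
      finally show "E x / norm k \<le> C * norm f" .
      have "C1 * norm f \<le> C * norm f" by (rule mult_right_mono[OF CC(3)]) simp
      then show "E x \<le> C * norm f" using E1[of x] by linarith
    qed
    ultimately have "norm (l2_class g) \<le> C * norm f"
      "\<forall>x. norm (g x) \<le> C * norm f \<and> norm (g1 x) \<le> C * norm f"
      using bg by (blast intro: order_trans)+
    then show ?thesis using pg pg1 sg unfolding F_def by blast
  qed
  ultimately show ?thesis by blast
qed

section \<open>Membership in the Hamiltonians\<close>

lemma H_eps_memberI:
  assumes Y: "primitive_on UNIV Y Y1"
    and Y1: "primitive_on UNIV Y1 (\<lambda>x. (of_real (\<alpha> / \<epsilon>\<^sup>2 * \<Psi> (x / \<epsilon>)) - z) * Y x - l2_rep f x)"
    and sq: "square_integrable Y" "square_integrable Y1"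
    and \<Psi>: "continuous_on UNIV \<Psi>" "\<And>x. \<bar>\<Psi> x\<bar> \<le> M" and "\<epsilon> > 0"
  shows "(l2_class Y, f + z *\<^sub>C l2_class Y) \<in> H_eps \<epsilon> \<alpha> \<Psi>"
proof -
  define V where "V x = \<alpha> / \<epsilon>\<^sup>2 * \<Psi> (x / \<epsilon>)" for x
  have V: "continuous_on UNIV V" unfolding V_def[abs_def]
    by (intro continuous_intros continuous_on_compose2[OF \<Psi>(1)]) (use \<open>\<epsilon> > 0\<close> in auto)
  have Vm: "V \<in> borel_measurable lborel" using V by (auto intro: borel_measurable_continuous_onI)
  have Ym: "Y \<in> borel_measurable lborel" using sq(1) by (rule square_integrable_measurable)
  have VY: "square_integrable (\<lambda>x. of_real (V x) * Y x)"
  proof (rule square_integrable_bound[OF _ sq(1)])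
    show "(\<lambda>x. of_real (V x) * Y x) \<in> borel_measurable lborel"
      using Vm Ym by simp
    show "norm (of_real (V x) * Y x) \<le> \<bar>\<alpha> / \<epsilon>\<^sup>2\<bar> * M * norm (Y x)" for x
      unfolding norm_mult norm_of_real V_def abs_mult
      by (intro mult_right_mono mult_left_mono \<Psi>(2)) auto
  qed
  define Y2 where "Y2 x = of_real (V x) * Y x + ((- z) * Y x + - l2_rep f x)" for x
  have Y2: "square_integrable Y2"
    unfolding Y2_def[abs_def]
    by (intro square_integrable_add VY square_integrable_mult sq square_integrable_minus square_integrable_l2_rep)
  have eq: "(\<lambda>x. (of_real (\<alpha> / \<epsilon>\<^sup>2 * \<Psi> (x / \<epsilon>)) - z) * Y x - l2_rep f x) = Y2"
    by (auto simp: Y2_def V_def algebra_simps)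
  note r = l2_rep_class[OF sq(1)] l2_rep_class[OF sq(2)] l2_rep_class[OF Y2]
  have "weak_derivative UNIV (l2_class Y) (l2_class Y1)"
    by (rule weak_derivative_if_primitive[OF Y square_integrable_measurable[OF sq(2)] r(1,2)])
  moreover have "weak_derivative UNIV (l2_class Y1) (l2_class Y2)"
    by (rule weak_derivative_if_primitive[OF Y1[unfolded eq] square_integrable_measurable[OF Y2] r(2,3)])
  ultimately have "(l2_class Y, l2_class Y1, l2_class Y2) \<in> sobolev_2_2 UNIV"
    by (simp add: sobolev_2_2_def l2_on_def)
  moreover have "AE x in lborel. l2_rep (f + z *\<^sub>C l2_class Y) x = - l2_rep (l2_class Y2) x + (\<alpha> / \<epsilon>\<^sup>2 * \<Psi> (x / \<epsilon>)) *\<^sub>R l2_rep (l2_class Y) x"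
    using r l2_rep_add[of f "z *\<^sub>C l2_class Y"] l2_rep_scaleC[of z "l2_class Y"]
    by eventually_elim (simp add: Y2_def V_def scaleR_conv_of_real)
  ultimately show ?thesis unfolding H_eps_def by blast
qed

text \<open>The common second derivative \<open>Y2\<close> is given on the whole line, the first derivative by one function on
  each side, because it may jump at the origin as well.\<close>

lemma weak_derivative_pieces:
  assumes m: "primitive_on {..0} Ym Ym1" "primitive_on {..0} Ym1 Y2"
    and p: "primitive_on {0..} Yp Yp1" "primitive_on {0..} Yp1 Y2"
    and c: "continuous_on UNIV Ym1" "continuous_on UNIV Yp1"
    and ae: "AE x in lborel. l2_rep y x = (if x < 0 then Ym x else Yp x)"
      "AE x in lborel. l2_rep y1 x = (if x < 0 then Ym1 x else Yp1 x)"
      "AE x in lborel. l2_rep y2 x = Y2 x" and Y2: "Y2 \<in> borel_measurable lborel" and U: "0 \<notin> U"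
  shows "weak_derivative U y y1" "weak_derivative U y1 y2"
proof -
  have [measurable]: "Ym1 \<in> borel_measurable borel" "Yp1 \<in> borel_measurable borel"
    using c by (auto intro: borel_measurable_continuous_onI)
  let ?Y1 = "\<lambda>x. if x < 0 then Ym1 x else Yp1 x"
  have m1: "?Y1 \<in> borel_measurable lborel" by simp
  have "primitive_on {..0} Ym ?Y1"
  proof (rule primitive_on_cong_AE[OF m(1) is_interval_ic _ m1])
    show "AE x in lborel. x \<in> {..0} \<longrightarrow> Ym1 x = ?Y1 x"
      using AE_lborel_singleton[of "0::real"] by eventually_elim auto
  qed simp
  moreover have "primitive_on {0..} Yp ?Y1"
    by (rule primitive_on_cong[OF p(1) is_interval_ci]) auto
  ultimately show "weak_derivative U y y1"
    by (rule weak_derivative_if_primitive_punctured[OF _ _ m1 ae(1,2) U])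
  show "weak_derivative U y1 y2"
    by (rule weak_derivative_if_primitive_punctured[OF m(2) p(2) Y2 ae(2,3) U])
qed

lemma has_limit_value_pieces:
  assumes c: "continuous_on UNIV Ym" "continuous_on UNIV Yp"
    and ae: "AE x in lborel. l2_rep y x = (if x < 0 then Ym x else Yp x)"
  shows "has_limit_value y (at_left 0) (Ym 0)" "has_limit_value y (at_right 0) (Yp 0)"
proof -
  let ?f = "\<lambda>x. if x < 0 then Ym x else Yp x"
  have "isCont ?f x" if "x \<noteq> 0" for x
  proof (cases "x < 0")
    case True
    have "isCont Ym x" using c(1) by (simp add: continuous_on_eq_continuous_at)
    moreover have e: "\<forall>\<^sub>F t in nhds x. ?f t = Ym t"
      using eventually_nhds_in_open[of "{..<0}" x] True by (auto elim: eventually_mono)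
    ultimately show ?thesis unfolding isCont_cong[OF e] by blast
  next
    case False
    have "isCont Yp x" using c(2) by (simp add: continuous_on_eq_continuous_at)
    moreover have e: "\<forall>\<^sub>F t in nhds x. ?f t = Yp t"
      using eventually_nhds_in_open[of "{0<..}" x] False that by (auto elim: eventually_mono)
    ultimately show ?thesis unfolding isCont_cong[OF e] by blast
  qed
  then have f: "continuous_on (- {0}) ?f" by (intro continuous_at_imp_continuous_on) auto
  have "(Ym \<longlongrightarrow> Ym 0) (at_left 0)" "(Yp \<longlongrightarrow> Yp 0) (at_right 0)"
    using c by (auto simp: continuous_on_eq_continuous_at continuous_at intro: tendsto_within_subset)
  moreover have e1: "\<forall>\<^sub>F t in at_left 0. Ym t = ?f t"
    by (rule eventually_at_leftI[of "-1"]) auto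
  moreover have e2: "\<forall>\<^sub>F t in at_right 0. Yp t = ?f t"
    by (rule eventually_at_rightI[of _ 1]) auto
  ultimately have "(?f \<longlongrightarrow> Ym 0) (at_left 0)" "(?f \<longlongrightarrow> Yp 0) (at_right 0)"
    unfolding tendsto_cong[OF e1] tendsto_cong[OF e2] by simp_all
  then show "has_limit_value y (at_left 0) (Ym 0)" "has_limit_value y (at_right 0) (Yp 0)"
    unfolding has_limit_value_def using f ae by blast+
qed

lemma S_op_memberI:
  assumes m: "primitive_on UNIV Ym Ym1" "primitive_on UNIV Ym1 (\<lambda>x. - z * Ym x - l2_rep f x)"
    and p: "primitive_on UNIV Yp Yp1" "primitive_on UNIV Yp1 (\<lambda>x. - z * Yp x - l2_rep f x)"
    and sq: "square_integrable (\<lambda>x. if x < 0 then Ym x else Yp x)"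
      "square_integrable (\<lambda>x. if x < 0 then Ym1 x else Yp1 x)"
    and i: "Yp 0 = of_real \<theta> * Ym 0" "of_real \<theta> * Yp1 0 = Ym1 0"
  shows "(l2_class (\<lambda>x. if x < 0 then Ym x else Yp x),
      f + z *\<^sub>C l2_class (\<lambda>x. if x < 0 then Ym x else Yp x)) \<in> S_op \<theta>"
proof -
  let ?Y = "\<lambda>x. if x < 0 then Ym x else Yp x" and ?Y1 = "\<lambda>x. if x < 0 then Ym1 x else Yp1 x"
  define y where "y = l2_class ?Y"
  define y2 where "y2 = - (f + z *\<^sub>C y)"
  have c: "continuous_on UNIV Ym" "continuous_on UNIV Yp" "continuous_on UNIV Ym1" "continuous_on UNIV Yp1"
    using continuous_on_primitive_UNIV m p by blast+
  have ae: "AE x in lborel. l2_rep y x = ?Y x" "AE x in lborel. l2_rep (l2_class ?Y1) x = ?Y1 x"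
    unfolding y_def by (rule l2_rep_class[OF sq(1)], rule l2_rep_class[OF sq(2)])
  let ?Y2 = "\<lambda>x. - z * ?Y x - l2_rep f x"
  have ae2: "AE x in lborel. l2_rep y2 x = ?Y2 x"
    using ae(1) l2_rep_uminus[of "f + z *\<^sub>C y"] l2_rep_add[of f "z *\<^sub>C y"] l2_rep_scaleC[of z y]
    unfolding y2_def by eventually_elim simp
  have Y2: "?Y2 \<in> borel_measurable lborel"
    using square_integrable_measurable[OF sq(1)] l2_rep_measurable[of f]
    by (intro borel_measurable_diff borel_measurable_times borel_measurable_const)
  have Fm: "(\<lambda>x. - z * Ym x - l2_rep f x) \<in> borel_measurable lborel"
    using borel_measurable_continuous_onI[OF c(1)] l2_rep_measurable[of f]
    by (intro borel_measurable_diff borel_measurable_times borel_measurable_const) auto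
  have pm: "primitive_on {..0} Ym1 ?Y2"
  proof (rule primitive_on_cong_AE[OF primitive_on_subset[OF m(2)] is_interval_ic Fm Y2])
    show "AE x in lborel. x \<in> {..0} \<longrightarrow> - z * Ym x - l2_rep f x = ?Y2 x"
      using AE_lborel_singleton[of "0::real"] by eventually_elim auto
  qed simp
  have pp: "primitive_on {0..} Yp1 ?Y2"
    by (rule primitive_on_cong[OF primitive_on_subset[OF p(2)] is_interval_ci]) auto
  have U: "0 \<notin> - {0::real}" by simp
  note w = weak_derivative_pieces[OF primitive_on_subset[OF m(1)] pm primitive_on_subset[OF p(1)] pp c(3,4) ae ae2 Y2 U]
  have ne: "AE x in lborel. x \<noteq> (0::real)" using AE_lborel_singleton[of "0::real"] .
  have on: "u \<in> l2_on (- {0})" for u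
    unfolding l2_on_def mem_Collect_eq using ne by eventually_elim simp
  have "(y, l2_class ?Y1, y2) \<in> sobolev_2_2 (- {0})"
    unfolding sobolev_2_2_def using on w by simp
  moreover have "f + z *\<^sub>C y = - y2" by (simp add: y2_def)
  ultimately show ?thesis
    using has_limit_value_pieces[OF c(1,2) ae(1)] has_limit_value_pieces[OF c(3,4) ae(2)] i
    unfolding S_op_def y_def[symmetric] by blast
qed

lemma square_integrable_indicator:
  assumes "square_integrable F" "A \<in> sets borel"
  shows "square_integrable (\<lambda>x. indicator A x *\<^sub>R F x)"
proof (rule square_integrable_bound[OF _ assms(1), of _ 1])
  show "(\<lambda>x. indicator A x *\<^sub>R F x) \<in> borel_measurable lborel"
    using square_integrable_measurable[OF assms(1)] assms(2) by (intro borel_measurable_scaleR) auto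
qed (auto split: split_indicator)

lemma Dirichlet_memberI:
  assumes m: "primitive_on UNIV Ym Ym1" "primitive_on UNIV Ym1 (\<lambda>x. - z * Ym x - l2_rep f x)"
    and p: "primitive_on UNIV Yp Yp1" "primitive_on UNIV Yp1 (\<lambda>x. - z * Yp x - l2_rep f x)"
    and sq: "square_integrable (\<lambda>x. if x < 0 then Ym x else Yp x)"
      "square_integrable (\<lambda>x. if x < 0 then Ym1 x else Yp1 x)"
    and i: "Yp 0 = 0" "Ym 0 = 0"
  shows "(l2_class (\<lambda>x. if x < 0 then Ym x else Yp x),
      f + z *\<^sub>C l2_class (\<lambda>x. if x < 0 then Ym x else Yp x)) \<in> S_minus \<oplus>\<^sub>o\<^sub>p S_plus"
proof -
  let ?Y = "\<lambda>x. if x < 0 then Ym x else Yp x" and ?Y1 = "\<lambda>x. if x < 0 then Ym1 x else Yp1 x"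
  have c: "continuous_on UNIV Ym" "continuous_on UNIV Yp" "continuous_on UNIV Ym1" "continuous_on UNIV Yp1"
    using continuous_on_primitive_UNIV m p by blast+
  have c0: "continuous_on UNIV (\<lambda>x::real. 0::complex)" by simp
  have p0: "primitive_on I (\<lambda>x. 0) (\<lambda>x. 0)" for I
    by (auto simp: primitive_on_def set_integrable_def)
  define y where "y = l2_class ?Y"
  \<comment> \<open>The two components of the direct sum are the restrictions to the half-lines.\<close>
  define u u1 u2 where "u = l2_class (\<lambda>x. indicator {..<0} x *\<^sub>R ?Y x)"
    and "u1 = l2_class (\<lambda>x. indicator {..<0} x *\<^sub>R ?Y1 x)"
    and "u2 = l2_class (\<lambda>x. indicator {..<0} x *\<^sub>R (- l2_rep (f + z *\<^sub>C y) x))"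
  define v v1 v2 where "v = l2_class (\<lambda>x. indicator {0<..} x *\<^sub>R ?Y x)"
    and "v1 = l2_class (\<lambda>x. indicator {0<..} x *\<^sub>R ?Y1 x)"
    and "v2 = l2_class (\<lambda>x. indicator {0<..} x *\<^sub>R (- l2_rep (f + z *\<^sub>C y) x))"
  note sqf = square_integrable_minus[OF square_integrable_l2_rep[of "f + z *\<^sub>C y"]]
  have ne: "AE x in lborel. x \<noteq> (0::real)" using AE_lborel_singleton[of "0::real"] .
  have aey: "AE x in lborel. l2_rep (f + z *\<^sub>C y) x = l2_rep f x + z * ?Y x"
    using l2_rep_class[OF sq(1)] l2_rep_add[of f "z *\<^sub>C y"] l2_rep_scaleC[of z y]
    unfolding y_def by eventually_elim simp
  have Fm: "(\<lambda>x. - z * Y x - l2_rep f x) \<in> borel_measurable lborel" if "continuous_on UNIV Y" for Y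
    using borel_measurable_continuous_onI[OF that] l2_rep_measurable[of f]
    by (intro borel_measurable_diff borel_measurable_times borel_measurable_const) auto
  let ?U2 = "\<lambda>x. if x < 0 then - z * Ym x - l2_rep f x else 0"
  let ?V2 = "\<lambda>x. if x > 0 then - z * Yp x - l2_rep f x else 0"
  have Um: "?U2 \<in> borel_measurable lborel" "?V2 \<in> borel_measurable lborel"
    using measurable_If[OF Fm[OF c(1)] measurable_const[of 0], of "\<lambda>x. x < 0"]
      measurable_If[OF Fm[OF c(2)] measurable_const[of 0], of "\<lambda>x. x > 0"] by auto
  have aeu: "AE x in lborel. l2_rep u x = (if x < 0 then Ym x else (\<lambda>x. 0) x)"
    "AE x in lborel. l2_rep u1 x = (if x < 0 then Ym1 x else (\<lambda>x. 0) x)"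
    using l2_rep_class[OF square_integrable_indicator[OF sq(1), of "{..<0}", OF lessThan_borel]]
      l2_rep_class[OF square_integrable_indicator[OF sq(2), of "{..<0}", OF lessThan_borel]]
    unfolding u_def u1_def by (eventually_elim, auto)+
  have aeu2: "AE x in lborel. l2_rep u2 x = ?U2 x"
    using l2_rep_class[OF square_integrable_indicator[OF sqf, of "{..<0}", OF lessThan_borel]] aey
    unfolding u2_def by eventually_elim auto
  have aev: "AE x in lborel. l2_rep v x = (if x < 0 then (\<lambda>x. 0) x else Yp x)"
    "AE x in lborel. l2_rep v1 x = (if x < 0 then (\<lambda>x. 0) x else Yp1 x)"
    using l2_rep_class[OF square_integrable_indicator[OF sq(1), of "{0<..}", OF greaterThan_borel]] ne
      l2_rep_class[OF square_integrable_indicator[OF sq(2), of "{0<..}", OF greaterThan_borel]]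
    unfolding v_def v1_def by (eventually_elim, auto)+
  have aev2: "AE x in lborel. l2_rep v2 x = ?V2 x"
    using l2_rep_class[OF square_integrable_indicator[OF sqf, of "{0<..}", OF greaterThan_borel]] aey
    unfolding v2_def by eventually_elim auto
  have pu: "primitive_on {..0} Ym1 ?U2"
  proof (rule primitive_on_cong_AE[OF primitive_on_subset[OF m(2)] is_interval_ic Fm[OF c(1)] Um(1)])
    show "AE x in lborel. x \<in> {..0} \<longrightarrow> - z * Ym x - l2_rep f x = ?U2 x"
      using ne by eventually_elim auto
  qed simp
  have pv: "primitive_on {0..} Yp1 ?V2"
  proof (rule primitive_on_cong_AE[OF primitive_on_subset[OF p(2)] is_interval_ci Fm[OF c(2)] Um(2)])
    show "AE x in lborel. x \<in> {0..} \<longrightarrow> - z * Yp x - l2_rep f x = ?V2 x"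
      using ne by eventually_elim auto
  qed simp
  have pu0: "primitive_on {0..} (\<lambda>x. 0) ?U2"
    by (rule primitive_on_cong[OF p0 is_interval_ci]) auto
  have pv0: "primitive_on {..0} (\<lambda>x. 0) ?V2"
    by (rule primitive_on_cong[OF p0 is_interval_ic]) auto
  have U: "0 \<notin> {..<0::real}" "0 \<notin> {0::real<..}" by auto
  note wu = weak_derivative_pieces[OF primitive_on_subset[OF m(1)] pu p0 pu0 c(3) c0 aeu aeu2 Um(1) U(1)]
  note wv = weak_derivative_pieces[OF p0 pv0 primitive_on_subset[OF p(1)] pv c0 c(4) aev aev2 Um(2) U(2)]
  have "u \<in> l2_on {..<0}" "u1 \<in> l2_on {..<0}" "u2 \<in> l2_on {..<0}"
    using aeu aeu2 unfolding l2_on_def mem_Collect_eq by (eventually_elim, auto)+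
  then have su: "(u, u1, u2) \<in> sobolev_2_2 {..<0}" using wu by (simp add: sobolev_2_2_def)
  have "AE x in lborel. x \<notin> {0<..} \<longrightarrow> l2_rep v x = 0" using aev(1) ne by eventually_elim auto
  moreover have "AE x in lborel. x \<notin> {0<..} \<longrightarrow> l2_rep v1 x = 0" using aev(2) ne by eventually_elim auto
  moreover have "AE x in lborel. x \<notin> {0<..} \<longrightarrow> l2_rep v2 x = 0" using aev2 ne by eventually_elim auto
  ultimately have sv: "(v, v1, v2) \<in> sobolev_2_2 {0<..}" using wv by (simp add: sobolev_2_2_def l2_on_def)
  have "(u, - u2) \<in> S_minus"
    using su has_limit_value_pieces(1)[OF c(1) c0 aeu(1)] i unfolding S_minus_def by auto
  moreover have "(v, - v2) \<in> S_plus"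
    using sv has_limit_value_pieces(2)[OF c0 c(2) aev(1)] i unfolding S_plus_def by auto
  moreover have "y = u + v"
    unfolding l2_eq_iff using l2_rep_add[of u v] aeu(1) aev(1) l2_rep_class[OF sq(1)]
    unfolding y_def by eventually_elim auto
  moreover have "f + z *\<^sub>C y = - u2 + - v2"
    unfolding l2_eq_iff using l2_rep_add[of "- u2" "- v2"] l2_rep_uminus[of u2] l2_rep_uminus[of v2] aeu2 aev2 aey ne
    by eventually_elim auto
  ultimately show ?thesis unfolding direct_sum_def y_def[symmetric] by blast
qed

section \<open>Convergence of families of functionals\<close>

text \<open>Convergence in norm of functionals on \<open>l2\<close>. Boundedness of the limit is included because the product
  with a convergent scalar family needs it.\<close>

definition functional_tendsto :: "(real \<Rightarrow> l2 \<Rightarrow> complex) \<Rightarrow> (l2 \<Rightarrow> complex) \<Rightarrow> bool" where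
  "functional_tendsto F F0 \<longleftrightarrow>
     (\<exists>C. \<forall>f. norm (F0 f) \<le> C * norm f) \<and>
     (\<exists>\<delta>. (\<delta> \<longlongrightarrow> 0) (at_right 0) \<and> (\<forall>\<epsilon>>0. \<forall>f. norm (F \<epsilon> f - F0 f) \<le> \<delta> \<epsilon> * norm f))"

lemma functional_tendstoI:
  assumes "\<And>f. norm (F0 f) \<le> C * norm f" "(\<delta> \<longlongrightarrow> 0) (at_right 0)"
    "\<And>\<epsilon> f. \<epsilon> > 0 \<Longrightarrow> norm (F \<epsilon> f - F0 f) \<le> \<delta> \<epsilon> * norm f"
  shows "functional_tendsto F F0"
  using assms unfolding functional_tendsto_def by blast

lemma functional_tendstoE:
  assumes "functional_tendsto F F0"
  obtains C \<delta> where "\<And>f. norm (F0 f) \<le> C * norm f" "C \<ge> 0" "(\<delta> \<longlongrightarrow> 0) (at_right 0)" "\<And>\<epsilon>. \<delta> \<epsilon> \<ge> 0"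
    "\<And>\<epsilon> f. \<epsilon> > 0 \<Longrightarrow> norm (F \<epsilon> f - F0 f) \<le> \<delta> \<epsilon> * norm f"
proof -
  obtain C \<delta> where *: "\<And>f. norm (F0 f) \<le> C * norm f" "(\<delta> \<longlongrightarrow> 0) (at_right 0)"
    "\<And>\<epsilon> f. \<epsilon> > 0 \<Longrightarrow> norm (F \<epsilon> f - F0 f) \<le> \<delta> \<epsilon> * norm f"
    using assms unfolding functional_tendsto_def by blast
  show ?thesis
  proof (rule that[of "\<bar>C\<bar>" "\<lambda>\<epsilon>. \<bar>\<delta> \<epsilon>\<bar>"])
    show "norm (F0 f) \<le> \<bar>C\<bar> * norm f" for f
      by (rule order_trans[OF *(1)]) (simp add: mult_right_mono)
    show "((\<lambda>\<epsilon>. \<bar>\<delta> \<epsilon>\<bar>) \<longlongrightarrow> 0) (at_right 0)" by (rule tendsto_rabs_zero[OF *(2)])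
    show "norm (F \<epsilon> f - F0 f) \<le> \<bar>\<delta> \<epsilon>\<bar> * norm f" if "\<epsilon> > 0" for \<epsilon> f
      by (rule order_trans[OF *(3)[OF that]]) (simp add: mult_right_mono)
  qed auto
qed

lemma functional_tendsto_add:
  assumes "functional_tendsto F F0" "functional_tendsto G G0"
  shows "functional_tendsto (\<lambda>\<epsilon> f. F \<epsilon> f + G \<epsilon> f) (\<lambda>f. F0 f + G0 f)"
proof -
  obtain C \<delta> where F: "\<And>f. norm (F0 f) \<le> C * norm f" "(\<delta> \<longlongrightarrow> 0) (at_right 0)"
    "\<And>\<epsilon> f. \<epsilon> > 0 \<Longrightarrow> norm (F \<epsilon> f - F0 f) \<le> \<delta> \<epsilon> * norm f"
    by (rule functional_tendstoE[OF assms(1)]) blast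
  obtain D \<gamma> where G: "\<And>f. norm (G0 f) \<le> D * norm f" "(\<gamma> \<longlongrightarrow> 0) (at_right 0)"
    "\<And>\<epsilon> f. \<epsilon> > 0 \<Longrightarrow> norm (G \<epsilon> f - G0 f) \<le> \<gamma> \<epsilon> * norm f"
    by (rule functional_tendstoE[OF assms(2)]) blast
  show ?thesis
  proof (rule functional_tendstoI[where C="C + D" and \<delta>="\<lambda>\<epsilon>. \<delta> \<epsilon> + \<gamma> \<epsilon>"])
    show "norm (F0 f + G0 f) \<le> (C + D) * norm f" for f
      using norm_triangle_ineq[of "F0 f" "G0 f"] F(1)[of f] G(1)[of f] by (simp add: algebra_simps)
    show "((\<lambda>\<epsilon>. \<delta> \<epsilon> + \<gamma> \<epsilon>) \<longlongrightarrow> 0) (at_right 0)" using tendsto_add[OF F(2) G(2)] by simp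
    fix \<epsilon> :: real and f assume e: "\<epsilon> > 0"
    have "norm (F \<epsilon> f + G \<epsilon> f - (F0 f + G0 f)) \<le> norm (F \<epsilon> f - F0 f) + norm (G \<epsilon> f - G0 f)"
      using norm_triangle_ineq[of "F \<epsilon> f - F0 f" "G \<epsilon> f - G0 f"] by (simp add: algebra_simps)
    then show "norm (F \<epsilon> f + G \<epsilon> f - (F0 f + G0 f)) \<le> (\<delta> \<epsilon> + \<gamma> \<epsilon>) * norm f"
      using F(3)[OF e, of f] G(3)[OF e, of f] by (simp add: algebra_simps)
  qed
qed

lemma functional_tendsto_mult:
  assumes a: "(a \<longlongrightarrow> a0) (at_right 0)" and "functional_tendsto F F0"
  shows "functional_tendsto (\<lambda>\<epsilon> f. a \<epsilon> * F \<epsilon> f) (\<lambda>f. a0 * F0 f)"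
proof -
  obtain C \<delta> where F: "\<And>f. norm (F0 f) \<le> C * norm f" "C \<ge> 0" "(\<delta> \<longlongrightarrow> 0) (at_right 0)" "\<And>\<epsilon>. \<delta> \<epsilon> \<ge> 0"
    "\<And>\<epsilon> f. \<epsilon> > 0 \<Longrightarrow> norm (F \<epsilon> f - F0 f) \<le> \<delta> \<epsilon> * norm f"
    by (rule functional_tendstoE[OF assms(2)]) blast
  show ?thesis
  proof (rule functional_tendstoI[where C="norm a0 * C" and \<delta>="\<lambda>\<epsilon>. norm (a \<epsilon> - a0) * C + norm (a \<epsilon>) * \<delta> \<epsilon>"])
    show "norm (a0 * F0 f) \<le> norm a0 * C * norm f" for f
      using mult_left_mono[OF F(1)[of f], of "norm a0"] by (simp add: norm_mult mult_ac)
    have "((\<lambda>\<epsilon>. norm (a \<epsilon> - a0) * C + norm (a \<epsilon>) * \<delta> \<epsilon>) \<longlongrightarrow> norm (a0 - a0) * C + norm a0 * 0) (at_right 0)"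
      by (intro tendsto_intros a F(3))
    then show "((\<lambda>\<epsilon>. norm (a \<epsilon> - a0) * C + norm (a \<epsilon>) * \<delta> \<epsilon>) \<longlongrightarrow> 0) (at_right 0)" by simp
    fix \<epsilon> :: real and f assume e: "\<epsilon> > 0"
    have "a \<epsilon> * F \<epsilon> f - a0 * F0 f = (a \<epsilon> - a0) * F0 f + a \<epsilon> * (F \<epsilon> f - F0 f)" by (simp add: algebra_simps)
    then have "norm (a \<epsilon> * F \<epsilon> f - a0 * F0 f) \<le> norm (a \<epsilon> - a0) * norm (F0 f) + norm (a \<epsilon>) * norm (F \<epsilon> f - F0 f)"
      by (metis norm_mult norm_triangle_ineq)
    also have "\<dots> \<le> norm (a \<epsilon> - a0) * (C * norm f) + norm (a \<epsilon>) * (\<delta> \<epsilon> * norm f)"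
      by (intro add_mono mult_left_mono F(1) F(5) e) auto
    finally show "norm (a \<epsilon> * F \<epsilon> f - a0 * F0 f) \<le> (norm (a \<epsilon> - a0) * C + norm (a \<epsilon>) * \<delta> \<epsilon>) * norm f"
      by (simp add: algebra_simps)
  qed
qed

lemma functional_tendsto_diff:
  assumes "functional_tendsto F F0" "functional_tendsto G G0"
  shows "functional_tendsto (\<lambda>\<epsilon> f. F \<epsilon> f - G \<epsilon> f) (\<lambda>f. F0 f - G0 f)"
  using functional_tendsto_add[OF assms(1) functional_tendsto_mult[OF tendsto_const assms(2), of "-1"]] by simp

text \<open>The factor \<open>sqrt (b - a)\<close> is the \<open>L\<^sub>2\<close> norm of the indicator function; it is what makes the
  contribution of the source inside a short interval negligible.\<close>

lemma integral_Icc_bound: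
  assumes h: "continuous_on {a..b} h" "\<And>x. x \<in> {a..b} \<Longrightarrow> norm (h x) \<le> K" and ab: "a \<le> b" and "K \<ge> 0"
  shows "set_integrable lborel {a..b} (\<lambda>x. h x * l2_rep f x)"
    and "norm (LBINT x:{a..b}. h x * l2_rep f x) \<le> K * sqrt (b - a) * norm f"
proof -
  define H where "H x = indicator {a..b} x *\<^sub>R h x" for x
  have Hi: "integrable lborel H"
    using borel_integrable_compact[OF compact_Icc h(1)] by (simp add: H_def[abs_def])
  have ki: "integrable lborel (\<lambda>x. K\<^sup>2 * indicator {a..b} x :: real)"
    using borel_integrable_compact[OF compact_Icc[of a b] continuous_on_const[of _ "1::real"]]
    by (intro integrable_mult_right) simp
  have HK: "(norm (H x))\<^sup>2 \<le> K\<^sup>2 * indicator {a..b} x" for x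
    using power_mono[OF h(2)[of x], of 2] by (auto simp: H_def split: split_indicator)
  have H: "square_integrable H"
    unfolding square_integrable_def
    using Hi by (intro conjI Bochner_Integration.integrable_bound[OF ki]) (use HK in auto)
  have nH: "sqrt (LBINT x. (norm (H x))\<^sup>2) \<le> K * sqrt (b - a)"
  proof -
    have "(LBINT x. (norm (H x))\<^sup>2) \<le> (LBINT x. K\<^sup>2 * indicator {a..b} x)"
      using H by (intro integral_mono ki HK) (simp add: square_integrable_def)
    also have "\<dots> = K\<^sup>2 * (b - a)" using ab by simp
    finally have "sqrt (LBINT x. (norm (H x))\<^sup>2) \<le> sqrt (K\<^sup>2 * (b - a))" by (rule real_sqrt_le_mono)
    then show ?thesis using \<open>K \<ge> 0\<close> by (simp add: real_sqrt_mult)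
  qed
  have eq: "indicator {a..b} x *\<^sub>R (h x * l2_rep f x) = H x * l2_rep f x" for x
    by (simp add: H_def)
  note CS = l2_Cauchy_Schwarz[OF H square_integrable_l2_rep[of f]]
  show "set_integrable lborel {a..b} (\<lambda>x. h x * l2_rep f x)"
    unfolding set_integrable_def eq by (rule CS(1))
  have "norm (LBINT x:{a..b}. h x * l2_rep f x) \<le> (LBINT x. norm (H x * l2_rep f x))"
    unfolding set_lebesgue_integral_def eq by (rule integral_norm_bound)
  also have "\<dots> \<le> K * sqrt (b - a) * norm f"
    by (rule order_trans[OF CS(2)]) (use nH in \<open>auto simp: norm_l2_eq[symmetric] intro!: mult_right_mono\<close>)
  finally show "norm (LBINT x:{a..b}. h x * l2_rep f x) \<le> K * sqrt (b - a) * norm f" .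
qed

section \<open>The transfer matrix of the squeezed potential\<close>

lemma norm_le_of_sum_squares_le:
  fixes a b :: complex and N N1 R C :: real
  assumes "(norm a)\<^sup>2 + (norm b)\<^sup>2 \<le> C\<^sup>2 * (N\<^sup>2 + N1\<^sup>2 + 2 * R\<^sup>2)" "C \<ge> 0" "N \<ge> 0" "N1 \<ge> 0" "R \<ge> 0"
  shows "norm a \<le> C * (N + N1 + 2 * R)" "norm b \<le> C * (N + N1 + 2 * R)"
proof -
  have "N\<^sup>2 + N1\<^sup>2 + 2 * R\<^sup>2 \<le> (N + N1 + 2 * R)\<^sup>2"
    using assms(3-5) by (simp add: power2_sum power_mult_distrib)
  then have "C\<^sup>2 * (N\<^sup>2 + N1\<^sup>2 + 2 * R\<^sup>2) \<le> (C * (N + N1 + 2 * R))\<^sup>2"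
    by (simp add: power_mult_distrib mult_left_mono)
  then have "(norm a)\<^sup>2 + (norm b)\<^sup>2 \<le> (C * (N + N1 + 2 * R))\<^sup>2" using assms(1) by linarith
  then have "(norm a)\<^sup>2 \<le> (C * (N + N1 + 2 * R))\<^sup>2" "(norm b)\<^sup>2 \<le> (C * (N + N1 + 2 * R))\<^sup>2"
    by (smt (verit) zero_le_power2)+
  then show "norm a \<le> C * (N + N1 + 2 * R)" "norm b \<le> C * (N + N1 + 2 * R)"
    using assms by (auto intro!: power2_le_imp_le)
qed

text \<open>The condition \<open>Re k \<noteq> 0\<close> expresses that \<open>k\<^sup>2\<close> is not real.\<close>

locale squeezed_potential =
  fixes \<Psi> :: "real \<Rightarrow> real" and \<alpha> :: real and k :: complex and M :: real
  assumes \<Psi>_cont: "continuous_on UNIV \<Psi>" and \<Psi>_supp: "\<And>x. \<bar>x\<bar> \<ge> 1 \<Longrightarrow> \<Psi> x = 0"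
    and \<Psi>_bound: "\<And>x. \<bar>\<Psi> x\<bar> \<le> M" and Im_k: "Im k > 0" and Re_k: "Re k \<noteq> 0"
begin

text \<open>The coefficient of the equation in the variable \<open>\<xi> = x / \<epsilon>\<close>, that is \<open>\<epsilon>\<^sup>2\<close> times the potential minus
  \<open>\<epsilon>\<^sup>2 * z\<close>.\<close>

definition q :: "real \<Rightarrow> real \<Rightarrow> complex" where
  "q \<epsilon> \<xi> = of_real (\<alpha> * \<Psi> \<xi>) - of_real (\<epsilon>\<^sup>2) * k\<^sup>2"

lemma q_cont: "continuous_on A (q \<epsilon>)"
  unfolding q_def[abs_def] by (intro continuous_intros continuous_on_subset[OF \<Psi>_cont]) auto

lemma M_nonneg: "M \<ge> 0"
  using \<Psi>_bound[of 0] by linarith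

lemma q_bound: "norm (q \<epsilon> \<xi>) \<le> \<bar>\<alpha>\<bar> * M + \<epsilon>\<^sup>2 * (norm k)\<^sup>2"
proof -
  have "norm (q \<epsilon> \<xi>) \<le> \<bar>\<alpha> * \<Psi> \<xi>\<bar> + norm (of_real (\<epsilon>\<^sup>2) * k\<^sup>2)"
    unfolding q_def by (rule order_trans[OF norm_triangle_ineq4]) (simp add: norm_mult abs_mult)
  also have "\<dots> \<le> \<bar>\<alpha>\<bar> * M + \<epsilon>\<^sup>2 * (norm k)\<^sup>2"
    unfolding abs_mult norm_mult norm_power norm_of_real
    by (intro add_mono mult_left_mono \<Psi>_bound) auto
  finally show ?thesis .
qed

text \<open>The square root of the exponential factor in the Gronwall estimates for the coefficient \<open>q\<close>.\<close>

definition growth :: "real \<Rightarrow> real" where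
  "growth \<epsilon> = exp (2 + (\<bar>\<alpha>\<bar> * M + \<epsilon>\<^sup>2 * (norm k)\<^sup>2))"

lemma growth_pos: "growth \<epsilon> > 0" by (simp add: growth_def)

lemma growth_tendsto: "(growth \<longlongrightarrow> growth 0) (at_right 0)"
proof -
  have "isCont growth 0" unfolding growth_def[abs_def] by (intro continuous_intros)
  then show ?thesis by (auto simp: continuous_at intro: tendsto_within_subset)
qed

lemma exp_growth: "exp (2 * (2 + (\<bar>\<alpha>\<bar> * M + \<epsilon>\<^sup>2 * (norm k)\<^sup>2))) = (growth \<epsilon>)\<^sup>2"
  by (simp add: growth_def power2_eq_square mult_exp_exp)

lemma inner_bound_initial:
  assumes "solves (q \<epsilon>) r w w1" "\<And>x. x \<in> {-1..1} \<Longrightarrow> norm (r x) \<le> R" "x \<in> {-1..1}"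
  shows "norm (w x) \<le> growth \<epsilon> * (norm (w (-1)) + norm (w1 (-1)) + 2 * R)"
proof (rule norm_le_of_sum_squares_le(1))
  show "(norm (w x))\<^sup>2 + (norm (w1 x))\<^sup>2 \<le> (growth \<epsilon>)\<^sup>2 * ((norm (w (-1)))\<^sup>2 + (norm (w1 (-1)))\<^sup>2 + 2 * R\<^sup>2)"
    using solves_bound_initial[OF assms(1) q_bound assms(2,3)] unfolding exp_growth .
  show "R \<ge> 0" using order_trans[OF norm_ge_zero assms(2)[of 0]] by simp
qed (use growth_pos[of \<epsilon>] in auto)

lemma inner_bound_terminal:
  assumes "solves (q \<epsilon>) r w w1" "\<And>x. x \<in> {-1..1} \<Longrightarrow> norm (r x) \<le> R" "x \<in> {-1..1}"
  shows "norm (w x) \<le> growth \<epsilon> * (norm (w 1) + norm (w1 1) + 2 * R)"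
    and "norm (w1 x) \<le> growth \<epsilon> * (norm (w 1) + norm (w1 1) + 2 * R)"
proof -
  have *: "(norm (w x))\<^sup>2 + (norm (w1 x))\<^sup>2 \<le> (growth \<epsilon>)\<^sup>2 * ((norm (w 1))\<^sup>2 + (norm (w1 1))\<^sup>2 + 2 * R\<^sup>2)"
    using solves_bound_terminal[OF assms(1) q_bound assms(2,3)] unfolding exp_growth .
  have R: "R \<ge> 0" using order_trans[OF norm_ge_zero assms(2)[of 0]] by simp
  show "norm (w x) \<le> growth \<epsilon> * (norm (w 1) + norm (w1 1) + 2 * R)"
    "norm (w1 x) \<le> growth \<epsilon> * (norm (w 1) + norm (w1 1) + 2 * R)"
    by (rule norm_le_of_sum_squares_le[OF *]; use growth_pos[of \<epsilon>] R in simp)+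
qed

text \<open>\<open>H0\<close> and \<open>H1\<close> are the solutions of the rescaled homogeneous equation with terminal data
  \<open>(1, 0)\<close> and \<open>(0, 1)\<close>; their values at \<open>-1\<close> give the matrix that transports Cauchy data from \<open>-1\<close>
  to \<open>1\<close>.\<close>

definition H0 :: "real \<Rightarrow> (real \<Rightarrow> complex) \<times> (real \<Rightarrow> complex)" where
  "H0 \<epsilon> = (SOME p. solves (q \<epsilon>) (\<lambda>x. 0) (fst p) (snd p) \<and> fst p 1 = 1 \<and> snd p 1 = 0)"

definition H1 :: "real \<Rightarrow> (real \<Rightarrow> complex) \<times> (real \<Rightarrow> complex)" where
  "H1 \<epsilon> = (SOME p. solves (q \<epsilon>) (\<lambda>x. 0) (fst p) (snd p) \<and> fst p 1 = 0 \<and> snd p 1 = 1)"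

lemma H0: "solves (q \<epsilon>) (\<lambda>x. 0) (fst (H0 \<epsilon>)) (snd (H0 \<epsilon>))" "fst (H0 \<epsilon>) 1 = 1" "snd (H0 \<epsilon>) 1 = 0"
proof -
  obtain w w1 where "solves (q \<epsilon>) (\<lambda>x. 0) w w1 \<and> w 1 = 1 \<and> w1 1 = 0"
    using solves_exists_terminal[OF q_cont continuous_on_const] by blast
  then have "\<exists>p. solves (q \<epsilon>) (\<lambda>x. 0) (fst p) (snd p) \<and> fst p 1 = 1 \<and> snd p 1 = 0"
    by (intro exI[of _ "(w, w1)"]) simp
  from someI_ex[OF this, folded H0_def]
  show "solves (q \<epsilon>) (\<lambda>x. 0) (fst (H0 \<epsilon>)) (snd (H0 \<epsilon>))" "fst (H0 \<epsilon>) 1 = 1" "snd (H0 \<epsilon>) 1 = 0" by auto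
qed

lemma H1: "solves (q \<epsilon>) (\<lambda>x. 0) (fst (H1 \<epsilon>)) (snd (H1 \<epsilon>))" "fst (H1 \<epsilon>) 1 = 0" "snd (H1 \<epsilon>) 1 = 1"
proof -
  obtain w w1 where "solves (q \<epsilon>) (\<lambda>x. 0) w w1 \<and> w 1 = 0 \<and> w1 1 = 1"
    using solves_exists_terminal[OF q_cont continuous_on_const] by blast
  then have "\<exists>p. solves (q \<epsilon>) (\<lambda>x. 0) (fst p) (snd p) \<and> fst p 1 = 0 \<and> snd p 1 = 1"
    by (intro exI[of _ "(w, w1)"]) simp
  from someI_ex[OF this, folded H1_def]
  show "solves (q \<epsilon>) (\<lambda>x. 0) (fst (H1 \<epsilon>)) (snd (H1 \<epsilon>))" "fst (H1 \<epsilon>) 1 = 0" "snd (H1 \<epsilon>) 1 = 1" by auto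
qed

definition t11 where "t11 \<epsilon> = snd (H1 \<epsilon>) (-1)"
definition t12 where "t12 \<epsilon> = - fst (H1 \<epsilon>) (-1)"
definition t21 where "t21 \<epsilon> = - snd (H0 \<epsilon>) (-1)"
definition t22 where "t22 \<epsilon> = fst (H0 \<epsilon>) (-1)"

text \<open>The Wronskian of \<open>H0\<close> and \<open>H1\<close> is constant, with value \<open>-1\<close> at the right end point.\<close>

lemma transfer_det: "t11 \<epsilon> * t22 \<epsilon> - t12 \<epsilon> * t21 \<epsilon> = 1"
  using solves_wronskian_constant[OF H0(1) H1(1), of "-1" \<epsilon>] H0(2,3)[of \<epsilon>] H1(2,3)[of \<epsilon>]
  by (simp add: t11_def t12_def t21_def t22_def algebra_simps)

text \<open>The difference of two solutions with the same terminal data solves the equation with source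
  \<open>- \<epsilon>\<^sup>2 * k\<^sup>2 * v\<close> and zero terminal data.\<close>

lemma inner_perturbation:
  assumes w: "solves (q \<epsilon>) (\<lambda>x. 0) w w1" and v: "solves (q 0) (\<lambda>x. 0) v v1"
    and eq: "w 1 = v 1" "w1 1 = v1 1" and b: "norm (v 1) + norm (v1 1) \<le> 1"
  shows "norm (w (-1) - v (-1)) \<le> 2 * growth \<epsilon> * growth 0 * (norm k)\<^sup>2 * \<epsilon>\<^sup>2"
    and "norm (w1 (-1) - v1 (-1)) \<le> 2 * growth \<epsilon> * growth 0 * (norm k)\<^sup>2 * \<epsilon>\<^sup>2"
proof -
  have v': "norm (v x) \<le> growth 0" if "x \<in> {-1..1}" for x
  proof -
    have "norm (v x) \<le> growth 0 * (norm (v 1) + norm (v1 1) + 2 * 0)"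
      by (rule inner_bound_terminal(1)[OF v _ that]) simp
    also have "\<dots> \<le> growth 0 * 1" using b growth_pos[of 0] by (intro mult_left_mono) auto
    finally show ?thesis by simp
  qed
  have r: "norm ((q \<epsilon> x - q 0 x) * v x + 0) \<le> growth 0 * (norm k)\<^sup>2 * \<epsilon>\<^sup>2" if "x \<in> {-1..1}" for x
  proof -
    have "norm ((q \<epsilon> x - q 0 x) * v x + 0) = (\<epsilon>\<^sup>2 * (norm k)\<^sup>2) * norm (v x)"
      by (simp add: q_def norm_mult norm_power)
    also have "\<dots> \<le> (\<epsilon>\<^sup>2 * (norm k)\<^sup>2) * growth 0" by (intro mult_left_mono v' that) auto
    finally show ?thesis by (simp add: mult_ac)
  qed
  note B = inner_bound_terminal[OF solves_diff[OF w v] r, of "-1"]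
  show "norm (w (-1) - v (-1)) \<le> 2 * growth \<epsilon> * growth 0 * (norm k)\<^sup>2 * \<epsilon>\<^sup>2"
    "norm (w1 (-1) - v1 (-1)) \<le> 2 * growth \<epsilon> * growth 0 * (norm k)\<^sup>2 * \<epsilon>\<^sup>2"
    using B by (auto simp: eq mult_ac)
qed

definition transfer_error where "transfer_error \<epsilon> = 2 * growth \<epsilon> * growth 0 * (norm k)\<^sup>2 * \<epsilon>\<^sup>2"

lemma transfer_perturbation:
  "norm (t11 \<epsilon> - t11 0) \<le> transfer_error \<epsilon>" "norm (t12 \<epsilon> - t12 0) \<le> transfer_error \<epsilon>"
  "norm (t21 \<epsilon> - t21 0) \<le> transfer_error \<epsilon>" "norm (t22 \<epsilon> - t22 0) \<le> transfer_error \<epsilon>"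
  using inner_perturbation[OF H0(1) H0(1), of \<epsilon>] inner_perturbation[OF H1(1) H1(1), of \<epsilon>]
    H0(2,3) H1(2,3)
  by (simp_all add: t11_def t12_def t21_def t22_def transfer_error_def norm_minus_commute)

lemma transfer_error_tendsto: "((\<lambda>\<epsilon>. transfer_error \<epsilon> / \<epsilon>) \<longlongrightarrow> 0) (at_right 0)" "(transfer_error \<longlongrightarrow> 0) (at_right 0)"
proof -
  have id: "((\<lambda>\<epsilon>. \<epsilon>) \<longlongrightarrow> (0::real)) (at_right 0)" by (rule tendsto_ident_at)
  have "((\<lambda>\<epsilon>. 2 * growth \<epsilon> * growth 0 * (norm k)\<^sup>2 * \<epsilon>) \<longlongrightarrow> 2 * growth 0 * growth 0 * (norm k)\<^sup>2 * 0) (at_right 0)"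
    by (intro tendsto_intros growth_tendsto id)
  moreover have "\<forall>\<^sub>F \<epsilon> in at_right 0. 2 * growth \<epsilon> * growth 0 * (norm k)\<^sup>2 * \<epsilon> = transfer_error \<epsilon> / \<epsilon>"
    by (rule eventually_at_rightI[of 0 1]) (auto simp: transfer_error_def power2_eq_square)
  ultimately show "((\<lambda>\<epsilon>. transfer_error \<epsilon> / \<epsilon>) \<longlongrightarrow> 0) (at_right 0)" by (simp add: tendsto_cong)
  have "((\<lambda>\<epsilon>. 2 * growth \<epsilon> * growth 0 * (norm k)\<^sup>2 * \<epsilon>\<^sup>2) \<longlongrightarrow> 2 * growth 0 * growth 0 * (norm k)\<^sup>2 * 0\<^sup>2) (at_right 0)"
    by (intro tendsto_intros growth_tendsto id)
  then show "(transfer_error \<longlongrightarrow> 0) (at_right 0)" by (simp add: transfer_error_def[abs_def])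
qed

lemma transfer_tendsto:
  "(t11 \<longlongrightarrow> t11 0) (at_right 0)" "(t12 \<longlongrightarrow> t12 0) (at_right 0)"
  "(t21 \<longlongrightarrow> t21 0) (at_right 0)" "(t22 \<longlongrightarrow> t22 0) (at_right 0)"
  by (rule LIM_zero_cancel, rule Lim_null_comparison[OF always_eventually transfer_error_tendsto(2)],
      use transfer_perturbation in blast)+

definition \<Delta> where
  "\<Delta> \<epsilon> = t21 \<epsilon> - \<i> * k * of_real \<epsilon> * (t11 \<epsilon> + t22 \<epsilon>) - k\<^sup>2 * (of_real \<epsilon>)\<^sup>2 * t12 \<epsilon>"

text \<open>If \<open>\<Delta> \<epsilon>\<close> vanished, some inner solution would continue to an outgoing wave on both sides.
  The flux \<open>Im (cnj u * u')\<close> of such a solution would increase across the interval when multiplied by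
  \<open>Re k\<close>, whereas \<open>Im (k ^ 2)\<close> makes it decrease.\<close>

lemma \<Delta>_nonzero:
  assumes "\<epsilon> > 0"
  shows "\<Delta> \<epsilon> \<noteq> 0"
proof
  assume D: "\<Delta> \<epsilon> = 0"
  define u where "u x = fst (H0 \<epsilon>) x + \<i> * k * of_real \<epsilon> * fst (H1 \<epsilon>) x" for x
  define u1 where "u1 x = snd (H0 \<epsilon>) x + \<i> * k * of_real \<epsilon> * snd (H1 \<epsilon>) x" for x
  have s: "(u has_vector_derivative u1 x) (at x within {-1..1})"
    "(u1 has_vector_derivative q \<epsilon> x * u x) (at x within {-1..1})" if "x \<in> {-1..1}" for x
  proof -
    have d: "(fst (H0 \<epsilon>) has_vector_derivative snd (H0 \<epsilon>) x) (at x within {-1..1})"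
      "(snd (H0 \<epsilon>) has_vector_derivative q \<epsilon> x * fst (H0 \<epsilon>) x) (at x within {-1..1})"
      "(fst (H1 \<epsilon>) has_vector_derivative snd (H1 \<epsilon>) x) (at x within {-1..1})"
      "(snd (H1 \<epsilon>) has_vector_derivative q \<epsilon> x * fst (H1 \<epsilon>) x) (at x within {-1..1})"
      using bspec[OF H0(1)[unfolded solves_def] that] bspec[OF H1(1)[unfolded solves_def] that] by auto
    show "(u has_vector_derivative u1 x) (at x within {-1..1})"
      unfolding u_def[abs_def] u1_def by (auto intro!: derivative_eq_intros d)
    show "(u1 has_vector_derivative q \<epsilon> x * u x) (at x within {-1..1})"
      unfolding u1_def[abs_def] u_def by (auto intro!: derivative_eq_intros d simp: algebra_simps)
  qed
  define j where "j x = Re k * Im (cnj (u x) * u1 x)" for x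
  have dj: "(j has_real_derivative - 2 * \<epsilon>\<^sup>2 * (Re k)\<^sup>2 * Im k * (norm (u x))\<^sup>2) (at x within {-1..1})" if "x \<in> {-1..1}" for x
  proof -
    have "((\<lambda>x. cnj (u x) * u1 x) has_vector_derivative cnj (u x) * (q \<epsilon> x * u x) + cnj (u1 x) * u1 x) (at x within {-1..1})"
      by (rule bounded_bilinear.has_vector_derivative[OF bounded_bilinear_mult
            has_vector_derivative_cnj[OF s(1)[OF that]] s(2)[OF that]])
    from bounded_linear.has_vector_derivative[OF bounded_linear_Im this]
    have "((\<lambda>x. Im (cnj (u x) * u1 x)) has_real_derivative Im (cnj (u x) * (q \<epsilon> x * u x) + cnj (u1 x) * u1 x)) (at x within {-1..1})"
      by (simp add: has_real_derivative_iff_has_vector_derivative)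
    from DERIV_cmult[OF this, of "Re k"]
    have "(j has_real_derivative Re k * Im (cnj (u x) * (q \<epsilon> x * u x) + cnj (u1 x) * u1 x)) (at x within {-1..1})"
      unfolding j_def[abs_def] .
    moreover have "Im (cnj (u x) * (q \<epsilon> x * u x) + cnj (u1 x) * u1 x) = - 2 * \<epsilon>\<^sup>2 * Re k * Im k * (norm (u x))\<^sup>2"
      unfolding q_def cmod_power2 by (simp add: power2_eq_square algebra_simps)
    ultimately show ?thesis by (simp add: power2_eq_square mult_ac)
  qed
  have cj: "continuous_on {-1..1} j"
    unfolding continuous_on_eq_continuous_within using dj DERIV_continuous by blast
  have "j 1 \<le> j (-1)"
  proof (rule DERIV_nonpos_imp_decreasing_open[OF _ _ cj])
    fix x :: real assume x: "-1 < x" "x < 1"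
    have "(j has_real_derivative - 2 * \<epsilon>\<^sup>2 * (Re k)\<^sup>2 * Im k * (norm (u x))\<^sup>2) (at x)"
      using dj[of x] x by (simp add: at_within_Icc_at)
    moreover have "- 2 * \<epsilon>\<^sup>2 * (Re k)\<^sup>2 * Im k * (norm (u x))\<^sup>2 \<le> 0"
      using Im_k by (simp add: mult_nonneg_nonneg)
    ultimately show "\<exists>y. (j has_real_derivative y) (at x) \<and> y \<le> 0" by blast
  qed simp
  have one: "u 1 = 1" "u1 1 = \<i> * k * of_real \<epsilon>"
    by (simp_all add: u_def u1_def H0 H1)
  have "\<Delta> \<epsilon> = - \<i> * k * of_real \<epsilon> * u (-1) - u1 (-1)"
    by (simp add: \<Delta>_def u_def u1_def t11_def t12_def t21_def t22_def power2_eq_square algebra_simps)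
  then have m: "u1 (-1) = - \<i> * k * of_real \<epsilon> * u (-1)" using D by simp
  have "j 1 = \<epsilon> * (Re k)\<^sup>2"
    by (simp add: j_def one power2_eq_square)
  moreover have "j (-1) = - \<epsilon> * (Re k)\<^sup>2 * (norm (u (-1)))\<^sup>2"
    unfolding j_def m cmod_power2 by (simp add: power2_eq_square algebra_simps)
  ultimately have "\<epsilon> * (Re k)\<^sup>2 \<le> - (\<epsilon> * (Re k)\<^sup>2 * (norm (u (-1)))\<^sup>2)" using \<open>j 1 \<le> j (-1)\<close> by simp
  moreover have "0 \<le> \<epsilon> * (Re k)\<^sup>2 * (norm (u (-1)))\<^sup>2" using assms by simp
  moreover have "0 < \<epsilon> * (Re k)\<^sup>2" using assms Re_k by simp
  ultimately show False by linarith
qed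

end

section \<open>Matching the free resolvent across the squeezed potential\<close>

text \<open>Back to the variable \<open>x\<close>: every derivative costs a factor \<open>1 / \<epsilon>\<close>.\<close>

lemma solves_scaled:
  assumes s: "solves Q r w w1" and c: "continuous_on {-1..1} Q" "continuous_on {-1..1} r" and "\<epsilon> > 0"
  shows "primitive_on {-\<epsilon>..\<epsilon>} (\<lambda>x. w (x / \<epsilon>)) (\<lambda>x. w1 (x / \<epsilon>) / of_real \<epsilon>)"
    and "primitive_on {-\<epsilon>..\<epsilon>} (\<lambda>x. w1 (x / \<epsilon>) / of_real \<epsilon>)
      (\<lambda>x. (Q (x / \<epsilon>) * w (x / \<epsilon>) + r (x / \<epsilon>)) / (of_real \<epsilon>)\<^sup>2)"
proof -
  have im: "(\<lambda>x. x / \<epsilon>) ` {-\<epsilon>..\<epsilon>} \<subseteq> {-1..1}"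
    using \<open>\<epsilon> > 0\<close> by (auto simp: field_simps)
  have sc: "continuous_on {-\<epsilon>..\<epsilon>} (\<lambda>x. x / \<epsilon>)"
    using \<open>\<epsilon> > 0\<close> by (intro continuous_intros) auto
  have comp: "continuous_on {-\<epsilon>..\<epsilon>} (\<lambda>x. g (x / \<epsilon>))" if "continuous_on {-1..1} g" for g :: "real \<Rightarrow> complex"
    by (rule continuous_on_compose2[OF that sc im])
  have d: "((\<lambda>x. g (x / \<epsilon>)) has_vector_derivative g' / of_real \<epsilon>) (at x within {-\<epsilon>..\<epsilon>})"
    if "(g has_vector_derivative g') (at (x / \<epsilon>) within {-1..1})" for g :: "real \<Rightarrow> complex" and g' x
  proof -
    have "((\<lambda>x. x / \<epsilon>) has_vector_derivative (1 / \<epsilon>)) (at x within {-\<epsilon>..\<epsilon>})"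
      unfolding has_real_derivative_iff_has_vector_derivative[symmetric]
      using \<open>\<epsilon> > 0\<close> by (auto intro!: derivative_eq_intros)
    from vector_diff_chain_within[OF this has_vector_derivative_within_subset[OF that im]]
    show ?thesis by (simp add: o_def scaleR_conv_of_real)
  qed
  have "x / \<epsilon> \<in> {-1..1}" if "x \<in> {-\<epsilon>..\<epsilon>}" for x using im that by blast
  note sd = bspec[OF s[unfolded solves_def] this]
  show "primitive_on {-\<epsilon>..\<epsilon>} (\<lambda>x. w (x / \<epsilon>)) (\<lambda>x. w1 (x / \<epsilon>) / of_real \<epsilon>)"
  proof (rule primitive_on_derivative)
    show "continuous_on {-\<epsilon>..\<epsilon>} (\<lambda>x. w1 (x / \<epsilon>) / of_real \<epsilon>)"
      using \<open>\<epsilon> > 0\<close> by (intro continuous_intros comp solves_continuous[OF s]) auto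
  qed (use sd d in \<open>auto simp: is_interval_cc\<close>)
  show "primitive_on {-\<epsilon>..\<epsilon>} (\<lambda>x. w1 (x / \<epsilon>) / of_real \<epsilon>)
      (\<lambda>x. (Q (x / \<epsilon>) * w (x / \<epsilon>) + r (x / \<epsilon>)) / (of_real \<epsilon>)\<^sup>2)"
  proof (rule primitive_on_derivative)
    show "continuous_on {-\<epsilon>..\<epsilon>} (\<lambda>x. (Q (x / \<epsilon>) * w (x / \<epsilon>) + r (x / \<epsilon>)) / (of_real \<epsilon>)\<^sup>2)"
      using \<open>\<epsilon> > 0\<close> by (intro continuous_intros comp solves_continuous[OF s] c) auto
    fix x assume x: "x \<in> {-\<epsilon>..\<epsilon>}"
    have "((\<lambda>x. w1 (x / \<epsilon>)) has_vector_derivative (Q (x / \<epsilon>) * w (x / \<epsilon>) + r (x / \<epsilon>)) / of_real \<epsilon>) (at x within {-\<epsilon>..\<epsilon>})"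
      using sd[OF x] by (intro d) blast
    from has_vector_derivative_divide[OF this, of "of_real \<epsilon>"]
    show "((\<lambda>x. w1 (x / \<epsilon>) / of_real \<epsilon>) has_vector_derivative (Q (x / \<epsilon>) * w (x / \<epsilon>) + r (x / \<epsilon>)) / (of_real \<epsilon>)\<^sup>2) (at x within {-\<epsilon>..\<epsilon>})"
      by (simp add: power2_eq_square)
  qed (simp add: is_interval_cc)
qed

lemma primitive_increment_bound:
  assumes F: "primitive_on UNIV F f" and c: "continuous_on UNIV f" and B: "\<And>x. norm (f x) \<le> B" and "a \<le> b"
  shows "norm (F b - F a) \<le> B * (b - a)"
proof -
  have c': "continuous_on {a..b} f" using c continuous_on_subset by blast
  have "F b - F a = integral {a..b} f"
    using primitive_onD[OF F, of a b] \<open>a \<le> b\<close> by (simp add: set_borel_integral_eq_integral(2))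
  then show ?thesis using integral_bound[OF \<open>a \<le> b\<close> c'] B by simp
qed

lemma square_integrable_exp_abs:
  assumes "c > 0"
  shows "square_integrable (\<lambda>x. complex_of_real (exp (- c * \<bar>x\<bar>)))"
    and "(LBINT x::real. (exp (- c * \<bar>x\<bar>))\<^sup>2) = (LBINT x::real. exp (- (2 * c) * \<bar>x\<bar>))"
    and "integrable lborel (\<lambda>x::real. (exp (- c * \<bar>x\<bar>))\<^sup>2)"
proof -
  have e: "(exp (- c * \<bar>x\<bar>))\<^sup>2 = exp (- (2 * c) * \<bar>x\<bar>)" for x :: real
    by (simp add: power2_eq_square mult_exp_exp)
  show i: "integrable lborel (\<lambda>x::real. (exp (- c * \<bar>x\<bar>))\<^sup>2)"
    unfolding e using integrable_exp_abs[of "2 * c" 0] assms by simp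
  then show "square_integrable (\<lambda>x. complex_of_real (exp (- c * \<bar>x\<bar>)))"
    unfolding square_integrable_def norm_of_real abs_exp_cancel by auto
  show "(LBINT x::real. (exp (- c * \<bar>x\<bar>))\<^sup>2) = (LBINT x::real. exp (- (2 * c) * \<bar>x\<bar>))"
    unfolding e ..
qed

text \<open>The functions \<open>G f\<close> and \<open>G1 f\<close> stand for the free resolvent of \<open>f\<close> and its derivative.\<close>

locale squeezed_resolvent = squeezed_potential +
  fixes G G1 :: "l2 \<Rightarrow> real \<Rightarrow> complex" and C :: real
  assumes G: "\<And>f. primitive_on UNIV (G f) (G1 f)"
    and G1: "\<And>f. primitive_on UNIV (G1 f) (\<lambda>x. - k\<^sup>2 * G f x - l2_rep f x)"
    and G_sq: "\<And>f. square_integrable (G f)" "\<And>f. square_integrable (G1 f)"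
    and G_norm: "\<And>f. norm (l2_class (G f)) \<le> C * norm f"
    and G_bound: "\<And>f x. norm (G f x) \<le> C * norm f" "\<And>f x. norm (G1 f x) \<le> C * norm f"
    and C_nonneg: "C \<ge> 0"
begin

lemma G_cont: "continuous_on A (G f)" "continuous_on A (G1 f)"
  using continuous_on_primitive_UNIV[OF G] continuous_on_primitive_UNIV[OF G1] continuous_on_subset by blast+

lemma G_increment: "a \<le> b \<Longrightarrow> norm (G f b - G f a) \<le> C * (b - a) * norm f"
  using primitive_increment_bound[OF G G_cont(2) G_bound(2)] by (simp add: mult_ac)

lemma G1_increment:
  assumes "a \<le> b"
  shows "norm (G1 f b - G1 f a) \<le> ((norm k)\<^sup>2 * C * (b - a) + sqrt (b - a)) * norm f"
proof -
  note B1 = integral_Icc_bound[OF continuous_on_const, of a b 1 1 f, simplified]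
  have i: "set_integrable lborel {a..b} (\<lambda>x. - k\<^sup>2 * G f x)"
    by (intro borel_integrable_atLeastAtMost' continuous_intros G_cont)
  have "G1 f b - G1 f a = (LBINT x:{a..b}. - k\<^sup>2 * G f x) - (LBINT x:{a..b}. l2_rep f x)"
    unfolding primitive_onD(2)[OF G1 UNIV_I UNIV_I assms]
    by (rule set_integral_diff(2)[OF i l2_rep_set_integrable])
  then have "norm (G1 f b - G1 f a) \<le> norm (LBINT x:{a..b}. - k\<^sup>2 * G f x) + norm (LBINT x:{a..b}. l2_rep f x)"
    by (metis norm_triangle_ineq4)
  also have "(LBINT x:{a..b}. - k\<^sup>2 * G f x) = integral {a..b} (\<lambda>x. - k\<^sup>2 * G f x)"
    by (rule set_borel_integral_eq_integral(2)[OF i])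
  also have "norm (integral {a..b} (\<lambda>x. - k\<^sup>2 * G f x)) \<le> ((norm k)\<^sup>2 * (C * norm f)) * (b - a)"
    by (rule integral_bound[OF assms])
       (use G_bound(1) in \<open>auto intro!: continuous_intros G_cont mult_left_mono simp: norm_mult norm_power\<close>)
  also have "norm (LBINT x:{a..b}. l2_rep f x) \<le> sqrt (b - a) * norm f"
    using B1(2) assms by simp
  finally show ?thesis by (simp add: algebra_simps)
qed

text \<open>By \<open>G_increment\<close> and \<open>G1_increment\<close> the values at \<open>\<epsilon>\<close> and \<open>- \<epsilon>\<close> differ from those at \<open>0\<close> by
  \<open>O (\<epsilon>)\<close> and \<open>O (sqrt \<epsilon>)\<close> times the norm of \<open>f\<close>.\<close>

lemma functional_tendsto_boundary:
  "functional_tendsto (\<lambda>\<epsilon> f. G f \<epsilon>) (\<lambda>f. G f 0)" "functional_tendsto (\<lambda>\<epsilon> f. G f (- \<epsilon>)) (\<lambda>f. G f 0)"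
  "functional_tendsto (\<lambda>\<epsilon> f. G1 f \<epsilon>) (\<lambda>f. G1 f 0)" "functional_tendsto (\<lambda>\<epsilon> f. G1 f (- \<epsilon>)) (\<lambda>f. G1 f 0)"
proof -
  have id: "((\<lambda>\<epsilon>. \<epsilon>) \<longlongrightarrow> (0::real)) (at_right 0)" by (rule tendsto_ident_at)
  have t0: "((\<lambda>\<epsilon>. C * \<epsilon>) \<longlongrightarrow> 0) (at_right 0)"
    using tendsto_mult_left[OF id, of C] by simp
  have t1: "((\<lambda>\<epsilon>. (norm k)\<^sup>2 * C * \<epsilon> + sqrt \<epsilon>) \<longlongrightarrow> 0) (at_right 0)"
    using tendsto_add[OF tendsto_mult_left[OF id, of "(norm k)\<^sup>2 * C"] tendsto_real_sqrt[OF id]] by simp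
  show "functional_tendsto (\<lambda>\<epsilon> f. G f \<epsilon>) (\<lambda>f. G f 0)"
    by (rule functional_tendstoI[OF G_bound(1) t0]) (use G_increment[of 0] in simp)
  show "functional_tendsto (\<lambda>\<epsilon> f. G f (- \<epsilon>)) (\<lambda>f. G f 0)"
    by (rule functional_tendstoI[OF G_bound(1) t0]) (use G_increment[of "- _" 0] in \<open>simp add: norm_minus_commute\<close>)
  show "functional_tendsto (\<lambda>\<epsilon> f. G1 f \<epsilon>) (\<lambda>f. G1 f 0)"
    by (rule functional_tendstoI[OF G_bound(2) t1]) (use G1_increment[of 0] in simp)
  show "functional_tendsto (\<lambda>\<epsilon> f. G1 f (- \<epsilon>)) (\<lambda>f. G1 f 0)"
    by (rule functional_tendstoI[OF G_bound(2) t1]) (use G1_increment[of "- _" 0] in \<open>simp add: norm_minus_commute\<close>)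
qed

definition remainder0 where "remainder0 \<epsilon> f = (LBINT x:{-\<epsilon>..\<epsilon>}. fst (H0 \<epsilon>) (x / \<epsilon>) * l2_rep f x)"
definition remainder1 where "remainder1 \<epsilon> f = (LBINT x:{-\<epsilon>..\<epsilon>}. fst (H1 \<epsilon>) (x / \<epsilon>) * l2_rep f x)"

lemma functional_tendsto_remainder:
  "functional_tendsto remainder0 (\<lambda>f. 0)" "functional_tendsto remainder1 (\<lambda>f. 0)"
proof -
  have id: "((\<lambda>\<epsilon>. \<epsilon>) \<longlongrightarrow> (0::real)) (at_right 0)" by (rule tendsto_ident_at)
  have t: "((\<lambda>\<epsilon>. growth \<epsilon> * sqrt (2 * \<epsilon>)) \<longlongrightarrow> 0) (at_right 0)"
    using tendsto_mult[OF growth_tendsto tendsto_real_sqrt[OF tendsto_mult_left[OF id, of 2]]] by simp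
  have b: "norm (LBINT x:{-\<epsilon>..\<epsilon>}. w (x / \<epsilon>) * l2_rep f x) \<le> growth \<epsilon> * sqrt (2 * \<epsilon>) * norm f"
    if e: "\<epsilon> > 0" and s: "solves (q \<epsilon>) (\<lambda>x. 0) w w1" and one: "norm (w 1) + norm (w1 1) = 1" for w w1 \<epsilon> f
  proof -
    have im: "(\<lambda>x. x / \<epsilon>) ` {-\<epsilon>..\<epsilon>} \<subseteq> {-1..1}" using e by (auto simp: field_simps)
    have c: "continuous_on {-\<epsilon>..\<epsilon>} (\<lambda>x. w (x / \<epsilon>))"
      by (rule continuous_on_compose2[OF solves_continuous(1)[OF s] _ im]) (use e in \<open>auto intro!: continuous_intros\<close>)
    have "norm (w (x / \<epsilon>)) \<le> growth \<epsilon>" if "x \<in> {-\<epsilon>..\<epsilon>}" for x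
    proof -
      have "x / \<epsilon> \<in> {-1..1}" using im that by blast
      from inner_bound_terminal(1)[OF s _ this, of 0] one show ?thesis by simp
    qed
    from integral_Icc_bound(2)[OF c this, of f] show ?thesis using e growth_pos[of \<epsilon>] by simp
  qed
  show "functional_tendsto remainder0 (\<lambda>f. 0)"
    by (rule functional_tendstoI[where C=0, OF _ t]) (use b[OF _ H0(1)] H0(2,3) in \<open>auto simp: remainder0_def\<close>)
  show "functional_tendsto remainder1 (\<lambda>f. 0)"
    by (rule functional_tendstoI[where C=0, OF _ t]) (use b[OF _ H1(1)] H1(2,3) in \<open>auto simp: remainder1_def\<close>)
qed

text \<open>The two ratios through which the amplitudes see \<open>\<Delta>\<close>; unlike \<open>1 / \<Delta>\<close> they converge even if
  \<open>\<Delta>\<close> tends to zero.\<close>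

definition gain where "gain \<epsilon> = of_real \<epsilon> / \<Delta> \<epsilon>"
definition t21_ratio where "t21_ratio \<epsilon> = t21 \<epsilon> / \<Delta> \<epsilon>"

text \<open>The amplitudes of the outgoing waves at \<open>- \<epsilon>\<close> and \<open>\<epsilon>\<close>: the first one solves the linear equation
  that the radiation condition at \<open>\<epsilon>\<close> imposes, the second one is then read off from the transfer
  matrix. All coefficients stay bounded as \<open>\<epsilon>\<close> tends to zero, in the resonant case as well.\<close>

definition left_amplitude where
  "left_amplitude \<epsilon> f = gain \<epsilon> * ((G1 f \<epsilon> - \<i> * k * G f \<epsilon>) + (remainder0 \<epsilon> f + \<i> * k * of_real \<epsilon> * remainder1 \<epsilon> f))
     - (t21_ratio \<epsilon> - \<i> * k * gain \<epsilon> * t11 \<epsilon>) * G f (- \<epsilon>)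
     - gain \<epsilon> * (t22 \<epsilon> - \<i> * k * of_real \<epsilon> * t12 \<epsilon>) * G1 f (- \<epsilon>)"

definition right_amplitude where
  "right_amplitude \<epsilon> f = t11 \<epsilon> * (G f (- \<epsilon>) + left_amplitude \<epsilon> f)
     + of_real \<epsilon> * t12 \<epsilon> * (G1 f (- \<epsilon>) - \<i> * k * left_amplitude \<epsilon> f) + of_real \<epsilon> * remainder1 \<epsilon> f - G f \<epsilon>"

definition left_amplitude_lim where
  "left_amplitude_lim d0 m0 f = d0 * (G1 f 0 - \<i> * k * G f 0) - (m0 - \<i> * k * d0 * t11 0) * G f 0 - d0 * t22 0 * G1 f 0"

definition right_amplitude_lim where
  "right_amplitude_lim d0 m0 f = t11 0 * (G f 0 + left_amplitude_lim d0 m0 f) - G f 0"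

lemma amplitude_tendsto:
  assumes d: "(gain \<longlongrightarrow> d0) (at_right 0)" and m: "(t21_ratio \<longlongrightarrow> m0) (at_right 0)"
  shows "functional_tendsto left_amplitude (left_amplitude_lim d0 m0)" "functional_tendsto right_amplitude (right_amplitude_lim d0 m0)"
proof -
  have id: "((\<lambda>\<epsilon>. \<epsilon>) \<longlongrightarrow> (0::real)) (at_right 0)" by (rule tendsto_ident_at)
  have "functional_tendsto (\<lambda>\<epsilon> f. gain \<epsilon> * ((G1 f \<epsilon> - \<i> * k * G f \<epsilon>) + (remainder0 \<epsilon> f + (\<i> * k * of_real \<epsilon>) * remainder1 \<epsilon> f))
     - (t21_ratio \<epsilon> - \<i> * k * gain \<epsilon> * t11 \<epsilon>) * G f (- \<epsilon>)
     - (gain \<epsilon> * (t22 \<epsilon> - \<i> * k * of_real \<epsilon> * t12 \<epsilon>)) * G1 f (- \<epsilon>))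
    (\<lambda>f. d0 * ((G1 f 0 - \<i> * k * G f 0) + (0 + (\<i> * k * of_real 0) * 0))
     - (m0 - \<i> * k * d0 * t11 0) * G f 0
     - (d0 * (t22 0 - \<i> * k * of_real 0 * t12 0)) * G1 f 0)"
    by (intro functional_tendsto_diff functional_tendsto_add functional_tendsto_mult functional_tendsto_boundary
        functional_tendsto_remainder tendsto_intros d m id transfer_tendsto)
  then show left_amplitude: "functional_tendsto left_amplitude (left_amplitude_lim d0 m0)"
    by (simp add: left_amplitude_def[abs_def] left_amplitude_lim_def[abs_def])
  have "functional_tendsto (\<lambda>\<epsilon> f. t11 \<epsilon> * (G f (- \<epsilon>) + left_amplitude \<epsilon> f)
     + (of_real \<epsilon> * t12 \<epsilon>) * (G1 f (- \<epsilon>) - (\<i> * k) * left_amplitude \<epsilon> f) + of_real \<epsilon> * remainder1 \<epsilon> f - G f \<epsilon>)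
    (\<lambda>f. t11 0 * (G f 0 + left_amplitude_lim d0 m0 f)
     + (of_real 0 * t12 0) * (G1 f 0 - (\<i> * k) * left_amplitude_lim d0 m0 f) + of_real 0 * 0 - G f 0)"
    by (intro functional_tendsto_diff functional_tendsto_add functional_tendsto_mult functional_tendsto_boundary
        functional_tendsto_remainder left_amplitude tendsto_intros id transfer_tendsto)
  then show "functional_tendsto right_amplitude (right_amplitude_lim d0 m0)"
    by (simp add: right_amplitude_def[abs_def] right_amplitude_lim_def[abs_def])
qed

lemma source_cont: "continuous_on A (\<lambda>\<xi>. of_real (\<alpha> * \<Psi> \<xi>) * G f (\<epsilon> * \<xi>))"
  by (intro continuous_intros continuous_on_subset[OF \<Psi>_cont] continuous_on_compose2[OF G_cont(1)[of UNIV]]) auto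

text \<open>Green's identity for the sum of the free resolvent and an inner solution against a homogeneous
  solution expresses the Cauchy data at \<open>\<epsilon>\<close> by those at \<open>- \<epsilon>\<close>, up to an integral of \<open>f\<close> over
  \<open>[- \<epsilon>, \<epsilon>]\<close>.\<close>

lemma Green_identity:
  assumes e: "\<epsilon> > 0" and s: "solves (q \<epsilon>) (\<lambda>\<xi>. of_real (\<alpha> * \<Psi> \<xi>) * G f (\<epsilon> * \<xi>)) s s1"
    and h: "solves (q \<epsilon>) (\<lambda>x. 0) h h1"
  shows "((G1 f \<epsilon> + s1 1 / of_real \<epsilon>) * h 1 - (G f \<epsilon> + s 1) * (h1 1 / of_real \<epsilon>))
      - ((G1 f (- \<epsilon>) + s1 (-1) / of_real \<epsilon>) * h (-1) - (G f (- \<epsilon>) + s (-1)) * (h1 (-1) / of_real \<epsilon>))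
    = - (LBINT x:{-\<epsilon>..\<epsilon>}. h (x / \<epsilon>) * l2_rep f x)"
proof -
  note ps = solves_scaled[OF s q_cont source_cont e] and ph = solves_scaled[OF h q_cont continuous_on_const e]
  note pG = primitive_on_subset[OF G, of "{-\<epsilon>..\<epsilon>}" f, OF subset_UNIV]
    primitive_on_subset[OF G1, of "{-\<epsilon>..\<epsilon>}" f, OF subset_UNIV]
  define D where "D x = (G1 f x + s1 (x / \<epsilon>) / of_real \<epsilon>) * h (x / \<epsilon>) - (G f x + s (x / \<epsilon>)) * (h1 (x / \<epsilon>) / of_real \<epsilon>)" for x
  have P: "primitive_on {-\<epsilon>..\<epsilon>} D (\<lambda>x. - (h (x / \<epsilon>) * l2_rep f x))"
  proof (rule primitive_on_cong[OF primitive_on_diff[OF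
        primitive_on_mult[OF primitive_on_add[OF pG(2) ps(2)] ph(1) is_interval_cc]
        primitive_on_mult[OF primitive_on_add[OF pG(1) ps(1)] ph(2) is_interval_cc]] is_interval_cc])
    fix x
    show "(- k\<^sup>2 * G f x - l2_rep f x +
          (q \<epsilon> (x / \<epsilon>) * s (x / \<epsilon>) + complex_of_real (\<alpha> * \<Psi> (x / \<epsilon>)) * G f (\<epsilon> * (x / \<epsilon>))) / (complex_of_real \<epsilon>)\<^sup>2) * h (x / \<epsilon>) +
         (G1 f x + s1 (x / \<epsilon>) / complex_of_real \<epsilon>) * (h1 (x / \<epsilon>) / complex_of_real \<epsilon>) -
         ((G1 f x + s1 (x / \<epsilon>) / complex_of_real \<epsilon>) * (h1 (x / \<epsilon>) / complex_of_real \<epsilon>) +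
          (G f x + s (x / \<epsilon>)) * ((q \<epsilon> (x / \<epsilon>) * h (x / \<epsilon>) + 0) / (complex_of_real \<epsilon>)\<^sup>2)) =
         - (h (x / \<epsilon>) * l2_rep f x)"
      using e by (simp add: q_def field_simps)
  qed (simp add: D_def)
  have ee: "- \<epsilon> \<in> {-\<epsilon>..\<epsilon>}" "\<epsilon> \<in> {-\<epsilon>..\<epsilon>}" "- \<epsilon> \<le> \<epsilon>" using e by auto
  note PD = primitive_onD[OF P ee]
  have i: "set_integrable lborel {-\<epsilon>..\<epsilon>} (\<lambda>x. h (x / \<epsilon>) * l2_rep f x)"
    using set_integrable_mult_right[of "-1", OF PD(1)] by (simp add: set_integrable_def)
  show ?thesis
    using PD(2) e unfolding set_integral_uminus[OF i] by (simp add: D_def)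
qed

text \<open>Continue from \<open>- \<epsilon>\<close> to \<open>\<epsilon>\<close> with the data of the outgoing wave of amplitude \<open>left_amplitude\<close>. The
  transfer relations give the Cauchy data at \<open>\<epsilon>\<close>, and the choice of \<open>left_amplitude\<close> makes them those
  of an outgoing wave.\<close>

lemma inner_solution:
  assumes e: "\<epsilon> > 0"
  shows "\<exists>s s1. solves (q \<epsilon>) (\<lambda>\<xi>. of_real (\<alpha> * \<Psi> \<xi>) * G f (\<epsilon> * \<xi>)) s s1 \<and>
    s (-1) = left_amplitude \<epsilon> f \<and> s1 (-1) = - \<i> * k * of_real \<epsilon> * left_amplitude \<epsilon> f \<and>
    s 1 = right_amplitude \<epsilon> f \<and> s1 1 = \<i> * k * of_real \<epsilon> * right_amplitude \<epsilon> f"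
proof -
  obtain s s1 where s: "solves (q \<epsilon>) (\<lambda>\<xi>. of_real (\<alpha> * \<Psi> \<xi>) * G f (\<epsilon> * \<xi>)) s s1"
    "s (-1) = left_amplitude \<epsilon> f" "s1 (-1) = - \<i> * k * of_real \<epsilon> * left_amplitude \<epsilon> f"
    using solves_exists_initial[OF q_cont source_cont] by blast
  define e' where "e' = complex_of_real \<epsilon>"
  have e': "e' \<noteq> 0" using e by (simp add: e'_def)
  have sm: "s1 (-1) / e' = - \<i> * k * left_amplitude \<epsilon> f" using e' by (simp add: s e'_def)
  have "e' * (G f \<epsilon> + s 1) = e' * (t11 \<epsilon> * (G f (- \<epsilon>) + left_amplitude \<epsilon> f) + e' * t12 \<epsilon> * (G1 f (- \<epsilon>) - \<i> * k * left_amplitude \<epsilon> f) + e' * remainder1 \<epsilon> f)"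
    using Green_identity[OF e s(1) H1(1)] e' unfolding H1 remainder1_def[symmetric] e'_def[symmetric] sm s(2)
    by (simp add: t11_def t12_def field_simps)
  then have h1: "G f \<epsilon> + s 1 = t11 \<epsilon> * (G f (- \<epsilon>) + left_amplitude \<epsilon> f) + e' * t12 \<epsilon> * (G1 f (- \<epsilon>) - \<i> * k * left_amplitude \<epsilon> f) + e' * remainder1 \<epsilon> f"
    using e' by (simp only: mult_left_cancel not_False_eq_True)
  then have p: "s 1 = right_amplitude \<epsilon> f" by (simp add: right_amplitude_def e'_def algebra_simps)
  have "e' * (G1 f \<epsilon> + s1 1 / e') = e' * (t22 \<epsilon> * (G1 f (- \<epsilon>) - \<i> * k * left_amplitude \<epsilon> f) + t21 \<epsilon> / e' * (G f (- \<epsilon>) + left_amplitude \<epsilon> f) - remainder0 \<epsilon> f)"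
    using Green_identity[OF e s(1) H0(1)] e' unfolding H0 remainder0_def[symmetric] e'_def[symmetric] sm s(2)
    by (simp add: t21_def t22_def field_simps)
  then have h0: "G1 f \<epsilon> + s1 1 / e' = t22 \<epsilon> * (G1 f (- \<epsilon>) - \<i> * k * left_amplitude \<epsilon> f) + t21 \<epsilon> / e' * (G f (- \<epsilon>) + left_amplitude \<epsilon> f) - remainder0 \<epsilon> f"
    using e' by (simp only: mult_left_cancel not_False_eq_True)
  have D: "\<Delta> \<epsilon> \<noteq> 0" by (rule \<Delta>_nonzero[OF e])
  \<comment> \<open>The defining equation of the amplitude at \<open>- \<epsilon>\<close>, cleared of denominators.\<close>
  have "\<Delta> \<epsilon> * left_amplitude \<epsilon> f = e' * ((G1 f \<epsilon> - \<i> * k * G f \<epsilon>) + (remainder0 \<epsilon> f + \<i> * k * e' * remainder1 \<epsilon> f))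
     - (t21 \<epsilon> - \<i> * k * e' * t11 \<epsilon>) * G f (- \<epsilon>) - e' * (t22 \<epsilon> - \<i> * k * e' * t12 \<epsilon>) * G1 f (- \<epsilon>)"
    using D unfolding left_amplitude_def gain_def t21_ratio_def e'_def[symmetric] by (simp add: field_simps)
  then have "e' * (G1 f \<epsilon> - \<i> * k * G f \<epsilon>) =
     (t21 \<epsilon> - \<i> * k * e' * (t11 \<epsilon> + t22 \<epsilon>) - k\<^sup>2 * e'\<^sup>2 * t12 \<epsilon>) * left_amplitude \<epsilon> f
     - e' * (remainder0 \<epsilon> f + \<i> * k * e' * remainder1 \<epsilon> f)
     + (t21 \<epsilon> - \<i> * k * e' * t11 \<epsilon>) * G f (- \<epsilon>) + e' * (t22 \<epsilon> - \<i> * k * e' * t12 \<epsilon>) * G1 f (- \<epsilon>)"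
    unfolding \<Delta>_def e'_def[symmetric] by (simp add: algebra_simps)
  also have "\<dots> = e' * (G1 f \<epsilon> + s1 1 / e') - \<i> * k * e' * (G f \<epsilon> + s 1)"
    unfolding h0 h1 using e' by (simp add: field_simps power2_eq_square)
  finally have "s1 1 = \<i> * k * e' * s 1"
    using e' by (simp add: field_simps)
  then have "s1 1 = \<i> * k * of_real \<epsilon> * right_amplitude \<epsilon> f" by (simp add: p e'_def)
  then show ?thesis using s p by blast
qed

end

section \<open>Convergence of the resolvents\<close>

lemma norm_wave: "norm (exp (\<i> * k * complex_of_real x)) = exp (- Im k * x)"
  "norm (exp (- \<i> * k * complex_of_real x)) = exp (Im k * x)"
  by simp_all

lemma primitive_on_three_pieces:
  assumes e: "(\<epsilon>::real) > 0"
    and l: "primitive_on UNIV L L1" and m: "primitive_on {-\<epsilon>..\<epsilon>} I I1" and r: "primitive_on UNIV R R1"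
    and "L (- \<epsilon>) = I (- \<epsilon>)" "I \<epsilon> = R \<epsilon>"
    and "L1 (- \<epsilon>) = I1 (- \<epsilon>)" "I1 \<epsilon> = R1 \<epsilon>"
  shows "primitive_on UNIV (\<lambda>x. if x < - \<epsilon> then L x else if x \<le> \<epsilon> then I x else R x)
    (\<lambda>x. if x < - \<epsilon> then L1 x else if x \<le> \<epsilon> then I1 x else R1 x)" (is "primitive_on UNIV ?F ?f")
proof (rule primitive_on_glue[where c="- \<epsilon>"])
  show "primitive_on (UNIV \<inter> {..- \<epsilon>}) ?F ?f"
  proof (rule primitive_on_cong[OF primitive_on_subset[OF l]])
    fix x assume "x \<in> UNIV \<inter> {..- \<epsilon>}"
    then have "x < - \<epsilon> \<or> x = - \<epsilon>" by auto
    then show "L x = ?F x" "L1 x = ?f x" using e assms(5,7) by auto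
  qed (auto simp: is_interval_ic)
  show "primitive_on (UNIV \<inter> {- \<epsilon>..}) ?F ?f"
  proof (rule primitive_on_glue[where c="\<epsilon>"])
    show "primitive_on (UNIV \<inter> {- \<epsilon>..} \<inter> {..\<epsilon>}) ?F ?f"
    proof (rule primitive_on_cong[OF primitive_on_subset[OF m]])
      have "UNIV \<inter> {- \<epsilon>..} \<inter> {..\<epsilon>} = {- \<epsilon>..\<epsilon>}" by auto
      then show "is_interval (UNIV \<inter> {- \<epsilon>..} \<inter> {..\<epsilon>})" by (metis is_interval_cc)
    qed auto
    show "primitive_on (UNIV \<inter> {- \<epsilon>..} \<inter> {\<epsilon>..}) ?F ?f"
    proof (rule primitive_on_cong[OF primitive_on_subset[OF r]])
      have "UNIV \<inter> {- \<epsilon>..} \<inter> {\<epsilon>..} = {\<epsilon>..}" using e by auto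
      then show "is_interval (UNIV \<inter> {- \<epsilon>..} \<inter> {\<epsilon>..})" by (metis is_interval_ci)
      fix x assume "x \<in> UNIV \<inter> {- \<epsilon>..} \<inter> {\<epsilon>..}"
      then have "x > \<epsilon> \<or> x = \<epsilon>" by auto
      then show "R x = ?F x" "R1 x = ?f x" using e assms(6,8) by auto
    qed auto
  qed (use e in auto)
qed simp

context squeezed_resolvent
begin

lemma wave_primitives:
  "primitive_on UNIV (\<lambda>x. c * exp (- \<i> * k * of_real x)) (\<lambda>x. - \<i> * k * (c * exp (- \<i> * k * of_real x)))"
  "primitive_on UNIV (\<lambda>x. - \<i> * k * (c * exp (- \<i> * k * of_real x))) (\<lambda>x. - k\<^sup>2 * (c * exp (- \<i> * k * of_real x)))"
  "primitive_on UNIV (\<lambda>x. c * exp (\<i> * k * of_real x)) (\<lambda>x. \<i> * k * (c * exp (\<i> * k * of_real x)))"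
  "primitive_on UNIV (\<lambda>x. \<i> * k * (c * exp (\<i> * k * of_real x))) (\<lambda>x. - k\<^sup>2 * (c * exp (\<i> * k * of_real x)))"
proof -
  show 1: "primitive_on UNIV (\<lambda>x. c * exp (- \<i> * k * of_real x)) (\<lambda>x. - \<i> * k * (c * exp (- \<i> * k * of_real x)))" for c
    by (rule primitive_on_cong[OF primitive_on_cmult[OF primitive_on_exp[of "- \<i> * k"], of c]]) (auto simp: is_interval_univ)
  show "primitive_on UNIV (\<lambda>x. - \<i> * k * (c * exp (- \<i> * k * of_real x))) (\<lambda>x. - k\<^sup>2 * (c * exp (- \<i> * k * of_real x)))"
    by (rule primitive_on_cong[OF primitive_on_cmult[OF 1[of c], of "- \<i> * k"]])
       (auto simp: is_interval_univ power2_eq_square algebra_simps)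
  show 2: "primitive_on UNIV (\<lambda>x. c * exp (\<i> * k * of_real x)) (\<lambda>x. \<i> * k * (c * exp (\<i> * k * of_real x)))" for c
    by (rule primitive_on_cong[OF primitive_on_cmult[OF primitive_on_exp[of "\<i> * k"], of c]]) (auto simp: is_interval_univ)
  show "primitive_on UNIV (\<lambda>x. \<i> * k * (c * exp (\<i> * k * of_real x))) (\<lambda>x. - k\<^sup>2 * (c * exp (\<i> * k * of_real x)))"
    by (rule primitive_on_cong[OF primitive_on_cmult[OF 2[of c], of "\<i> * k"]])
       (auto simp: is_interval_univ power2_eq_square algebra_simps)
qed

text \<open>The outgoing, and hence decaying, wave with amplitudes \<open>a\<close> on the left and \<open>b\<close> on the right.\<close>

definition wave :: "complex \<Rightarrow> complex \<Rightarrow> real \<Rightarrow> complex" where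
  "wave a b x = (if x < 0 then a * exp (- \<i> * k * of_real x) else b * exp (\<i> * k * of_real x))"

lemma wave_norm: "norm (wave a b x) = (if x < 0 then norm a else norm b) * exp (- Im k * \<bar>x\<bar>)"
  unfolding wave_def using norm_wave[of k x] by (simp add: norm_mult)

lemma wave_measurable [measurable]: "wave a b \<in> borel_measurable borel"
proof -
  have c: "continuous_on UNIV (\<lambda>x. a * exp (- \<i> * k * complex_of_real x))" "continuous_on UNIV (\<lambda>x. b * exp (\<i> * k * complex_of_real x))"
    by (intro continuous_intros)+
  show ?thesis unfolding wave_def[abs_def]
    using borel_measurable_continuous_onI[OF c(1)] borel_measurable_continuous_onI[OF c(2)] by measurable
qed

lemma wave_square_integrable: "square_integrable (wave a b)"
proof (rule square_integrable_bound[OF _ square_integrable_exp_abs(1)[OF Im_k]])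
  show "norm (wave a b x) \<le> (norm a + norm b) * norm (complex_of_real (exp (- Im k * \<bar>x\<bar>)))" for x
    unfolding wave_norm norm_of_real abs_exp_cancel by (intro mult_right_mono) auto
qed simp

definition exp_l2_norm where "exp_l2_norm = sqrt (LBINT x::real. exp (- (2 * Im k) * \<bar>x\<bar>))"

text \<open>Exponential decay outside \<open>[- \<epsilon>, \<epsilon>]\<close> and a mere bound inside are enough for a small norm.\<close>

lemma l2_norm_bound:
  assumes w: "square_integrable w" and e: "\<epsilon> > 0" and A: "A \<ge> 0" and B: "B \<ge> 0"
    and out: "\<And>x. \<bar>x\<bar> > \<epsilon> \<Longrightarrow> norm (w x) \<le> A * exp (- Im k * \<bar>x\<bar>)"
    and inn: "\<And>x. \<bar>x\<bar> \<le> \<epsilon> \<Longrightarrow> norm (w x) \<le> B"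
  shows "norm (l2_class w) \<le> A * exp_l2_norm + B * sqrt (2 * \<epsilon>)"
proof -
  note ex = square_integrable_exp_abs[OF Im_k]
  have i1: "integrable lborel (\<lambda>x. A\<^sup>2 * (exp (- Im k * \<bar>x\<bar>))\<^sup>2)" by (rule integrable_mult_right[OF ex(3)])
  have i2: "integrable lborel (\<lambda>x. B\<^sup>2 * indicator {-\<epsilon>..\<epsilon>} x :: real)"
    using borel_integrable_compact[OF compact_Icc[of "-\<epsilon>" \<epsilon>] continuous_on_const[of _ "1::real"]]
    by (intro integrable_mult_right) simp
  have le: "(norm (w x))\<^sup>2 \<le> A\<^sup>2 * (exp (- Im k * \<bar>x\<bar>))\<^sup>2 + B\<^sup>2 * indicator {-\<epsilon>..\<epsilon>} x" for x
  proof (cases "\<bar>x\<bar> \<le> \<epsilon>")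
    case True
    then have "(norm (w x))\<^sup>2 \<le> B\<^sup>2" using inn by (intro power_mono) auto
    moreover have "B\<^sup>2 * indicator {-\<epsilon>..\<epsilon>} x = B\<^sup>2" using True by (auto simp: abs_le_iff)
    moreover have "0 \<le> A\<^sup>2 * (exp (- Im k * \<bar>x\<bar>))\<^sup>2" by simp
    ultimately show ?thesis by linarith
  next
    case False
    then have "(norm (w x))\<^sup>2 \<le> (A * exp (- Im k * \<bar>x\<bar>))\<^sup>2" using out[of x] by (intro power_mono) auto
    moreover have "0 \<le> B\<^sup>2 * indicator {-\<epsilon>..\<epsilon>} x" by simp
    ultimately show ?thesis unfolding power_mult_distrib by linarith
  qed
  have exp_l2_norm: "exp_l2_norm \<ge> 0" "exp_l2_norm\<^sup>2 = (LBINT x::real. (exp (- Im k * \<bar>x\<bar>))\<^sup>2)"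
    unfolding exp_l2_norm_def ex(2)[symmetric] by simp_all
  have "(LBINT x. (norm (w x))\<^sup>2) \<le> (LBINT x. A\<^sup>2 * (exp (- Im k * \<bar>x\<bar>))\<^sup>2 + B\<^sup>2 * indicator {-\<epsilon>..\<epsilon>} x)"
    using w by (intro integral_mono Bochner_Integration.integrable_add i1 i2 le) (simp add: square_integrable_def)
  also have "\<dots> = A\<^sup>2 * exp_l2_norm\<^sup>2 + B\<^sup>2 * (2 * \<epsilon>)"
    using e unfolding Bochner_Integration.integral_add[OF i1 i2] exp_l2_norm(2) by simp
  also have "\<dots> \<le> (A * exp_l2_norm + B * sqrt (2 * \<epsilon>))\<^sup>2"
    using A B exp_l2_norm(1) e by (simp add: power2_sum power_mult_distrib)
  finally have "sqrt (LBINT x. (norm (w x))\<^sup>2) \<le> A * exp_l2_norm + B * sqrt (2 * \<epsilon>)"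
    using A B exp_l2_norm(1) e by (intro real_le_lsqrt) auto
  then show ?thesis by (simp add: norm_l2_class[OF w])
qed

text \<open>The outgoing waves and the inner solution are glued at \<open>- \<epsilon>\<close> and \<open>\<epsilon>\<close>, where their Cauchy data agree.
  The phase factor in \<open>a\<close> and \<open>b\<close> refers the amplitudes to the origin, where those of the limit live.\<close>

lemma H_eps_resolvent:
  fixes f :: l2
  assumes e: "\<epsilon> > 0"
  defines "a \<equiv> exp (- \<i> * k * of_real \<epsilon>) * left_amplitude \<epsilon> f" and "b \<equiv> exp (- \<i> * k * of_real \<epsilon>) * right_amplitude \<epsilon> f"
  shows "\<exists>v. square_integrable v \<and>
    (l2_class (\<lambda>x. G f x + v x), f + k\<^sup>2 *\<^sub>C l2_class (\<lambda>x. G f x + v x)) \<in> H_eps \<epsilon> \<alpha> \<Psi> \<and>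
    (\<forall>x. \<bar>x\<bar> > \<epsilon> \<longrightarrow> v x = wave a b x) \<and>
    (\<forall>x. \<bar>x\<bar> \<le> \<epsilon> \<longrightarrow> norm (v x) \<le> growth \<epsilon> * ((1 + norm k * \<epsilon>) * norm (left_amplitude \<epsilon> f) + 2 * (\<bar>\<alpha>\<bar> * M * (C * norm f))))"
proof -
  obtain s s1 where s: "solves (q \<epsilon>) (\<lambda>\<xi>. of_real (\<alpha> * \<Psi> \<xi>) * G f (\<epsilon> * \<xi>)) s s1"
    "s (-1) = left_amplitude \<epsilon> f" "s1 (-1) = - \<i> * k * of_real \<epsilon> * left_amplitude \<epsilon> f"
    "s 1 = right_amplitude \<epsilon> f" "s1 1 = \<i> * k * of_real \<epsilon> * right_amplitude \<epsilon> f"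
    using inner_solution[OF e] by blast
  define B where "B = growth \<epsilon> * ((1 + norm k * \<epsilon>) * norm (left_amplitude \<epsilon> f) + 2 * (\<bar>\<alpha>\<bar> * M * (C * norm f)))"
  have sb: "norm (s x) \<le> B" if x: "x \<in> {-1..1}" for x
  proof -
    have src: "norm (of_real (\<alpha> * \<Psi> \<xi>) * G f (\<epsilon> * \<xi>)) \<le> \<bar>\<alpha>\<bar> * M * (C * norm f)" for \<xi>
      unfolding norm_mult norm_of_real abs_mult using M_nonneg
      by (intro mult_mono \<Psi>_bound G_bound) auto
    have "norm (s x) \<le> growth \<epsilon> * (norm (s (-1)) + norm (s1 (-1)) + 2 * (\<bar>\<alpha>\<bar> * M * (C * norm f)))"
      by (rule inner_bound_initial[OF s(1) src x])
    also have "\<dots> = B" using e by (simp add: B_def s norm_mult algebra_simps)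
    finally show ?thesis .
  qed
  have B0: "B \<ge> 0" using order_trans[OF norm_ge_zero sb[of 0]] by simp
  note ps = solves_scaled[OF s(1) q_cont source_cont e]
  note wl = wave_primitives(1,2)[of a] and wr = wave_primitives(3,4)[of b]
  define v where "v x = (if x < - \<epsilon> then a * exp (- \<i> * k * of_real x) else if x \<le> \<epsilon> then s (x / \<epsilon>) else b * exp (\<i> * k * of_real x))" for x
  define v1 where "v1 x = (if x < - \<epsilon> then - \<i> * k * (a * exp (- \<i> * k * of_real x)) else if x \<le> \<epsilon> then s1 (x / \<epsilon>) / of_real \<epsilon> else \<i> * k * (b * exp (\<i> * k * of_real x)))" for x
  define V where "V x = \<alpha> / \<epsilon>\<^sup>2 * \<Psi> (x / \<epsilon>)" for x
  have Vout: "V x = 0" if "\<bar>x\<bar> \<ge> \<epsilon>" for x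
  proof -
    have "\<bar>x / \<epsilon>\<bar> \<ge> 1" using that e by simp
    then show ?thesis by (simp add: V_def \<Psi>_supp)
  qed
  have jl: "a * exp (- \<i> * k * of_real (- \<epsilon>)) = left_amplitude \<epsilon> f" and jr: "b * exp (\<i> * k * of_real \<epsilon>) = right_amplitude \<epsilon> f"
    unfolding a_def b_def by (simp_all add: mult.commute[of "exp _" "c"] mult.assoc[symmetric] mult_exp_exp exp_minus)
  have e1: "- \<epsilon> / \<epsilon> = -1" "\<epsilon> / \<epsilon> = 1" using e by auto
  have e2: "complex_of_real \<epsilon> \<noteq> 0" using e by simp
  have j1: "s (- \<epsilon> / \<epsilon>) = left_amplitude \<epsilon> f" "s (\<epsilon> / \<epsilon>) = right_amplitude \<epsilon> f"
    "s1 (- \<epsilon> / \<epsilon>) / of_real \<epsilon> = - \<i> * k * left_amplitude \<epsilon> f" "s1 (\<epsilon> / \<epsilon>) / of_real \<epsilon> = \<i> * k * right_amplitude \<epsilon> f"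
    unfolding e1 s using e2 by simp_all
  have pv: "primitive_on UNIV v v1"
    unfolding v_def[abs_def] v1_def[abs_def]
    by (rule primitive_on_three_pieces[OF e wl(1) ps(1) wr(1)]) (simp_all only: jl jr j1)
  have inner_eq: "(q \<epsilon> (x / \<epsilon>) * s (x / \<epsilon>) + of_real (\<alpha> * \<Psi> (x / \<epsilon>)) * G f (\<epsilon> * (x / \<epsilon>))) / (of_real \<epsilon>)\<^sup>2
      = (of_real (V x) - k\<^sup>2) * s (x / \<epsilon>) + of_real (V x) * G f x" for x
    using e by (simp add: q_def V_def field_simps)
  have pI: "primitive_on {-\<epsilon>..\<epsilon>} (\<lambda>x. s1 (x / \<epsilon>) / of_real \<epsilon>)
      (\<lambda>x. (of_real (V x) - k\<^sup>2) * s (x / \<epsilon>) + of_real (V x) * G f x)"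
    using ps(2) unfolding inner_eq .
  have pv1: "primitive_on UNIV v1 (\<lambda>x. (of_real (V x) - k\<^sup>2) * v x + of_real (V x) * G f x)"
  proof (rule primitive_on_cong)
    show "primitive_on UNIV v1 (\<lambda>x. if x < - \<epsilon> then - k\<^sup>2 * (a * exp (- \<i> * k * of_real x))
        else if x \<le> \<epsilon> then (of_real (V x) - k\<^sup>2) * s (x / \<epsilon>) + of_real (V x) * G f x
        else - k\<^sup>2 * (b * exp (\<i> * k * of_real x)))"
      unfolding v1_def[abs_def]
      by (rule primitive_on_three_pieces[OF e wl(2) pI wr(2)])
         (use e in \<open>simp_all only: jl jr j1, simp_all add: Vout\<close>)
  qed (use e in \<open>auto simp: v_def Vout is_interval_univ\<close>)
  have vm: "v \<in> borel_measurable lborel" "v1 \<in> borel_measurable lborel"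
    using continuous_on_primitive_UNIV[OF pv] continuous_on_primitive_UNIV[OF pv1]
    by (auto intro: borel_measurable_continuous_onI)
  have vout: "v x = wave a b x" "v1 x = (if x < 0 then - \<i> * k else \<i> * k) * wave a b x" if "\<bar>x\<bar> > \<epsilon>" for x
    using that e by (auto simp: v_def v1_def wave_def abs_if split: if_splits)
  have vin: "norm (v x) \<le> B" if "\<bar>x\<bar> \<le> \<epsilon>" for x
  proof -
    have x: "x / \<epsilon> \<in> {-1..1}" using that e by (auto simp: abs_le_iff field_simps)
    have "v x = s (x / \<epsilon>)" using that by (auto simp: v_def abs_le_iff)
    then show ?thesis using sb[OF x] by simp
  qed
  obtain B1 where B1: "\<And>x. x \<in> {-\<epsilon>..\<epsilon>} \<Longrightarrow> norm (v1 x) \<le> B1"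
    using compact_imp_bounded[OF compact_continuous_image[OF continuous_on_subset[OF continuous_on_primitive_UNIV[OF pv1] subset_UNIV] compact_Icc]]
    unfolding bounded_iff by blast
  have B10: "B1 \<ge> 0" using order_trans[OF norm_ge_zero B1[of 0]] e by simp
  have expl: "1 \<le> exp (Im k * \<epsilon>) * exp (- Im k * \<bar>x\<bar>)" if "\<bar>x\<bar> \<le> \<epsilon>" for x
    using that Im_k unfolding mult_exp_exp by (simp add: mult_left_mono)
  have sqv: "square_integrable v"
  proof (rule square_integrable_bound[OF vm(1) square_integrable_exp_abs(1)[OF Im_k]])
    show "norm (v x) \<le> (norm a + norm b + B * exp (Im k * \<epsilon>)) * norm (complex_of_real (exp (- Im k * \<bar>x\<bar>)))" for x
    proof (cases "\<bar>x\<bar> > \<epsilon>")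
      case True
      then show ?thesis unfolding vout(1)[OF True] wave_norm norm_of_real abs_exp_cancel
        using B0 by (intro mult_right_mono) auto
    next
      case False
      then have "norm (v x) \<le> B * 1" using vin by simp
      also have "\<dots> \<le> B * (exp (Im k * \<epsilon>) * exp (- Im k * \<bar>x\<bar>))"
        using expl[of x] False B0 by (intro mult_left_mono) auto
      also have "\<dots> \<le> (norm a + norm b + B * exp (Im k * \<epsilon>)) * exp (- Im k * \<bar>x\<bar>)"
        by (simp add: algebra_simps)
      finally show ?thesis by simp
    qed
  qed
  have sqv1: "square_integrable v1"
  proof (rule square_integrable_bound[OF vm(2) square_integrable_exp_abs(1)[OF Im_k]])
    show "norm (v1 x) \<le> (norm k * (norm a + norm b) + B1 * exp (Im k * \<epsilon>)) * norm (complex_of_real (exp (- Im k * \<bar>x\<bar>)))" for x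
    proof (cases "\<bar>x\<bar> > \<epsilon>")
      case True
      have "norm (v1 x) = norm k * ((if x < 0 then norm a else norm b) * exp (- Im k * \<bar>x\<bar>))"
        unfolding vout(2)[OF True] norm_mult wave_norm by (simp add: norm_mult)
      also have "\<dots> \<le> norm k * ((norm a + norm b) * exp (- Im k * \<bar>x\<bar>))"
        by (intro mult_left_mono mult_right_mono) auto
      also have "\<dots> \<le> (norm k * (norm a + norm b) + B1 * exp (Im k * \<epsilon>)) * exp (- Im k * \<bar>x\<bar>)"
        using B10 by (simp add: algebra_simps)
      finally show ?thesis by simp
    next
      case False
      then have "x \<in> {-\<epsilon>..\<epsilon>}" by auto
      then have "norm (v1 x) \<le> B1 * 1" using B1[of x] by simp
      also have "\<dots> \<le> B1 * (exp (Im k * \<epsilon>) * exp (- Im k * \<bar>x\<bar>))"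
        using expl[of x] False B10 by (intro mult_left_mono) auto
      also have "\<dots> \<le> (norm k * (norm a + norm b) + B1 * exp (Im k * \<epsilon>)) * exp (- Im k * \<bar>x\<bar>)"
        by (simp add: algebra_simps)
      finally show ?thesis by simp
    qed
  qed
  have "(l2_class (\<lambda>x. G f x + v x), f + k\<^sup>2 *\<^sub>C l2_class (\<lambda>x. G f x + v x)) \<in> H_eps \<epsilon> \<alpha> \<Psi>"
  proof (rule H_eps_memberI[OF _ _ _ _ \<Psi>_cont \<Psi>_bound e])
    show "primitive_on UNIV (\<lambda>x. G f x + v x) (\<lambda>x. G1 f x + v1 x)"
      by (rule primitive_on_add[OF G pv])
    show "primitive_on UNIV (\<lambda>x. G1 f x + v1 x)
        (\<lambda>x. (of_real (\<alpha> / \<epsilon>\<^sup>2 * \<Psi> (x / \<epsilon>)) - k\<^sup>2) * (G f x + v x) - l2_rep f x)"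
      unfolding V_def[symmetric]
      by (rule primitive_on_cong[OF primitive_on_add[OF G1 pv1]]) (simp_all add: is_interval_univ algebra_simps)
  qed (intro square_integrable_add G_sq sqv sqv1)+
  then show ?thesis using sqv vout(1) vin unfolding B_def by blast
qed

text \<open>Outside \<open>[- \<epsilon>, \<epsilon>]\<close> the difference is a wave whose amplitudes tend to zero; inside it is bounded by a
  multiple of the norm of \<open>f\<close>, which contributes a factor \<open>sqrt (2 * \<epsilon>)\<close> to the norm.\<close>

lemma resolvent_convergence:
  assumes d: "(gain \<longlongrightarrow> d0) (at_right 0)" and m: "(t21_ratio \<longlongrightarrow> m0) (at_right 0)"
  shows "\<exists>\<delta>. (\<delta> \<longlongrightarrow> 0) (at_right 0) \<and> (\<forall>\<epsilon>>0. \<forall>f. \<exists>u. (u, f + k\<^sup>2 *\<^sub>C u) \<in> H_eps \<epsilon> \<alpha> \<Psi> \<and>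
    norm (u - l2_class (\<lambda>x. G f x + wave (left_amplitude_lim d0 m0 f) (right_amplitude_lim d0 m0 f) x)) \<le> \<delta> \<epsilon> * norm f)"
proof -
  have id: "((\<lambda>\<epsilon>. \<epsilon>) \<longlongrightarrow> (0::real)) (at_right 0)" by (rule tendsto_ident_at)
  have "((\<lambda>\<epsilon>. exp (- \<i> * k * of_real \<epsilon>)) \<longlongrightarrow> exp (- \<i> * k * of_real 0)) (at_right 0)"
    by (intro tendsto_intros id)
  then have ph: "((\<lambda>\<epsilon>. exp (- \<i> * k * of_real \<epsilon>)) \<longlongrightarrow> 1) (at_right 0)" by simp
  note amp = amplitude_tendsto[OF d m]
  have fa: "functional_tendsto (\<lambda>\<epsilon> f. exp (- \<i> * k * of_real \<epsilon>) * left_amplitude \<epsilon> f) (left_amplitude_lim d0 m0)"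
    "functional_tendsto (\<lambda>\<epsilon> f. exp (- \<i> * k * of_real \<epsilon>) * right_amplitude \<epsilon> f) (right_amplitude_lim d0 m0)"
    using functional_tendsto_mult[OF ph amp(1)] functional_tendsto_mult[OF ph amp(2)] by simp_all
  obtain C1 \<delta>1 where 1: "\<And>f. norm (left_amplitude_lim d0 m0 f) \<le> C1 * norm f" "C1 \<ge> 0" "(\<delta>1 \<longlongrightarrow> 0) (at_right 0)" "\<And>\<epsilon>. \<delta>1 \<epsilon> \<ge> 0"
    "\<And>\<epsilon> f. \<epsilon> > 0 \<Longrightarrow> norm (exp (- \<i> * k * of_real \<epsilon>) * left_amplitude \<epsilon> f - left_amplitude_lim d0 m0 f) \<le> \<delta>1 \<epsilon> * norm f"
    by (rule functional_tendstoE[OF fa(1)]) blast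
  obtain C2 \<delta>2 where 2: "\<And>f. norm (right_amplitude_lim d0 m0 f) \<le> C2 * norm f" "C2 \<ge> 0" "(\<delta>2 \<longlongrightarrow> 0) (at_right 0)" "\<And>\<epsilon>. \<delta>2 \<epsilon> \<ge> 0"
    "\<And>\<epsilon> f. \<epsilon> > 0 \<Longrightarrow> norm (exp (- \<i> * k * of_real \<epsilon>) * right_amplitude \<epsilon> f - right_amplitude_lim d0 m0 f) \<le> \<delta>2 \<epsilon> * norm f"
    by (rule functional_tendstoE[OF fa(2)]) blast
  obtain \<delta>3 where 3: "(\<delta>3 \<longlongrightarrow> 0) (at_right 0)" "\<And>\<epsilon>. \<delta>3 \<epsilon> \<ge> 0"
    "\<And>\<epsilon> f. \<epsilon> > 0 \<Longrightarrow> norm (left_amplitude \<epsilon> f - left_amplitude_lim d0 m0 f) \<le> \<delta>3 \<epsilon> * norm f"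
    by (rule functional_tendstoE[OF amp(1)]) blast
  define \<beta> where "\<beta> \<epsilon> = growth \<epsilon> * ((1 + norm k * \<epsilon>) * (C1 + \<delta>3 \<epsilon>) + 2 * (\<bar>\<alpha>\<bar> * M * C)) + (C1 + C2)" for \<epsilon>
  define \<delta> where "\<delta> \<epsilon> = (\<delta>1 \<epsilon> + \<delta>2 \<epsilon>) * exp_l2_norm + \<beta> \<epsilon> * sqrt (2 * \<epsilon>)" for \<epsilon>
  have "(\<beta> \<longlongrightarrow> growth 0 * ((1 + norm k * 0) * (C1 + 0) + 2 * (\<bar>\<alpha>\<bar> * M * C)) + (C1 + C2)) (at_right 0)"
    unfolding \<beta>_def[abs_def] by (intro tendsto_intros growth_tendsto id 3(1))
  from tendsto_add[OF tendsto_mult_right[OF tendsto_add[OF 1(3) 2(3)], of exp_l2_norm]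
      tendsto_mult[OF this tendsto_real_sqrt[OF tendsto_mult_left[OF id, of 2]]]]
  have \<delta>0: "(\<delta> \<longlongrightarrow> 0) (at_right 0)" by (simp add: \<delta>_def[abs_def])
  have "\<exists>u. (u, f + k\<^sup>2 *\<^sub>C u) \<in> H_eps \<epsilon> \<alpha> \<Psi> \<and>
    norm (u - l2_class (\<lambda>x. G f x + wave (left_amplitude_lim d0 m0 f) (right_amplitude_lim d0 m0 f) x)) \<le> \<delta> \<epsilon> * norm f" if e: "\<epsilon> > 0" for \<epsilon> f
  proof -
    define a b where "a = exp (- \<i> * k * of_real \<epsilon>) * left_amplitude \<epsilon> f" and "b = exp (- \<i> * k * of_real \<epsilon>) * right_amplitude \<epsilon> f"
    define a0 b0 where "a0 = left_amplitude_lim d0 m0 f" and "b0 = right_amplitude_lim d0 m0 f"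
    obtain v where v: "square_integrable v"
      "(l2_class (\<lambda>x. G f x + v x), f + k\<^sup>2 *\<^sub>C l2_class (\<lambda>x. G f x + v x)) \<in> H_eps \<epsilon> \<alpha> \<Psi>"
      "\<And>x. \<bar>x\<bar> > \<epsilon> \<Longrightarrow> v x = wave a b x"
      "\<And>x. \<bar>x\<bar> \<le> \<epsilon> \<Longrightarrow> norm (v x) \<le> growth \<epsilon> * ((1 + norm k * \<epsilon>) * norm (left_amplitude \<epsilon> f) + 2 * (\<bar>\<alpha>\<bar> * M * (C * norm f)))"
      using H_eps_resolvent[OF e, of f] unfolding a_def b_def by blast
    define w where "w x = v x - wave a0 b0 x" for x
    have ws: "square_integrable w"
      using square_integrable_add[OF v(1) square_integrable_minus[OF wave_square_integrable[of a0 b0]]]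
      by (simp add: w_def[abs_def])
    note s1 = square_integrable_add[OF G_sq(1)[of f] v(1)]
      and s2 = square_integrable_add[OF G_sq(1)[of f] wave_square_integrable[of a0 b0]]
    have eq: "l2_class (\<lambda>x. G f x + v x) - l2_class (\<lambda>x. G f x + wave a0 b0 x) = l2_class w"
      unfolding l2_eq_iff
      using l2_rep_diff[of "l2_class (\<lambda>x. G f x + v x)" "l2_class (\<lambda>x. G f x + wave a0 b0 x)"]
        l2_rep_class[OF s1] l2_rep_class[OF s2] l2_rep_class[OF ws]
      by eventually_elim (simp add: w_def)
    have "norm (l2_class w) \<le> ((\<delta>1 \<epsilon> + \<delta>2 \<epsilon>) * norm f) * exp_l2_norm + (\<beta> \<epsilon> * norm f) * sqrt (2 * \<epsilon>)"
    proof (rule l2_norm_bound[OF ws e])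
      have Cnn: "0 \<le> growth \<epsilon> * ((1 + norm k * \<epsilon>) * (C1 + \<delta>3 \<epsilon>) + 2 * (\<bar>\<alpha>\<bar> * M * C))"
        using growth_pos[of \<epsilon>] 1(2) 3(2)[of \<epsilon>] e C_nonneg M_nonneg by (intro mult_nonneg_nonneg add_nonneg_nonneg) auto
      show "0 \<le> (\<delta>1 \<epsilon> + \<delta>2 \<epsilon>) * norm f" using 1(4)[of \<epsilon>] 2(4)[of \<epsilon>] by simp
      show "0 \<le> \<beta> \<epsilon> * norm f" unfolding \<beta>_def using Cnn 1(2) 2(2) by simp
      show "norm (w x) \<le> ((\<delta>1 \<epsilon> + \<delta>2 \<epsilon>) * norm f) * exp (- Im k * \<bar>x\<bar>)" if x: "\<bar>x\<bar> > \<epsilon>" for x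
      proof -
        have "w x = wave (a - a0) (b - b0) x"
          unfolding w_def v(3)[OF x] wave_def by (simp add: algebra_simps)
        moreover have "norm (a - a0) \<le> (\<delta>1 \<epsilon> + \<delta>2 \<epsilon>) * norm f" "norm (b - b0) \<le> (\<delta>1 \<epsilon> + \<delta>2 \<epsilon>) * norm f"
          using 1(5)[OF e, of f] 2(5)[OF e, of f] mult_right_mono[OF 1(4)[of \<epsilon>] norm_ge_zero[of f]] mult_right_mono[OF 2(4)[of \<epsilon>] norm_ge_zero[of f]]
          unfolding a_def b_def a0_def b0_def distrib_right by linarith+
        ultimately show ?thesis by (simp only: wave_norm) (intro mult_right_mono, auto)
      qed
      show "norm (w x) \<le> \<beta> \<epsilon> * norm f" if x: "\<bar>x\<bar> \<le> \<epsilon>" for x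
      proof -
        have "norm (w x) \<le> norm (v x) + norm (wave a0 b0 x)" unfolding w_def by (rule norm_triangle_ineq4)
        moreover have "norm (wave a0 b0 x) \<le> (C1 + C2) * norm f"
        proof -
          have "norm (wave a0 b0 x) \<le> (norm a0 + norm b0) * 1"
            unfolding wave_norm using Im_k by (intro mult_mono) auto
          also have "\<dots> \<le> (C1 + C2) * norm f"
            using 1(1)[of f] 2(1)[of f] by (simp add: a0_def b0_def algebra_simps)
          finally show ?thesis .
        qed
        moreover have "norm (v x) \<le> (growth \<epsilon> * ((1 + norm k * \<epsilon>) * (C1 + \<delta>3 \<epsilon>) + 2 * (\<bar>\<alpha>\<bar> * M * C))) * norm f"
        proof -
          have "norm (left_amplitude \<epsilon> f) \<le> norm (left_amplitude_lim d0 m0 f) + norm (left_amplitude \<epsilon> f - left_amplitude_lim d0 m0 f)"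
            by (metis add.commute diff_add_cancel norm_triangle_ineq)
          also have "\<dots> \<le> (C1 + \<delta>3 \<epsilon>) * norm f"
            using 1(1)[of f] 3(3)[OF e, of f] by (simp add: algebra_simps)
          finally have c: "norm (left_amplitude \<epsilon> f) \<le> (C1 + \<delta>3 \<epsilon>) * norm f" .
          have "norm (v x) \<le> growth \<epsilon> * ((1 + norm k * \<epsilon>) * norm (left_amplitude \<epsilon> f) + 2 * (\<bar>\<alpha>\<bar> * M * (C * norm f)))"
            by (rule v(4)[OF x])
          also have "\<dots> \<le> growth \<epsilon> * ((1 + norm k * \<epsilon>) * ((C1 + \<delta>3 \<epsilon>) * norm f) + 2 * (\<bar>\<alpha>\<bar> * M * (C * norm f)))"
            using growth_pos[of \<epsilon>] e by (intro mult_left_mono add_right_mono c) auto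
          also have "\<dots> = (growth \<epsilon> * ((1 + norm k * \<epsilon>) * (C1 + \<delta>3 \<epsilon>) + 2 * (\<bar>\<alpha>\<bar> * M * C))) * norm f"
            by (simp add: algebra_simps)
          finally show ?thesis .
        qed
        ultimately show ?thesis unfolding \<beta>_def distrib_right by linarith
      qed
    qed
    then have "norm (l2_class w) \<le> \<delta> \<epsilon> * norm f" by (simp add: \<delta>_def algebra_simps)
    then show ?thesis
      using v(2) unfolding a0_def[symmetric] b0_def[symmetric] eq[symmetric] by blast
  qed
  with \<delta>0 show ?thesis by blast
qed

end

section \<open>Resonances and the limit operator\<close>

context squeezed_potential
begin

lemma neumann_solves:
  assumes w: "neumann_solution \<alpha> \<Psi> w"
  obtains w1 where "solves (q 0) (\<lambda>x. 0) (\<lambda>x. of_real (w x)) (\<lambda>x. of_real (w1 x))" "w1 (-1) = 0" "w1 1 = 0"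
proof -
  obtain w1 w2 where *: "\<forall>\<xi>\<in>{-1..1}. (w has_real_derivative w1 \<xi>) (at \<xi> within {-1..1})"
    "continuous_on {-1..1} w1"
    "\<forall>\<xi>\<in>{-1<..<1}. (w1 has_real_derivative w2 \<xi>) (at \<xi>) \<and> - w2 \<xi> + \<alpha> * \<Psi> \<xi> * w \<xi> = 0"
    "w1 (-1) = 0" "w1 1 = 0"
    using w unfolding neumann_solution_def by blast
  have cw: "continuous_on {-1..1} w"
    unfolding continuous_on_eq_continuous_within using *(1) DERIV_continuous by blast
  define g where "g \<xi> = \<alpha> * \<Psi> \<xi> * w \<xi>" for \<xi>
  have cg: "continuous_on {-1..1} g" unfolding g_def[abs_def]
    by (intro continuous_intros continuous_on_subset[OF \<Psi>_cont] cw) auto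
  have w1: "w1 x = integral {-1..x} g" if x: "x \<in> {-1..1}" for x
  proof -
    have "(g has_integral w1 x - w1 (-1)) {-1..x}"
    proof (rule fundamental_theorem_of_calculus_interior)
      show "-1 \<le> x" using x by simp
      show "continuous_on {-1..x} w1" using *(2) continuous_on_subset x by fastforce
      fix t assume "t \<in> {-1<..<x}"
      then have t: "t \<in> {-1<..<1}" using x by auto
      have "w2 t = g t" using *(3) t by (auto simp: g_def)
      moreover have "(w1 has_real_derivative w2 t) (at t)" using *(3) t by blast
      ultimately show "(w1 has_vector_derivative g t) (at t)"
        unfolding has_real_derivative_iff_has_vector_derivative[symmetric] by simp
    qed
    then show ?thesis using *(4) by (simp add: integral_unique)
  qed
  \<comment> \<open>The equation holds in the open interval only; the integral form extends it to the end points.\<close>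
  have dw1: "(w1 has_vector_derivative g x) (at x within {-1..1})" if x: "x \<in> {-1..1}" for x
    by (rule has_vector_derivative_transform[OF x _ integral_has_vector_derivative[OF cg x]]) (simp add: w1)
  have "solves (q 0) (\<lambda>x. 0) (\<lambda>x. of_real (w x)) (\<lambda>x. of_real (w1 x))"
    unfolding solves_def
  proof (intro ballI conjI)
    fix x :: real assume x: "x \<in> {-1..1}"
    show "((\<lambda>x. complex_of_real (w x)) has_vector_derivative of_real (w1 x)) (at x within {-1..1})"
      using *(1) x by (intro has_vector_derivative_of_real) blast
    show "((\<lambda>x. complex_of_real (w1 x)) has_vector_derivative q 0 x * of_real (w x) + 0) (at x within {-1..1})"
      using has_vector_derivative_of_real[OF dw1[OF x, folded has_real_derivative_iff_has_vector_derivative]] by (simp add: q_def g_def)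
  qed
  then show ?thesis using that *(4,5) by blast
qed

text \<open>Both statements are constant Wronskians: of \<open>w\<close> with \<open>H0\<close>, whose derivative vanishes at \<open>1\<close>, and of
  \<open>w\<close> with \<open>H1\<close>, which itself vanishes at \<open>1\<close>. The value \<open>w (-1)\<close> is not zero, because otherwise the
  Cauchy data of \<open>w\<close> at \<open>-1\<close> would be zero.\<close>

lemma neumann_transfer:
  assumes w: "neumann_solution \<alpha> \<Psi> w"
  shows "t21 0 = 0" "t11 0 = of_real (w 1 / w (-1))"
proof -
  obtain w1 where s: "solves (q 0) (\<lambda>x. 0) (\<lambda>x. of_real (w x)) (\<lambda>x. of_real (w1 x))" "w1 (-1) = 0" "w1 1 = 0"
    by (rule neumann_solves[OF w])
  have "w (-1) \<noteq> 0"
  proof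
    assume 0: "w (-1) = 0"
    have "w x = 0" if "x \<in> {-1..1}" for x
      using inner_bound_initial[OF s(1) _ that, of 0] s(2) 0 by simp
    then show False using w unfolding neumann_solution_def by blast
  qed
  moreover have "w (-1) * t21 0 = 0"
    using solves_wronskian_constant[OF s(1) H0(1), of "-1"] s(2,3) by (simp add: H0 t21_def)
  moreover have "of_real (w 1) = of_real (w (-1)) * t11 0"
    using solves_wronskian_constant[OF s(1) H1(1), of "-1"] s(2,3) by (simp add: H1 t11_def)
  ultimately show "t21 0 = 0" "t11 0 = of_real (w 1 / w (-1))" by simp_all
qed

text \<open>At \<open>\<epsilon> = 0\<close> the equation is real, so the real part of \<open>H0\<close> solves it; \<open>t21 0 = 0\<close> is its Neumann
  condition at \<open>-1\<close>.\<close>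

lemma resonant_if_t21_zero:
  assumes "t21 0 = 0"
  shows "\<alpha> \<in> resonant_set \<Psi>"
proof -
  define w where "w x = Re (fst (H0 0) x)" for x
  define w1 where "w1 x = Re (snd (H0 0) x)" for x
  have d: "(w has_real_derivative w1 x) (at x within {-1..1})"
    "(w1 has_real_derivative \<alpha> * \<Psi> x * w x) (at x within {-1..1})" if "x \<in> {-1..1}" for x
  proof -
    have s: "(fst (H0 0) has_vector_derivative snd (H0 0) x) (at x within {-1..1})"
      "(snd (H0 0) has_vector_derivative q 0 x * fst (H0 0) x + 0) (at x within {-1..1})"
      using bspec[OF H0(1)[unfolded solves_def] that] by blast+
    show "(w has_real_derivative w1 x) (at x within {-1..1})"
      "(w1 has_real_derivative \<alpha> * \<Psi> x * w x) (at x within {-1..1})"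
      using bounded_linear.has_vector_derivative[OF bounded_linear_Re s(1)]
        bounded_linear.has_vector_derivative[OF bounded_linear_Re s(2)]
      unfolding has_real_derivative_iff_has_vector_derivative w_def[abs_def] w1_def[abs_def] by (simp_all add: q_def)
  qed
  have cw1: "continuous_on {-1..1} w1"
    unfolding continuous_on_eq_continuous_within using d(2) DERIV_continuous by blast
  have inner: "\<forall>\<xi>\<in>{-1<..<1}. (w1 has_real_derivative \<alpha> * \<Psi> \<xi> * w \<xi>) (at \<xi>) \<and> - (\<alpha> * \<Psi> \<xi> * w \<xi>) + \<alpha> * \<Psi> \<xi> * w \<xi> = 0"
  proof
    fix \<xi> :: real assume "\<xi> \<in> {-1<..<1}"
    then show "(w1 has_real_derivative \<alpha> * \<Psi> \<xi> * w \<xi>) (at \<xi>) \<and> - (\<alpha> * \<Psi> \<xi> * w \<xi>) + \<alpha> * \<Psi> \<xi> * w \<xi> = 0"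
      using d(2)[of \<xi>] by (simp add: at_within_Icc_at)
  qed
  have bc: "w1 (-1) = 0" "w1 1 = 0" "w 1 \<noteq> 0"
    using assms by (simp_all add: w_def w1_def H0 t21_def)
  have "neumann_solution \<alpha> \<Psi> w"
    unfolding neumann_solution_def
  proof (intro conjI exI)
    show "\<forall>\<xi>\<in>{-1..1}. (w has_real_derivative w1 \<xi>) (at \<xi> within {-1..1})" using d(1) by blast
    show "\<exists>\<xi>\<in>{-1..1}. w \<xi> \<noteq> 0" using bc(3) by (intro bexI[of _ 1]) auto
  qed (rule cw1 inner bc)+
  then show ?thesis by (auto simp: resonant_set_def)
qed

lemma resonant_iff: "\<alpha> \<in> resonant_set \<Psi> \<longleftrightarrow> t21 0 = 0"
proof
  assume "\<alpha> \<in> resonant_set \<Psi>"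
  then obtain w where "neumann_solution \<alpha> \<Psi> w" unfolding resonant_set_def by blast
  then show "t21 0 = 0" by (rule neumann_transfer(1))
qed (rule resonant_if_t21_zero)

lemma coupling_transfer:
  assumes "\<alpha> \<in> resonant_set \<Psi>"
  shows "of_real (coupling \<Psi> \<alpha>) = t11 0" "coupling \<Psi> \<alpha> \<noteq> 0" "t22 0 = of_real (1 / coupling \<Psi> \<alpha>)"
proof -
  obtain w where w: "neumann_solution \<alpha> \<Psi> w" using assms by (auto simp: resonant_set_def)
  have "coupling \<Psi> \<alpha> = w 1 / w (-1)"
    unfolding coupling_def
  proof (rule the_equality)
    show "\<exists>v. neumann_solution \<alpha> \<Psi> v \<and> w 1 / w (-1) = v 1 / v (-1)" using w by blast
    fix \<theta> assume "\<exists>v. neumann_solution \<alpha> \<Psi> v \<and> \<theta> = v 1 / v (-1)"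
    then obtain v where v: "neumann_solution \<alpha> \<Psi> v" "\<theta> = v 1 / v (-1)" by blast
    have "complex_of_real \<theta> = of_real (w 1 / w (-1))"
      using neumann_transfer(2)[OF v(1)] neumann_transfer(2)[OF w] v(2) by simp
    then show "\<theta> = w 1 / w (-1)" by (simp only: of_real_eq_iff)
  qed
  then show t: "of_real (coupling \<Psi> \<alpha>) = t11 0" using neumann_transfer(2)[OF w] by simp
  have "t11 0 * t22 0 = 1" using transfer_det[of 0] neumann_transfer(1)[OF w] by simp
  then have *: "of_real (coupling \<Psi> \<alpha>) * t22 0 = 1" unfolding t .
  then show "coupling \<Psi> \<alpha> \<noteq> 0" by auto
  then show "t22 0 = of_real (1 / coupling \<Psi> \<alpha>)" using * by (simp add: field_simps)
qed

end

context squeezed_resolvent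
begin

text \<open>Here \<open>\<Delta>\<close> tends to \<open>t21 0\<close>, which is not zero.\<close>

lemma coefficients_nonresonant:
  assumes "t21 0 \<noteq> 0"
  shows "(gain \<longlongrightarrow> 0) (at_right 0)" "(t21_ratio \<longlongrightarrow> 1) (at_right 0)"
proof -
  have id: "((\<lambda>\<epsilon>. \<epsilon>) \<longlongrightarrow> (0::real)) (at_right 0)" by (rule tendsto_ident_at)
  have "((\<lambda>\<epsilon>. t21 \<epsilon> - \<i> * k * of_real \<epsilon> * (t11 \<epsilon> + t22 \<epsilon>) - k\<^sup>2 * (of_real \<epsilon>)\<^sup>2 * t12 \<epsilon>)
     \<longlongrightarrow> t21 0 - \<i> * k * of_real 0 * (t11 0 + t22 0) - k\<^sup>2 * (of_real 0)\<^sup>2 * t12 0) (at_right 0)"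
    by (intro tendsto_intros transfer_tendsto id)
  then have D: "(\<Delta> \<longlongrightarrow> t21 0) (at_right 0)" by (simp add: \<Delta>_def[abs_def])
  have "((\<lambda>\<epsilon>. of_real \<epsilon> / \<Delta> \<epsilon>) \<longlongrightarrow> of_real 0 / t21 0) (at_right 0)"
    by (intro tendsto_intros D id assms)
  then show "(gain \<longlongrightarrow> 0) (at_right 0)" by (simp add: gain_def[abs_def])
  have "((\<lambda>\<epsilon>. t21 \<epsilon> / \<Delta> \<epsilon>) \<longlongrightarrow> t21 0 / t21 0) (at_right 0)"
    by (intro tendsto_intros D transfer_tendsto assms)
  then show "(t21_ratio \<longlongrightarrow> 1) (at_right 0)" using assms by (simp add: t21_ratio_def[abs_def])
qed

text \<open>The entry \<open>t21\<close> is \<open>O (\<epsilon>\<^sup>2)\<close>, so the term of first order dominates \<open>\<Delta>\<close>.\<close>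

lemma coefficients_resonant:
  assumes r: "t21 0 = 0" and nz: "t11 0 + t22 0 \<noteq> 0"
  shows "(gain \<longlongrightarrow> inverse (- \<i> * k * (t11 0 + t22 0))) (at_right 0)" "(t21_ratio \<longlongrightarrow> 0) (at_right 0)"
proof -
  have id: "((\<lambda>\<epsilon>. \<epsilon>) \<longlongrightarrow> (0::real)) (at_right 0)" by (rule tendsto_ident_at)
  have k0: "k \<noteq> 0" using Im_k by auto
  have t: "((\<lambda>\<epsilon>. t21 \<epsilon> / of_real \<epsilon>) \<longlongrightarrow> 0) (at_right 0)"
  proof (rule Lim_null_comparison[OF _ transfer_error_tendsto(1)])
    show "\<forall>\<^sub>F \<epsilon> in at_right 0. norm (t21 \<epsilon> / of_real \<epsilon>) \<le> transfer_error \<epsilon> / \<epsilon>"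
      by (rule eventually_at_rightI[of 0 1])
         (use transfer_perturbation(3) r in \<open>auto simp: norm_divide intro!: divide_right_mono\<close>)
  qed
  define D where "D \<epsilon> = t21 \<epsilon> / of_real \<epsilon> - \<i> * k * (t11 \<epsilon> + t22 \<epsilon>) - k\<^sup>2 * of_real \<epsilon> * t12 \<epsilon>" for \<epsilon> :: real
  have "(D \<longlongrightarrow> 0 - \<i> * k * (t11 0 + t22 0) - k\<^sup>2 * of_real 0 * t12 0) (at_right 0)"
    unfolding D_def[abs_def] by (intro tendsto_intros transfer_tendsto id t)
  then have D: "(D \<longlongrightarrow> - \<i> * k * (t11 0 + t22 0)) (at_right 0)" by simp
  have lim: "((\<lambda>\<epsilon>. inverse (D \<epsilon>)) \<longlongrightarrow> inverse (- \<i> * k * (t11 0 + t22 0))) (at_right 0)"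
    using nz k0 by (intro tendsto_inverse D) auto
  have D\<Delta>: "D \<epsilon> = \<Delta> \<epsilon> / of_real \<epsilon>" if "\<epsilon> > 0" for \<epsilon>
    using that by (simp add: D_def \<Delta>_def field_simps power2_eq_square)
  have dD: "\<forall>\<^sub>F \<epsilon> in at_right 0. inverse (D \<epsilon>) = gain \<epsilon>"
    by (rule eventually_at_rightI[of 0 1]) (auto simp: D\<Delta> gain_def)
  from lim show d: "(gain \<longlongrightarrow> inverse (- \<i> * k * (t11 0 + t22 0))) (at_right 0)"
    unfolding tendsto_cong[OF dD] .
  have mD: "\<forall>\<^sub>F \<epsilon> in at_right 0. t21 \<epsilon> / of_real \<epsilon> * gain \<epsilon> = t21_ratio \<epsilon>"
    by (rule eventually_at_rightI[of 0 1]) (auto simp: gain_def t21_ratio_def)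
  from tendsto_mult[OF t d] show "(t21_ratio \<longlongrightarrow> 0) (at_right 0)"
    unfolding tendsto_cong[OF mD] by simp
qed

lemma limit_pieces:
  fixes a b :: complex
  defines "Ym \<equiv> \<lambda>f x. G f x + a * exp (- \<i> * k * of_real x)" and "Yp \<equiv> \<lambda>f x. G f x + b * exp (\<i> * k * of_real x)"
    and "Ym1 \<equiv> \<lambda>f x. G1 f x + - \<i> * k * (a * exp (- \<i> * k * of_real x))"
    and "Yp1 \<equiv> \<lambda>f x. G1 f x + \<i> * k * (b * exp (\<i> * k * of_real x))"
  shows "primitive_on UNIV (Ym f) (Ym1 f)" "primitive_on UNIV (Ym1 f) (\<lambda>x. - k\<^sup>2 * Ym f x - l2_rep f x)"
    "primitive_on UNIV (Yp f) (Yp1 f)" "primitive_on UNIV (Yp1 f) (\<lambda>x. - k\<^sup>2 * Yp f x - l2_rep f x)"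
    "square_integrable (\<lambda>x. if x < 0 then Ym f x else Yp f x)"
    "square_integrable (\<lambda>x. if x < 0 then Ym1 f x else Yp1 f x)"
    "(\<lambda>x. if x < 0 then Ym f x else Yp f x) = (\<lambda>x. G f x + wave a b x)"
proof -
  show "primitive_on UNIV (Ym f) (Ym1 f)" "primitive_on UNIV (Yp f) (Yp1 f)"
    unfolding Ym_def Yp_def Ym1_def Yp1_def by (rule primitive_on_add[OF G wave_primitives(1)] primitive_on_add[OF G wave_primitives(3)])+
  show "primitive_on UNIV (Ym1 f) (\<lambda>x. - k\<^sup>2 * Ym f x - l2_rep f x)"
    unfolding Ym_def Ym1_def
    by (rule primitive_on_cong[OF primitive_on_add[OF G1 wave_primitives(2)]]) (simp_all add: is_interval_univ algebra_simps)
  show "primitive_on UNIV (Yp1 f) (\<lambda>x. - k\<^sup>2 * Yp f x - l2_rep f x)"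
    unfolding Yp_def Yp1_def
    by (rule primitive_on_cong[OF primitive_on_add[OF G1 wave_primitives(4)]]) (simp_all add: is_interval_univ algebra_simps)
  show eq: "(\<lambda>x. if x < 0 then Ym f x else Yp f x) = (\<lambda>x. G f x + wave a b x)"
    by (auto simp: Ym_def Yp_def wave_def)
  show "square_integrable (\<lambda>x. if x < 0 then Ym f x else Yp f x)"
    unfolding eq by (intro square_integrable_add G_sq wave_square_integrable)
  have eq1: "(\<lambda>x. if x < 0 then Ym1 f x else Yp1 f x) = (\<lambda>x. G1 f x + wave (- \<i> * k * a) (\<i> * k * b) x)"
    by (auto simp: Ym1_def Yp1_def wave_def)
  show "square_integrable (\<lambda>x. if x < 0 then Ym1 f x else Yp1 f x)"
    unfolding eq1 by (intro square_integrable_add G_sq wave_square_integrable)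
qed

text \<open>The constant comes from \<open>l2_norm_bound\<close> with the interval \<open>[-1, 1]\<close>.\<close>

lemma limit_norm:
  "norm (l2_class (\<lambda>x. G f x + wave a b x)) \<le> C * norm f + (norm a + norm b) * (exp_l2_norm + sqrt 2)"
proof -
  have "l2_class (\<lambda>x. G f x + wave a b x) = l2_class (G f) + l2_class (wave a b)"
    unfolding l2_eq_iff
    using l2_rep_class[OF square_integrable_add[OF G_sq(1)[of f] wave_square_integrable[of a b]]]
      l2_rep_class[OF G_sq(1)[of f]] l2_rep_class[OF wave_square_integrable[of a b]]
      l2_rep_add[of "l2_class (G f)" "l2_class (wave a b)"]
    by eventually_elim simp
  moreover have "norm (l2_class (wave a b)) \<le> (norm a + norm b) * exp_l2_norm + (norm a + norm b) * sqrt (2 * 1)"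
  proof (rule l2_norm_bound[OF wave_square_integrable])
    show o: "norm (wave a b x) \<le> (norm a + norm b) * exp (- Im k * \<bar>x\<bar>)" for x
      unfolding wave_norm by (intro mult_right_mono) auto
    show "norm (wave a b x) \<le> norm a + norm b" for x
    proof -
      have "(norm a + norm b) * exp (- Im k * \<bar>x\<bar>) \<le> (norm a + norm b) * 1"
        using Im_k by (intro mult_left_mono) auto
      then show ?thesis using o[of x] by simp
    qed
  qed auto
  ultimately show ?thesis
    using norm_triangle_ineq[of "l2_class (G f)" "l2_class (wave a b)"] G_norm[of f] by (simp add: algebra_simps)
qed

text \<open>Both cases in one statement: with the limits of the coefficients inserted, the two amplitudes are
  exactly those for which the limit function satisfies the interface condition of \<open>H_lim\<close>.\<close>

lemma limit_coefficients:
  "\<exists>d0 m0. (gain \<longlongrightarrow> d0) (at_right 0) \<and> (t21_ratio \<longlongrightarrow> m0) (at_right 0) \<and>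
    (\<forall>f. (l2_class (\<lambda>x. G f x + wave (left_amplitude_lim d0 m0 f) (right_amplitude_lim d0 m0 f) x),
      f + k\<^sup>2 *\<^sub>C l2_class (\<lambda>x. G f x + wave (left_amplitude_lim d0 m0 f) (right_amplitude_lim d0 m0 f) x)) \<in> H_lim \<alpha> \<Psi>)"
proof (cases "\<alpha> \<in> resonant_set \<Psi>")
  case False
  then have "t21 0 \<noteq> 0" by (simp add: resonant_iff)
  moreover have "(l2_class (\<lambda>x. G f x + wave (left_amplitude_lim 0 1 f) (right_amplitude_lim 0 1 f) x),
      f + k\<^sup>2 *\<^sub>C l2_class (\<lambda>x. G f x + wave (left_amplitude_lim 0 1 f) (right_amplitude_lim 0 1 f) x)) \<in> H_lim \<alpha> \<Psi>" for f
  proof -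
    define a b where "a = left_amplitude_lim 0 1 f" and "b = right_amplitude_lim 0 1 f"
    have "a = - G f 0" by (simp add: a_def left_amplitude_lim_def)
    moreover have "b = - G f 0" by (simp add: b_def right_amplitude_lim_def a_def[symmetric] calculation)
    ultimately show ?thesis
      unfolding H_lim_def if_not_P[OF False] a_def[symmetric] b_def[symmetric] limit_pieces(7)[symmetric]
      by (intro Dirichlet_memberI[OF limit_pieces(1-6)]) simp_all
  qed
  ultimately show ?thesis using coefficients_nonresonant by blast
next
  case True
  define \<theta> where "\<theta> = coupling \<Psi> \<alpha>"
  note ct = coupling_transfer[OF True, folded \<theta>_def]
  define T where "T = complex_of_real \<theta>"
  have T0: "T \<noteq> 0" using ct(2) by (simp add: T_def)
  have t: "t11 0 = T" "t22 0 = inverse T" using ct by (simp_all add: T_def inverse_eq_divide)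
  have "complex_of_real (\<theta> * \<theta> + 1) \<noteq> 0" unfolding of_real_eq_0_iff using zero_le_square[of \<theta>] by linarith
  then have TT: "T * T + 1 \<noteq> 0" by (simp add: T_def)
  then have nz: "t11 0 + t22 0 \<noteq> 0" unfolding t using T0 by (simp add: field_simps)
  have k0: "k \<noteq> 0" using Im_k by auto
  have r: "t21 0 = 0" using True by (simp add: resonant_iff)
  define d0 where "d0 = inverse (- \<i> * k * (t11 0 + t22 0))"
  have d0: "- \<i> * k * (T * T + 1) * d0 = T"
  proof -
    have "T + inverse T = (T * T + 1) / T" using T0 by (simp add: field_simps)
    then have "d0 = T / (- \<i> * k * (T * T + 1))"
      unfolding d0_def t by (simp only: times_divide_eq_right inverse_eq_divide divide_divide_eq_right mult_1)
    moreover have "- \<i> * k * (T * T + 1) \<noteq> 0" using k0 TT by simp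
    ultimately show ?thesis by simp
  qed
  have "(l2_class (\<lambda>x. G f x + wave (left_amplitude_lim d0 0 f) (right_amplitude_lim d0 0 f) x),
      f + k\<^sup>2 *\<^sub>C l2_class (\<lambda>x. G f x + wave (left_amplitude_lim d0 0 f) (right_amplitude_lim d0 0 f) x)) \<in> H_lim \<alpha> \<Psi>" for f
  proof -
    define a b where "a = left_amplitude_lim d0 0 f" and "b = right_amplitude_lim d0 0 f"
    have b: "G f 0 + b = T * (G f 0 + a)"
      by (simp add: b_def right_amplitude_lim_def a_def[symmetric] t)
    then have b': "b = T * (G f 0 + a) - G f 0" by (simp add: algebra_simps)
    have "T * a = d0 * (T * (G1 f 0 - \<i> * k * G f 0) + \<i> * k * T * T * G f 0 - G1 f 0)"
      unfolding a_def left_amplitude_lim_def t using T0 by (simp add: field_simps)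
    then have "- \<i> * k * (T * T + 1) * (T * a) = T * (T * (G1 f 0 - \<i> * k * G f 0) + \<i> * k * T * T * G f 0 - G1 f 0)"
      using d0 by (metis mult.assoc)
    then have "T * (- \<i> * k * (T * T + 1) * a) = T * (T * (G1 f 0 - \<i> * k * G f 0) + \<i> * k * T * T * G f 0 - G1 f 0)"
      by (simp only: mult_ac)
    then have a: "- \<i> * k * (T * T + 1) * a = T * (G1 f 0 - \<i> * k * G f 0) + \<i> * k * T * T * G f 0 - G1 f 0"
      using T0 by (simp only: mult_left_cancel not_False_eq_True)
    have "T * (G1 f 0 + \<i> * k * b) = T * G1 f 0 + \<i> * k * T * (T * (G f 0 + a) - G f 0)"
      unfolding b' by (simp add: algebra_simps)
    also have "\<dots> = G1 f 0 + - \<i> * k * a"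
      using a by (simp add: algebra_simps)
    finally have "T * (G1 f 0 + \<i> * k * b) = G1 f 0 + - \<i> * k * a" .
    then show ?thesis
      unfolding H_lim_def if_P[OF True] a_def[symmetric] b_def[symmetric] limit_pieces(7)[symmetric]
      using b unfolding \<theta>_def[symmetric] T_def
      by (intro S_op_memberI[OF limit_pieces(1-6)]) simp_all
  qed
  then show ?thesis using coefficients_resonant[OF r nz] unfolding d0_def by blast
qed

lemma limit_resolvent:
  "\<exists>C' \<delta>. (\<delta> \<longlongrightarrow> 0) (at_right 0) \<and>
      (\<forall>f. \<exists>u0. (u0, f + k\<^sup>2 *\<^sub>C u0) \<in> H_lim \<alpha> \<Psi> \<and> norm u0 \<le> C' * norm f \<and>
        (\<forall>\<epsilon>>0. \<exists>u. (u, f + k\<^sup>2 *\<^sub>C u) \<in> H_eps \<epsilon> \<alpha> \<Psi> \<and> norm (u - u0) \<le> \<delta> \<epsilon> * norm f))"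
proof -
  obtain d0 m0 where l: "(gain \<longlongrightarrow> d0) (at_right 0)" "(t21_ratio \<longlongrightarrow> m0) (at_right 0)"
    and H: "\<And>f. (l2_class (\<lambda>x. G f x + wave (left_amplitude_lim d0 m0 f) (right_amplitude_lim d0 m0 f) x),
      f + k\<^sup>2 *\<^sub>C l2_class (\<lambda>x. G f x + wave (left_amplitude_lim d0 m0 f) (right_amplitude_lim d0 m0 f) x)) \<in> H_lim \<alpha> \<Psi>"
    using limit_coefficients by blast
  obtain \<delta> where \<delta>: "(\<delta> \<longlongrightarrow> 0) (at_right 0)" "\<And>\<epsilon> f. \<epsilon> > 0 \<Longrightarrow> \<exists>u. (u, f + k\<^sup>2 *\<^sub>C u) \<in> H_eps \<epsilon> \<alpha> \<Psi> \<and>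
    norm (u - l2_class (\<lambda>x. G f x + wave (left_amplitude_lim d0 m0 f) (right_amplitude_lim d0 m0 f) x)) \<le> \<delta> \<epsilon> * norm f"
    using resolvent_convergence[OF l] by blast
  obtain C1 where C1: "\<And>f. norm (left_amplitude_lim d0 m0 f) \<le> C1 * norm f"
    by (rule functional_tendstoE[OF amplitude_tendsto(1)[OF l]]) blast
  obtain C2 where C2: "\<And>f. norm (right_amplitude_lim d0 m0 f) \<le> C2 * norm f"
    by (rule functional_tendstoE[OF amplitude_tendsto(2)[OF l]]) blast
  have exp_l2_norm: "exp_l2_norm \<ge> 0" by (simp add: exp_l2_norm_def)
  have "norm (l2_class (\<lambda>x. G f x + wave (left_amplitude_lim d0 m0 f) (right_amplitude_lim d0 m0 f) x)) \<le> (C + (C1 + C2) * (exp_l2_norm + sqrt 2)) * norm f" for f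
  proof -
    have "norm (left_amplitude_lim d0 m0 f) + norm (right_amplitude_lim d0 m0 f) \<le> (C1 + C2) * norm f"
      using C1[of f] C2[of f] by (simp add: algebra_simps)
    then have "(norm (left_amplitude_lim d0 m0 f) + norm (right_amplitude_lim d0 m0 f)) * (exp_l2_norm + sqrt 2) \<le> ((C1 + C2) * norm f) * (exp_l2_norm + sqrt 2)"
      using exp_l2_norm by (intro mult_right_mono) auto
    then show ?thesis
      using limit_norm[of f "left_amplitude_lim d0 m0 f" "right_amplitude_lim d0 m0 f"] by (simp add: algebra_simps)
  qed
  with H \<delta> show ?thesis by blast
qed

end

section \<open>Norm resolvent convergence\<close>

text \<open>If \<open>z\<close> is not real, then neither the real nor the imaginary part of its square roots is zero.\<close>

lemma complex_square_root_upper: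
  assumes "z \<notin> \<real>"
  obtains k where "k\<^sup>2 = z" "Im k > 0" "Re k \<noteq> 0"
proof -
  define c where "c = csqrt z"
  have c: "c\<^sup>2 = z" by (simp add: c_def)
  have "Im z \<noteq> 0" using assms by (simp add: complex_is_Real_iff)
  moreover have "Im z = 2 * (Re c * Im c)" by (simp flip: c add: power2_eq_square)
  ultimately have nz: "Re c \<noteq> 0" "Im c \<noteq> 0" by auto
  show ?thesis
  proof (cases "Im c > 0")
    case True then show ?thesis using that[of c] c nz by simp
  next
    case False then show ?thesis using that[of "- c"] c nz by simp
  qed
qed

text \<open>The potential vanishes outside \<open>[-1, 1]\<close>, and by continuity at the end points.\<close>

lemma delta'_like_regular:
  assumes "delta'_like \<Psi>"
  shows "continuous_on UNIV \<Psi>" "\<bar>x\<bar> \<ge> 1 \<Longrightarrow> \<Psi> x = 0" "\<exists>M. \<forall>x. \<bar>\<Psi> x\<bar> \<le> M"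
proof -
  have P: "\<Psi> \<in> C0_infty UNIV" and supp: "closure (support_on UNIV \<Psi>) = {-1..1}"
    using assms by (auto simp: delta'_like_def)
  show c: "continuous_on UNIV \<Psi>" by (rule smooth_continuous[OF C0_infty_smooth[OF P]])
  have out: "\<Psi> x = 0" if "x \<notin> {-1..1}" for x
    using that closure_subset[of "support_on UNIV \<Psi>"] unfolding supp by (auto simp: support_on_def)
  have cl: "closed {x. \<Psi> x = 0}"
    using continuous_closed_preimage_constant[OF c closed_UNIV, of 0] by simp
  have "closure {1<..} \<subseteq> {x. \<Psi> x = 0}" "closure {..<-1} \<subseteq> {x. \<Psi> x = 0}"
    using out by (intro closure_minimal cl; force)+
  then have z: "\<Psi> x = 0" if "x \<ge> 1 \<or> x \<le> -1" for x
    using that by auto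
  show "\<Psi> x = 0" if "\<bar>x\<bar> \<ge> 1"
    using that by (intro z) linarith
  obtain M where M: "\<And>x. x \<in> {-1..1} \<Longrightarrow> norm (\<Psi> x) \<le> M"
    using compact_imp_bounded[OF compact_continuous_image[OF continuous_on_subset[OF c subset_UNIV] compact_Icc]]
    unfolding bounded_iff by blast
  have "\<bar>\<Psi> x\<bar> \<le> \<bar>M\<bar>" for x
    using M[of x] out[of x] by (cases "x \<in> {-1..1}") auto
  then show "\<exists>M. \<forall>x. \<bar>\<Psi> x\<bar> \<le> M" by blast
qed

theorem theorem4p1:
  fixes \<Psi> :: "real \<Rightarrow> real" and \<alpha> :: real
  assumes "delta'_like \<Psi>"
  shows "norm_resolvent_convergent (\<lambda>\<epsilon>. H_eps \<epsilon> \<alpha> \<Psi>) (H_lim \<alpha> \<Psi>)"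
proof -
  note \<Psi> = delta'_like_regular[OF assms]
  obtain M where M: "\<And>x. \<bar>\<Psi> x\<bar> \<le> M" using \<Psi>(3) by blast
  obtain \<rho> where \<rho>: "\<rho> \<in> C0_infty UNIV" "(LBINT x. \<rho> x) = 1"
    by (rule delta'_like_mollifier[OF assms]) blast
  have Im: "Im z \<noteq> 0" if "z \<notin> \<real>" for z using that by (simp add: complex_is_Real_iff)
  show ?thesis
  proof (rule norm_resolvent_convergentI)
    show "linear_graph (H_lim \<alpha> \<Psi>)"
      unfolding H_lim_def S_minus_def S_plus_def
      by (simp add: linear_graph_S_op linear_graph_direct_sum linear_graph_Dirichlet)
    show "u = 0" if "z \<notin> \<real>" "(u, z *\<^sub>C u) \<in> H_lim \<alpha> \<Psi>" for z u
      using that(2) S_op_kernel[OF \<rho> Im[OF that(1)]] Dirichlet_kernel[OF \<rho> Im[OF that(1)]]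
      unfolding H_lim_def by (auto split: if_splits)
    show "linear_graph (H_eps \<epsilon> \<alpha> \<Psi>)" for \<epsilon> by (rule linear_graph_H_eps)
    show "u = 0" if "\<epsilon> > 0" "z \<notin> \<real>" "(u, z *\<^sub>C u) \<in> H_eps \<epsilon> \<alpha> \<Psi>" for \<epsilon> z u
      by (rule H_eps_kernel[OF \<rho> \<Psi>(1) that(1) Im[OF that(2)] that(3)])
    fix z :: complex assume "z \<notin> \<real>"
    then obtain k where k: "k\<^sup>2 = z" "Im k > 0" "Re k \<noteq> 0" by (rule complex_square_root_upper)
    obtain C where C: "C \<ge> 0" "\<forall>f. \<exists>g g1. primitive_on UNIV g g1 \<and>
      primitive_on UNIV g1 (\<lambda>x. - k\<^sup>2 * g x - l2_rep f x) \<and>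
      square_integrable g \<and> square_integrable g1 \<and> norm (l2_class g) \<le> C * norm f \<and>
      (\<forall>x. norm (g x) \<le> C * norm f \<and> norm (g1 x) \<le> C * norm f)"
      using free_resolvent[OF k(2)] by blast
    obtain G where "\<forall>f. \<exists>g1. primitive_on UNIV (G f) g1 \<and>
      primitive_on UNIV g1 (\<lambda>x. - k\<^sup>2 * G f x - l2_rep f x) \<and>
      square_integrable (G f) \<and> square_integrable g1 \<and> norm (l2_class (G f)) \<le> C * norm f \<and>
      (\<forall>x. norm (G f x) \<le> C * norm f \<and> norm (g1 x) \<le> C * norm f)"
      using choice[OF C(2)] by blast
    from choice[OF this] obtain G1 where G: "\<And>f. primitive_on UNIV (G f) (G1 f) \<and>
      primitive_on UNIV (G1 f) (\<lambda>x. - k\<^sup>2 * G f x - l2_rep f x) \<and>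
      square_integrable (G f) \<and> square_integrable (G1 f) \<and> norm (l2_class (G f)) \<le> C * norm f \<and>
      (\<forall>x. norm (G f x) \<le> C * norm f \<and> norm (G1 f x) \<le> C * norm f)"
      by blast
    interpret squeezed_resolvent \<Psi> \<alpha> k M G G1 C
    proof unfold_locales
      show "continuous_on UNIV \<Psi>" by (rule \<Psi>(1))
      show "\<Psi> x = 0" if "1 \<le> \<bar>x\<bar>" for x using that by (rule \<Psi>(2))
      show "\<bar>\<Psi> x\<bar> \<le> M" for x by (rule M)
      show "0 < Im k" "Re k \<noteq> 0" by (rule k)+
      show "C \<ge> 0" by (rule C(1))
    qed (use G in blast)+
    show "\<exists>C \<delta>. (\<delta> \<longlongrightarrow> 0) (at_right 0) \<and>
      (\<forall>f. \<exists>u0. (u0, f + z *\<^sub>C u0) \<in> H_lim \<alpha> \<Psi> \<and> norm u0 \<le> C * norm f \<and>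
        (\<forall>\<epsilon>>0. \<exists>u. (u, f + z *\<^sub>C u) \<in> H_eps \<epsilon> \<alpha> \<Psi> \<and> norm (u - u0) \<le> \<delta> \<epsilon> * norm f))"
      using limit_resolvent unfolding k(1) .
  qed
qed

end
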